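(* Let $p>2$ and suppose that hypothesis (H), i.e. all the conditions listed in the context, holds. Then there exists $u\in C^1((\lambda_0,\lambda_\infty),Y)$ such that, for every $\lambda\in(\lambda_0,\lambda_\infty)$, $u(\lambda)\in X_p$, $u(\lambda)>0$ on $[0,1)$, and $(\lambda,u(\lambda))$ is the unique non-trivial solution, for this value of $\lambda$, of $$-(r^{N-1}\phi_p(u'))'=\lambda r^{N-1}f(r,u),\quad 0<r<1,\qquad u'(0)=u(1)=0.$$ Furthermore, $$\lim_{\lambda\to\lambda_0}|u(\lambda)|_0=0\quad\text{and}\quad \lim_{\lambda\to\lambda_\infty}|u(\lambda)|_0=\infty .$$
   Context: $N\ge1$ is an integer, $p>2$, $\phi_p(\xi):=|\xi|^{p-2}\xi$ for $\xi\in\mathbb{R}$, $\mathbb{R}^*:=\mathbb{R}\setminus\{0\}$, and $'$ is differentiation in $r$. $Y:=C^0[0,1]$ with sup norm $|\cdot|_0$, and $X_p:=\{u\in C^1[0,1]:\phi_p(u')\in C^1[0,1],\ u'(0)=u(1)=0\}$. A solution of the boundary value problem is a pair $(\lambda,u)$ with $\lambda\in\mathbb{R}$ and $u\in C^1[0,1]$ with $\phi_p(u')\in C^1[0,1]$ that satisfies the problem; it is non-trivial if $u\not\equiv0$. The function $f:[0,\infty)\times\mathbb{R}\to\mathbb{R}$ is continuous, and $\partial_2 f$ denotes its partial derivative in the second variable $\xi$. Hypothesis (H) means that all of the following hold. - (H1) $f(r,\cdot)\in C^1(\mathbb{R})$ for all $r\in[0,1]$ and $\partial_2f\in C^0([0,1]\times\mathbb{R})$.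 - (H2) $f(r,\xi)>0$ for $(r,\xi)\in[0,1]\times\mathbb{R}^*$ and $f(r,0)=0$ for all $r\in[0,1]$. - (H3) $(p-1)f(r,\xi)\ge\partial_2f(r,\xi)\xi$ for $(r,\xi)\in[0,1]\times[0,\infty)$, and there exist $\delta,\epsilon>0$ such that $(p-1)f(r,\xi)>\partial_2f(r,\xi)\xi$ for all $(r,\xi)\in(1-\delta,1]\times(0,\epsilon)$. - By (H3), $\xi\mapsto f(r,\xi)/\phi_p(\xi)$ is non-increasing on $(0,\infty)$; let $f_0(r)$ and $f_\infty(r)$ be its limits as $\xi\to0^+$ and $\xi\to\infty$. It is assumed that $f_0,f_\infty$ are finite and belong to $C^0[0,1]$. (Then $f_0>0$ on $[0,1]$, $0\le f_\infty\le f_0$ and $f_\infty\not\equiv f_0$.) - (H4) $\lim_{\xi\to0^+}|f(\cdot,\xi)/\phi_p(\xi)-f_0|_0=\lim_{\xi\to0^+}|\partial_2f(\cdot,\xi)/\xi^{p-2}-(p-1)f_0|_0=0$. - (H5) $\lim_{\xi\to\infty}|f(\cdot,\xi)/\phi_p(\xi)-f_\infty|_0=0$. - (H6) Either (a) $N\ge1$ is arbitrary and $f_\infty>0$ on $[0,1]$, or (b) $N=1$ and $f_\infty\equiv0$ on $[0,1]$. For a positive weight $w\in C^0[0,1]$, consider the eigenvalue problem $-(r^{N-1}\phi_p(v'))'=\lambda r^{N-1}w(r)\phi_p(v)$ for $0<r<1$, $v'(0)=v(1)=0$. It is known that it has exactly one eigenvalue with an eigenfunction positive on $[0,1)$; this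 eigenvalue is positive and simple. $\lambda_0$ denotes this eigenvalue for $w=f_0$. In case (H6)(a), $\lambda_\infty$ denotes this eigenvalue for $w=f_\infty$; in case (H6)(b), $\lambda_\infty:=\infty$. It is known that $\lambda_0<\lambda_\infty$. *)

theory Defs
  imports "HOL-Analysis.Analysis"
begin

definition phi :: "real \<Rightarrow> real \<Rightarrow> real" where
  "phi p \<xi> = \<bar>\<xi>\<bar> powr (p - 2) * \<xi>"

text \<open>
  Functions on the unit interval are represented by functions on all reals of which only the
  values on the interval are used. In particular the derivative is taken within the interval,
  hence one-sided at the two end points.
\<close>

definition D01 :: "(real \<Rightarrow> real) \<Rightarrow> real \<Rightarrow> real" where
  "D01 u r = vector_derivative u (at r within {0..1})"

definition C1_01 :: "(real \<Rightarrow> real) \<Rightarrow> bool" where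
  "C1_01 u \<longleftrightarrow> u differentiable_on {0..1} \<and> continuous_on {0..1} (D01 u)"

definition sup_norm01 :: "(real \<Rightarrow> real) \<Rightarrow> real" where
  "sup_norm01 v = (SUP r\<in>{0..1}. \<bar>v r\<bar>)"

text \<open>
  The Banach space of continuous functions on the unit interval, isometrically embedded in the
  bounded continuous functions on the real line: a function is extended by its two boundary
  values. The three lemmas below state that every continuous function on the interval has exactly
  one such extension, and that the norm is the supremum norm over the interval.
\<close>

definition C0_01 :: "(real \<Rightarrow>\<^sub>C real) set" where
  "C0_01 = {v. \<forall>r. apply_bcontfun v r = apply_bcontfun v (clamp 0 1 r)}"

lemma clamp01_mem: "clamp 0 1 (r::real) \<in> {0..1}"
  using clamp_in_interval[of "0::real" 1 r] by simp

lemma C0_01_extension: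
  assumes "continuous_on {0..1} g"
  shows "\<exists>v\<in>C0_01. \<forall>r\<in>{0..1}. apply_bcontfun v r = g r"
proof -
  obtain v :: "real \<Rightarrow>\<^sub>C real" where v: "\<And>x. apply_bcontfun v x = g (clamp 0 1 x)"
    using continuous_on_cbox_bcontfunE[of "0::real" 1 g] assms by auto
  have idem: "clamp 0 1 (r::real) = r" if "r \<in> {0..1}" for r
    using that by (intro clamp_cancel_cbox) auto
  have "v \<in> C0_01"
    using idem[OF clamp01_mem] by (simp add: C0_01_def v)
  then show ?thesis
    using idem v by (intro bexI[of _ v]) simp_all
qed

lemma C0_01_eqI:
  assumes "v \<in> C0_01" "w \<in> C0_01" "\<And>r. r \<in> {0..1} \<Longrightarrow> apply_bcontfun v r = apply_bcontfun w r"
  shows "v = w"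
proof (rule bcontfun_eqI)
  fix r
  show "apply_bcontfun v r = apply_bcontfun w r"
    using assms(1,2) assms(3)[OF clamp01_mem] by (simp add: C0_01_def)
qed

lemma norm_C0_01:
  assumes "v \<in> C0_01"
  shows "norm v = sup_norm01 (apply_bcontfun v)"
proof (rule antisym)
  have bdd: "bdd_above ((\<lambda>r. \<bar>apply_bcontfun v r\<bar>) ` {0..1})"
    using norm_bounded[of v] by (auto intro!: bdd_aboveI2)
  show "norm v \<le> sup_norm01 (apply_bcontfun v)"
  proof (rule norm_bound)
    fix r
    have "norm (apply_bcontfun v r) = \<bar>apply_bcontfun v (clamp 0 1 r)\<bar>"
      using assms by (simp add: C0_01_def)
    also have "\<dots> \<le> sup_norm01 (apply_bcontfun v)"
      unfolding sup_norm01_def by (rule cSUP_upper[OF clamp01_mem bdd])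
    finally show "norm (apply_bcontfun v r) \<le> sup_norm01 (apply_bcontfun v)" .
  qed
  show "sup_norm01 (apply_bcontfun v) \<le> norm v"
    unfolding sup_norm01_def using norm_bounded[of v] by (intro cSUP_least) auto
qed

definition X :: "real \<Rightarrow> (real \<Rightarrow> real) set" where
  "X p = {u. C1_01 u \<and> C1_01 (\<lambda>r. phi p (D01 u r)) \<and> D01 u 0 = 0 \<and> u 1 = 0}"

definition is_solution ::
    "nat \<Rightarrow> real \<Rightarrow> (real \<Rightarrow> real \<Rightarrow> real) \<Rightarrow> real \<Rightarrow> (real \<Rightarrow> real) \<Rightarrow> bool" where
  "is_solution N p g \<mu> u \<longleftrightarrow>
     C1_01 u \<and> C1_01 (\<lambda>r. phi p (D01 u r)) \<and>
     (\<forall>r\<in>{0<..<1}. ((\<lambda>s. s ^ (N - 1) * phi p (D01 u s)) has_real_derivative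
        - (\<mu> * r ^ (N - 1) * g r (u r))) (at r)) \<and>
     D01 u 0 = 0 \<and> u 1 = 0"

definition nontrivial01 :: "(real \<Rightarrow> real) \<Rightarrow> bool" where
  "nontrivial01 u \<longleftrightarrow> (\<exists>r\<in>{0..1}. u r \<noteq> 0)"

definition principal_eigenvalue :: "nat \<Rightarrow> real \<Rightarrow> (real \<Rightarrow> real) \<Rightarrow> real \<Rightarrow> bool" where
  "principal_eigenvalue N p w \<mu> \<longleftrightarrow>
     (\<exists>v. is_solution N p (\<lambda>r \<xi>. w r * phi p \<xi>) \<mu> v \<and> (\<forall>r\<in>{0..<1}. v r > 0))"

end

theory Submission
  imports Defs
begin

text \<open>
  For \<open>\<lambda> > 0\<close> a non-trivial solution is positive and strictly decreasing, so it is the solution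
  \<open>u(\<cdot>; \<lambda>, a)\<close> of the initial value problem \<open>u(0) = a > 0\<close>, \<open>u'(0) = 0\<close>, and \<open>a\<close> is a zero of \<open>S(\<lambda>, a) = u(1; \<lambda>, a)\<close>.
  In integrated form \<open>- u'(r) = (r m(r))\<^sup>q\<close> with \<open>q = 1 / (p - 1)\<close>, where the radial mean \<open>m\<close> of \<open>\<lambda> f(\<cdot>, u)\<close> is bounded
  away from \<open>0\<close>; hence the equation, although degenerate at \<open>r = 0\<close>, is a regular Volterra equation.

  Let \<open>y\<close> be the derivative of \<open>u\<close> in \<open>a\<close>. By (H3) a Wronskian of \<open>u\<close> and \<open>y\<close> is monotone, which gives \<open>y(1) > 0\<close> at
  every zero of \<open>S(\<lambda>, \<cdot>)\<close>. So \<open>S(\<lambda>, \<cdot>)\<close> can cross zero only upwards, and only once. Sturm comparison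
  (Picone's identity) with the principal eigenfunctions gives \<open>S < 0\<close> for small \<open>a\<close> and \<open>S > 0\<close> for large \<open>a\<close> when
  \<open>\<lambda>\<^sub>0 < \<lambda> < \<lambda>\<^sub>\<infinity>\<close>, as well as \<open>S(\<lambda>\<^sub>0, \<cdot>) > 0\<close>
  and \<open>S(\<lambda>, a) < 0\<close> for \<open>\<lambda>\<close> near \<open>\<lambda>\<^sub>\<infinity>\<close>, hence the zero \<open>\<alpha>(\<lambda>)\<close> and its limits.
  The difference quotients of \<open>\<lambda> \<mapsto> u(\<cdot>; \<lambda>, \<alpha>(\<lambda>))\<close> solve linear Volterra equations whose coefficients are averaged
  slopes; these converge uniformly, so the curve is continuously differentiable.
\<close>

text \<open>As p > 2, the inverse x^q of phi has q < 1 and is not Lipschitz at 0, while the source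
  vanishes together with u; standard ODE theory gives neither uniqueness nor smoothness. The lower
  bound of the mean comes from the start: u stays near its initial value on an initial interval of
  controlled length, and the radial mean at every s sees that interval. Homogeneity of phi makes u/a
  start at 1 and turns a into a parameter of the nonlinearity \<open>K\<close>. All shooting
  problems then belong to one class of nonlinearities on [0,1] x [0,1], and for a tending to
  infinity they approach the homogeneous problem with weight \<open>finf\<close>. In case (b) of
  (H6) that limit is 0, and S > 0 for large a follows from the smallness of \<open>K\<close> instead
  of an eigenfunction.

  The curve is differentiated without an implicit function theorem in a function space. The
  difference of two solutions is an exact combination of Y (initial value) and Z (parameter
  \<lambda>), without remainder. Both solutions vanish at r = 1, so the difference quotient of
  \<alpha> is -Z(1)/Y(1), and Y(1) > 0 keeps it finite.\<close>

lemma integral_abs_bound: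
  fixes g :: "real \<Rightarrow> real"
  assumes "a \<le> b" "g integrable_on {a..b}" "\<And>x. x \<in> {a..b} \<Longrightarrow> \<bar>g x\<bar> \<le> B"
  shows "\<bar>integral {a..b} g\<bar> \<le> B * (b - a)"
proof -
  have "0 \<le> B" using assms(1) assms(3)[of a] by auto
  then show ?thesis
    using has_integral_bound[of B g "integral {a..b} g" a b] assms
    by (simp add: has_integral_integral)
qed

lemma continuous_on_01_bound:
  fixes g :: "real \<Rightarrow> real"
  assumes "continuous_on {0..1} g"
  obtains B where "B > 0" "\<And>t. t \<in> {0..1} \<Longrightarrow> \<bar>g t\<bar> \<le> B"
proof -
  have "bounded (g ` {0..1})"
    using assms by (intro compact_imp_bounded compact_continuous_image) auto
  then obtain B where "B > 0" "\<forall>x\<in>g ` {0..1}. norm x \<le> B"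
    using bounded_pos by blast
  then show thesis using that by auto
qed

lemma continuous_on_01_pos_bound:
  fixes g :: "real \<Rightarrow> real"
  assumes "continuous_on {0..1} g" "\<And>t. t \<in> {0..1} \<Longrightarrow> g t > 0"
  obtains c where "c > 0" "\<And>t. t \<in> {0..1} \<Longrightarrow> c \<le> g t"
proof -
  have "(0::real) \<in> {0..1}" by simp
  then obtain x where "x \<in> {0..1}" "\<forall>y\<in>{0..1}. g x \<le> g y"
    using continuous_attains_inf[OF compact_Icc _ assms(1)] by blast
  then show thesis using that[of "g x"] assms(2) by auto
qed

section \<open>Volterra equations\<close>

text \<open>The Lipschitz condition is causal: the value at s is controlled by the difference over
  [0,s] only. This is what an exponential weight exploits to turn any L into a contraction.\<close>

definition volterra_operator :: "real \<Rightarrow> ((real \<Rightarrow> real) \<Rightarrow> real \<Rightarrow> real) \<Rightarrow> bool" where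
  "volterra_operator L \<Psi> \<longleftrightarrow> L > 0 \<and>
     (\<forall>u. continuous_on {0..1} u \<longrightarrow> continuous_on {0..1} (\<Psi> u)) \<and>
     (\<forall>u v s B. continuous_on {0..1} u \<longrightarrow> continuous_on {0..1} v \<longrightarrow> s \<in> {0..1} \<longrightarrow>
        (\<forall>t\<in>{0..s}. \<bar>u t - v t\<bar> \<le> B) \<longrightarrow> \<bar>\<Psi> u s - \<Psi> v s\<bar> \<le> L * B)"

lemma volterra_operator_continuous:
  "volterra_operator L \<Psi> \<Longrightarrow> continuous_on {0..1} u \<Longrightarrow> continuous_on {0..1} (\<Psi> u)"
  by (simp add: volterra_operator_def)

lemma continuous_on_01_integral:
  fixes g :: "real \<Rightarrow> real"
  assumes "continuous_on {0..1} g"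
  shows "continuous_on {0..1} (\<lambda>r. integral {0..r} g)"
  using indefinite_integral_continuous_1[of g 0 1] integrable_continuous_real[OF assms] by simp

lemma integrable_on_01_initial:
  fixes g :: "real \<Rightarrow> real"
  assumes "continuous_on {0..1} g" "r \<in> {0..1}"
  shows "g integrable_on {0..r}"
  using assms by (intro integrable_continuous_real continuous_on_subset[OF assms(1)]) auto

text \<open>In the norm \<open>sup \<bar>u s\<bar> exp (- 2 L s)\<close> the integrated operator is a contraction.\<close>

lemma volterra_contraction:
  assumes V: "volterra_operator L \<Psi>" and u: "continuous_on {0..1} u" and v: "continuous_on {0..1} v"
    and B: "\<And>s. s \<in> {0..1} \<Longrightarrow> \<bar>u s - v s\<bar> \<le> B * exp (2 * L * s)"
    and r: "r \<in> {0..1}"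
  shows "\<bar>integral {0..r} (\<Psi> u) - integral {0..r} (\<Psi> v)\<bar> \<le> B / 2 * exp (2 * L * r)"
proof -
  have L: "L > 0" using V by (simp add: volterra_operator_def)
  have B0: "0 \<le> B" using B[of 0] by simp
  have bd: "\<bar>\<Psi> u s - \<Psi> v s\<bar> \<le> L * (B * exp (2 * L * s))" if s: "s \<in> {0..r}" for s
  proof -
    have "\<bar>u t - v t\<bar> \<le> B * exp (2 * L * s)" if t: "t \<in> {0..s}" for t
    proof -
      have "\<bar>u t - v t\<bar> \<le> B * exp (2 * L * t)" using B[of t] t s r by auto
      also have "\<dots> \<le> B * exp (2 * L * s)" using t L B0 by (intro mult_left_mono) auto
      finally show ?thesis .
    qed
    then show ?thesis using V u v s r unfolding volterra_operator_def by auto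
  qed
  have iu: "\<Psi> u integrable_on {0..r}" and iv: "\<Psi> v integrable_on {0..r}"
    using V u v r by (auto intro: integrable_on_01_initial volterra_operator_continuous[OF V])
  have FT: "((\<lambda>s. L * (B * exp (2 * L * s))) has_integral
      (B / 2 * exp (2 * L * r) - B / 2 * exp (2 * L * 0))) {0..r}"
    using r L
    by (intro fundamental_theorem_of_calculus)
       (auto intro!: derivative_eq_intros simp flip: has_real_derivative_iff_has_vector_derivative)
  have "\<bar>integral {0..r} (\<Psi> u) - integral {0..r} (\<Psi> v)\<bar>
      = norm (integral {0..r} (\<lambda>s. \<Psi> u s - \<Psi> v s))"
    using iu iv by (simp add: integral_diff)
  also have "\<dots> \<le> integral {0..r} (\<lambda>s. L * (B * exp (2 * L * s)))"
    using iu iv FT bd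
    by (intro integral_norm_bound_integral) (auto intro: integrable_diff simp: has_integral_iff)
  also have "\<dots> \<le> B / 2 * exp (2 * L * r)"
    using FT B0 by (simp add: has_integral_iff)
  finally show ?thesis .
qed

lemma volterra_exists:
  assumes V: "volterra_operator L \<Psi>" and b: "continuous_on {0..1} b"
  obtains u where "continuous_on {0..1} u" "\<And>r. r \<in> {0..1} \<Longrightarrow> u r = b r - integral {0..r} (\<Psi> u)"
proof -
  \<comment> \<open>The contraction lives in a weighted norm, while \<open>banach_fix_type\<close>
    works on the whole type of bounded continuous functions with the sup norm. Multiplication by the
    exponential transports one to the other, and clamping extends the images beyond the
    interval.\<close>
  define E where "E g s = exp (2 * L * s) * apply_bcontfun g s" for g :: "real \<Rightarrow>\<^sub>C real" and s
  have cE: "continuous_on {0..1} (E g)" for g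
    unfolding E_def by (intro continuous_intros) (auto intro: continuous_on_apply_bcontfun)
  have "\<exists>h :: real \<Rightarrow>\<^sub>C real. \<forall>r. apply_bcontfun h r =
      exp (- (2 * L * clamp 0 1 r)) * (b (clamp 0 1 r) - integral {0..clamp 0 1 r} (\<Psi> (E g)))" for g
  proof -
    have "continuous_on (cbox 0 1)
        (\<lambda>r. exp (- (2 * L * r)) * (b r - integral {0..r} (\<Psi> (E g))))"
      using b continuous_on_01_integral[OF volterra_operator_continuous[OF V cE[of g]]]
      by (auto intro!: continuous_intros)
    then show ?thesis by (rule continuous_on_cbox_bcontfunE) auto
  qed
  then obtain \<Phi> :: "(real \<Rightarrow>\<^sub>C real) \<Rightarrow> (real \<Rightarrow>\<^sub>C real)" where \<Phi>: "\<And>g r. apply_bcontfun (\<Phi> g) r =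
      exp (- (2 * L * clamp 0 1 r)) * (b (clamp 0 1 r) - integral {0..clamp 0 1 r} (\<Psi> (E g)))"
    by metis
  have "dist (\<Phi> g) (\<Phi> h) \<le> 1 / 2 * dist g h" for g h
  proof (rule dist_bound)
    fix r
    define s :: real where "s = clamp 0 1 r"
    have s: "s \<in> {0..1}" unfolding s_def by (rule clamp01_mem)
    have "\<bar>E g t - E h t\<bar> \<le> dist g h * exp (2 * L * t)" for t
      using dist_bounded[of g t h]
      by (simp add: E_def dist_real_def abs_mult flip: right_diff_distrib)
    then have le: "\<bar>integral {0..s} (\<Psi> (E g)) - integral {0..s} (\<Psi> (E h))\<bar>
        \<le> dist g h / 2 * exp (2 * L * s)"
      by (intro volterra_contraction[OF V cE cE _ s])
    have "dist (apply_bcontfun (\<Phi> g) r) (apply_bcontfun (\<Phi> h) r)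
        = exp (- (2 * L * s)) * \<bar>integral {0..s} (\<Psi> (E g)) - integral {0..s} (\<Psi> (E h))\<bar>"
      by (simp add: \<Phi> s_def dist_real_def abs_mult abs_minus_commute flip: right_diff_distrib)
    also have "\<dots> \<le> exp (- (2 * L * s)) * (dist g h / 2 * exp (2 * L * s))"
      using le by (intro mult_left_mono) auto
    also have "\<dots> = 1 / 2 * dist g h" by (simp add: exp_minus field_simps)
    finally show "dist (apply_bcontfun (\<Phi> g) r) (apply_bcontfun (\<Phi> h) r) \<le> 1 / 2 * dist g h" .
  qed
  then obtain g where g: "\<Phi> g = g"
    using banach_fix_type[of "1/2" \<Phi>] by auto
  show thesis
  proof (rule that[of "E g"])
    fix r :: real assume r: "r \<in> {0..1}"
    have "apply_bcontfun g r = exp (- (2 * L * r)) * (b r - integral {0..r} (\<Psi> (E g)))"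
      using \<Phi>[of g r] r by (simp add: g clamp_cancel_cbox)
    then show "E g r = b r - integral {0..r} (\<Psi> (E g))"
      unfolding E_def by (simp add: exp_minus)
  qed (rule cE)
qed

text \<open>Here v is an approximate solution with defect \<epsilon>. At the point where the
  weighted difference attains its maximum B, the contraction gives B \<le> \<epsilon> + B/2;
  removing the weight costs exp (2 L).\<close>

lemma volterra_stable:
  assumes V: "volterra_operator L \<Psi>"
    and u: "continuous_on {0..1} u" "\<And>r. r \<in> {0..1} \<Longrightarrow> u r = b r - integral {0..r} (\<Psi> u)"
    and v: "continuous_on {0..1} v"
      "\<And>r. r \<in> {0..1} \<Longrightarrow> \<bar>v r - (b r - integral {0..r} (\<Psi> v))\<bar> \<le> \<epsilon>"
    and r: "r \<in> {0..1}"
  shows "\<bar>u r - v r\<bar> \<le> 2 * exp (2 * L) * \<epsilon>"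
proof -
  have L: "L > 0" using V by (simp add: volterra_operator_def)
  have e0: "\<epsilon> \<ge> 0" using v(2)[of 0] by auto
  have "(0::real) \<in> {0..1}" by simp
  moreover have "continuous_on {0..1} (\<lambda>s. \<bar>u s - v s\<bar> * exp (- (2 * L * s)))"
    by (intro continuous_intros u v)
  ultimately obtain x where x: "x \<in> {0..1}"
    and max: "\<And>s. s \<in> {0..1} \<Longrightarrow>
      \<bar>u s - v s\<bar> * exp (- (2 * L * s)) \<le> \<bar>u x - v x\<bar> * exp (- (2 * L * x))"
    using continuous_attains_sup[OF compact_Icc] by (metis (no_types, lifting) empty_iff)
  define B where "B = \<bar>u x - v x\<bar> * exp (- (2 * L * x))"
  have le: "\<bar>u s - v s\<bar> \<le> B * exp (2 * L * s)" if "s \<in> {0..1}" for s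
    using max[OF that] by (simp add: B_def exp_minus field_simps)
  have "\<bar>integral {0..x} (\<Psi> u) - integral {0..x} (\<Psi> v)\<bar> \<le> B / 2 * exp (2 * L * x)"
    by (rule volterra_contraction[OF V u(1) v(1) le x])
  then have "\<bar>u x - v x\<bar> \<le> \<epsilon> + B / 2 * exp (2 * L * x)"
    using u(2)[OF x] v(2)[OF x] by linarith
  then have "B \<le> (\<epsilon> + B / 2 * exp (2 * L * x)) * exp (- (2 * L * x))"
    unfolding B_def by (intro mult_right_mono) auto
  also have "\<dots> = \<epsilon> * exp (- (2 * L * x)) + B / 2"
    by (simp add: exp_minus field_simps)
  also have "\<epsilon> * exp (- (2 * L * x)) \<le> \<epsilon> * 1"
    using e0 L x by (intro mult_left_mono) auto
  finally have "B \<le> 2 * \<epsilon>" by simp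
  moreover have "exp (2 * L * r) \<le> exp (2 * L)" using L r by auto
  ultimately have "B * exp (2 * L * r) \<le> (2 * \<epsilon>) * exp (2 * L)"
    using e0 by (intro mult_mono) auto
  then show ?thesis using le[OF r] by (simp add: mult_ac)
qed

lemma volterra_unique:
  assumes V: "volterra_operator L \<Psi>"
    and u: "continuous_on {0..1} u" "\<And>r. r \<in> {0..1} \<Longrightarrow> u r = b r - integral {0..r} (\<Psi> u)"
    and v: "continuous_on {0..1} v" "\<And>r. r \<in> {0..1} \<Longrightarrow> v r = b r - integral {0..r} (\<Psi> v)"
    and r: "r \<in> {0..1}"
  shows "u r = v r"
  using volterra_stable[OF V u v(1) _ r, of 0] v(2) by simp

lemma has_real_derivative_inside:
  fixes u :: "real \<Rightarrow> real"
  assumes "(u has_real_derivative d) (at r within {0..1})" "0 < r" "r < 1"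
  shows "(u has_real_derivative d) (at r)"
  using assms at_within_Icc_at[of 0 r 1] by simp

section \<open>Radial means\<close>

locale radial =
  fixes N :: nat and p :: real
  assumes N: "1 \<le> N" and p: "2 < p"
begin

text \<open>Exponent of the inverse of \<open>phi p\<close> on the nonnegative half-line.\<close>

definition q :: real where "q = 1 / (p - 1)"

lemma q_pos: "0 < q" and q_less_1: "q < 1" and q_times: "q * (p - 1) = 1"
  using p by (auto simp: q_def field_simps)

text \<open>After the substitution t = s \<tau>, \<open>s * rmean \<psi> s\<close> is s^(1-N) times
  the integral of t^(N-1) \<psi>(t) over [0,s], so it equals -phi(u') for a radial solution with
  source \<psi>. In this form the singular factor at s = 0 has disappeared.\<close>

definition rmean :: "(real \<Rightarrow> real) \<Rightarrow> real \<Rightarrow> real" where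
  "rmean \<psi> s = integral {0..1} (\<lambda>\<tau>. \<tau> ^ (N - 1) * \<psi> (s * \<tau>))"

lemma continuous_rmean_integrand:
  fixes \<psi> :: "real \<Rightarrow> real"
  assumes "continuous_on {0..1} \<psi>" "s \<in> {0..1}"
  shows "continuous_on {0..1} (\<lambda>\<tau>. \<tau> ^ (N - 1) * \<psi> (s * \<tau>))"
  using assms(2)
  by (intro continuous_intros continuous_on_compose2[OF assms(1)]) (auto intro: mult_le_one)

lemma rmean_integrable:
  fixes \<psi> :: "real \<Rightarrow> real"
  assumes "continuous_on {0..1} \<psi>" "s \<in> {0..1}"
  shows "(\<lambda>\<tau>. \<tau> ^ (N - 1) * \<psi> (s * \<tau>)) integrable_on {0..1}"
  by (rule integrable_continuous_real[OF continuous_rmean_integrand[OF assms]])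

lemma continuous_rmean:
  assumes "continuous_on {0..1} \<psi>"
  shows "continuous_on {0..1} (rmean \<psi>)"
proof -
  have "continuous_on ({0..1} \<times> cbox 0 1) (\<lambda>(s, \<tau>). \<tau> ^ (N - 1) * \<psi> (s * \<tau>))"
    unfolding split_beta
    by (intro continuous_intros continuous_on_compose2[OF assms]) (auto intro: mult_le_one)
  from integral_continuous_on_param[OF this] show ?thesis
    by (simp add: rmean_def[abs_def])
qed

lemma rmean_cmult: "rmean (\<lambda>t. c * \<psi> t) s = c * rmean \<psi> s"
  unfolding rmean_def integral_mult_right[symmetric]
  by (rule integral_cong) (simp add: mult.left_commute)

lemma rmean_add:
  assumes "continuous_on {0..1} \<psi>" "continuous_on {0..1} \<eta>" "s \<in> {0..1}"
  shows "rmean (\<lambda>t. \<psi> t + \<eta> t) s = rmean \<psi> s + rmean \<eta> s"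
  unfolding rmean_def
  using integral_add[OF rmean_integrable[OF assms(1,3)] rmean_integrable[OF assms(2,3)]]
  by (simp add: distrib_left)

lemma rmean_diff:
  assumes "continuous_on {0..1} \<psi>" "continuous_on {0..1} \<eta>" "s \<in> {0..1}"
  shows "rmean (\<lambda>t. \<psi> t - \<eta> t) s = rmean \<psi> s - rmean \<eta> s"
  unfolding rmean_def
  using integral_diff[OF rmean_integrable[OF assms(1,3)] rmean_integrable[OF assms(2,3)]]
  by (simp add: right_diff_distrib)

lemma rmean_cong:
  assumes "\<And>t. t \<in> {0..s} \<Longrightarrow> \<psi> t = \<eta> t" "s \<in> {0..1}"
  shows "rmean \<psi> s = rmean \<eta> s"
  unfolding rmean_def
  using assms by (intro integral_cong) (auto simp: mult_left_le)

lemma rmean_abs_le: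
  assumes "continuous_on {0..1} \<psi>" "s \<in> {0..1}" "\<And>t. t \<in> {0..s} \<Longrightarrow> \<bar>\<psi> t\<bar> \<le> B"
  shows "\<bar>rmean \<psi> s\<bar> \<le> B"
proof -
  have B: "0 \<le> B" using assms(2) assms(3)[of 0] by auto
  have "\<bar>rmean \<psi> s\<bar> \<le> B * (1 - 0)"
    unfolding rmean_def
  proof (rule integral_abs_bound)
    fix \<tau> :: real assume \<tau>: "\<tau> \<in> {0..1}"
    have "\<bar>\<tau> ^ (N - 1) * \<psi> (s * \<tau>)\<bar> = \<tau> ^ (N - 1) * \<bar>\<psi> (s * \<tau>)\<bar>"
      using \<tau> by (simp add: abs_mult)
    also have "\<dots> \<le> 1 * B"
      using \<tau> assms(2,3) B by (intro mult_mono) (auto simp: mult_left_le power_le_one)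
    finally show "\<bar>\<tau> ^ (N - 1) * \<psi> (s * \<tau>)\<bar> \<le> B" by simp
  qed (use rmean_integrable[OF assms(1,2)] in auto)
  then show ?thesis by simp
qed

lemma rmean_diff_le:
  assumes "continuous_on {0..1} \<psi>" "continuous_on {0..1} \<eta>" "s \<in> {0..1}"
    and "\<And>t. t \<in> {0..s} \<Longrightarrow> \<bar>\<psi> t - \<eta> t\<bar> \<le> B"
  shows "\<bar>rmean \<psi> s - rmean \<eta> s\<bar> \<le> B"
  using rmean_abs_le[of "\<lambda>t. \<psi> t - \<eta> t" s B] assms
  by (simp add: rmean_diff continuous_on_diff)

lemma rmean_nonneg:
  assumes "continuous_on {0..1} \<psi>" "s \<in> {0..1}" "\<And>t. t \<in> {0..1} \<Longrightarrow> 0 \<le> \<psi> t"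
  shows "0 \<le> rmean \<psi> s"
  unfolding rmean_def
  using assms by (intro integral_nonneg rmean_integrable) (auto simp: mult_le_one)

text \<open>Only \<tau> in [0,r0] is used: there s \<tau> \<le> r0 whatever s is, so a lower bound
  of \<psi> near 0 yields a bound of the mean that is uniform in s.\<close>

lemma rmean_lower:
  assumes "continuous_on {0..1} \<psi>" "s \<in> {0..1}" "\<And>t. t \<in> {0..1} \<Longrightarrow> 0 \<le> \<psi> t"
    and "r0 \<in> {0..1}" "\<And>t. t \<in> {0..r0} \<Longrightarrow> m \<le> \<psi> t" "0 \<le> m"
  shows "r0 ^ N * m / N \<le> rmean \<psi> s"
proof -
  let ?g = "\<lambda>\<tau>. \<tau> ^ (N - 1) * \<psi> (s * \<tau>)"
  have *: "((\<lambda>\<tau>. \<tau> ^ (N - 1) * m) has_integral (r0 ^ N * m / N - 0 ^ N * m / N)) {0..r0}"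
    using assms(4) N
    by (intro fundamental_theorem_of_calculus)
       (auto intro!: derivative_eq_intros simp flip: has_real_derivative_iff_has_vector_derivative)
  have i: "?g integrable_on {0..1}" by (rule rmean_integrable[OF assms(1,2)])
  have i0: "?g integrable_on {0..r0}"
    by (rule integrable_on_subinterval[OF i]) (use assms(4) in auto)
  have le: "s * \<tau> \<le> r0" if "0 \<le> \<tau>" "\<tau> \<le> r0" for \<tau>
    using mult_left_le_one_le[of \<tau> s] that assms(2) by auto
  have "r0 ^ N * m / N = integral {0..r0} (\<lambda>\<tau>. \<tau> ^ (N - 1) * m)"
    using * N by (simp add: has_integral_iff)
  also have "\<dots> \<le> integral {0..r0} ?g"
    using * i0 assms(2) le by (intro integral_le mult_left_mono assms(5)) (auto simp: has_integral_iff)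
  also have "\<dots> \<le> integral {0..1} ?g"
    using i i0 assms(2-4) by (intro integral_subset_le) (auto simp: mult_le_one)
  finally show ?thesis by (simp add: rmean_def)
qed

lemma rmean_pos:
  assumes "continuous_on {0..1} \<psi>" "s \<in> {0..1}" "\<And>t. t \<in> {0..1} \<Longrightarrow> 0 \<le> \<psi> t" "0 < \<psi> 0"
  shows "0 < rmean \<psi> s"
proof -
  have "\<exists>d>0. \<forall>t\<in>{0..1}. dist t 0 < d \<longrightarrow> dist (\<psi> t) (\<psi> 0) < \<psi> 0 / 2"
    using assms(1,4) unfolding continuous_on_iff
    by (metis atLeastAtMost_iff half_gt_zero less_eq_real_def zero_less_one)
  then obtain d where d: "d > 0" "\<And>t. t \<in> {0..1} \<Longrightarrow> dist t 0 < d \<Longrightarrow> dist (\<psi> t) (\<psi> 0) < \<psi> 0 / 2"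
    by blast
  define r0 where "r0 = min 1 (d / 2)"
  have r0: "0 < r0" "r0 \<le> 1" "r0 < d" using d(1) by (auto simp: r0_def)
  have "\<psi> 0 / 2 \<le> \<psi> t" if "t \<in> {0..r0}" for t
    using d(2)[of t] that r0 by (auto simp: dist_real_def abs_if split: if_splits)
  then have "r0 ^ N * (\<psi> 0 / 2) / N \<le> rmean \<psi> s"
    using assms r0 by (intro rmean_lower) auto
  moreover have "0 < r0 ^ N * (\<psi> 0 / 2) / N" using r0 assms(4) N by simp
  ultimately show ?thesis by linarith
qed

lemma power_rmean:
  assumes "s \<in> {0..1}"
  shows "s ^ N * rmean \<psi> s = integral {0..s} (\<lambda>t. t ^ (N - 1) * \<psi> t)"
proof (cases "s = 0")
  case True
  then show ?thesis using N by simp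
next
  case False
  then have s: "s > 0" using assms by auto
  define I where "I = integral {0..s} (\<lambda>t. t ^ (N - 1) * \<psi> t)"
  have "(\<lambda>x. x / s) ` {0..s} = {0..1}"
    using s by simp
  then have 1: "integral {0..1} (\<lambda>\<tau>. (s * \<tau>) ^ (N - 1) * \<psi> (s * \<tau>)) = 1 / s * I"
    using integral_stretch_real[of s 0 s "\<lambda>t. t ^ (N - 1) * \<psi> t"] s by (simp add: I_def)
  have 2: "integral {0..1} (\<lambda>\<tau>. (s * \<tau>) ^ (N - 1) * \<psi> (s * \<tau>)) = s ^ (N - 1) * rmean \<psi> s"
    by (simp add: rmean_def power_mult_distrib mult.assoc)
  have "s ^ N = s * s ^ (N - 1)" using N by (cases N) auto
  then have "s ^ N * rmean \<psi> s = s * (1 / s * I)" by (simp only: mult.assoc 2[symmetric] 1)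
  also have "\<dots> = I" using s by simp
  finally show ?thesis by (simp add: I_def)
qed

lemma power_rmean_has_derivative:
  assumes "continuous_on {0..1} \<psi>" "s \<in> {0..1}"
  shows "((\<lambda>s. s ^ N * rmean \<psi> s) has_real_derivative s ^ (N - 1) * \<psi> s) (at s within {0..1})"
proof -
  have "((\<lambda>s. integral {0..s} (\<lambda>t. t ^ (N - 1) * \<psi> t)) has_real_derivative s ^ (N - 1) * \<psi> s)
      (at s within {0..1})"
    by (rule integral_has_real_derivative[OF _ assms(2)]) (intro continuous_intros assms(1))
  then show ?thesis
    by (rule has_field_derivative_transform_within[where d = 1, OF _ _ assms(2)])
       (auto simp: power_rmean)
qed

lemma phi_nonneg:
  assumes "0 \<le> x"
  shows "phi p x = x powr (p - 1)"
proof -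
  have "x * x powr (p - 2) = x powr (p - 1)" using powr_mult_base[of x "p - 2"] assms by simp
  then show ?thesis using assms by (simp add: phi_def mult.commute[of _ x])
qed

lemma phi_minus: "phi p (- x) = - phi p x"
  by (simp add: phi_def)

lemma powr_q_inverse: "0 \<le> x \<Longrightarrow> (x powr q) powr (p - 1) = x" "0 \<le> x \<Longrightarrow> (x powr (p - 1)) powr q = x"
  by (simp_all add: powr_powr q_times mult.commute[of _ q])

lemma phi_minus_powr: "0 \<le> x \<Longrightarrow> phi p (- (x powr q)) = - x"
  by (simp add: phi_minus phi_nonneg powr_q_inverse)

lemma phi_eq_minusD:
  assumes "phi p d = - x" "0 \<le> x"
  shows "d = - (x powr q)"
proof -
  have "d \<le> 0"
  proof (rule ccontr)
    assume "\<not> d \<le> 0"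
    then have "0 < phi p d" by (simp add: phi_nonneg)
    then show False using assms by simp
  qed
  have "x = phi p (- d)" using assms(1) phi_minus[of d] by linarith
  also have "\<dots> = (- d) powr (p - 1)" using \<open>d \<le> 0\<close> by (intro phi_nonneg) simp
  finally have "x powr q = - d" using \<open>d \<le> 0\<close> powr_q_inverse(2)[of "- d"] by simp
  then show ?thesis by simp
qed

section \<open>Radial profiles\<close>

text \<open>The integrated form of \<open>- (r\<^sup>N\<^sup>-\<^sup>1 \<phi> (u'))' = r\<^sup>N\<^sup>-\<^sup>1 \<psi>\<close> with \<open>u' 0 = 0\<close>.\<close>

definition profile :: "(real \<Rightarrow> real) \<Rightarrow> (real \<Rightarrow> real) \<Rightarrow> bool" where
  "profile \<psi> u \<longleftrightarrow> continuous_on {0..1} \<psi> \<and> (\<forall>t\<in>{0..1}. 0 \<le> \<psi> t) \<and>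
     (\<forall>r\<in>{0..1}. u r = u 0 - integral {0..r} (\<lambda>s. (s * rmean \<psi> s) powr q))"

definition slope :: "(real \<Rightarrow> real) \<Rightarrow> real \<Rightarrow> real" where
  "slope \<psi> s = (s * rmean \<psi> s) powr q"

lemma profileD:
  assumes "profile \<psi> u"
  shows "continuous_on {0..1} \<psi>" "\<And>t. t \<in> {0..1} \<Longrightarrow> 0 \<le> \<psi> t"
    "\<And>r. r \<in> {0..1} \<Longrightarrow> integral {0..r} (slope \<psi>) = u 0 - u r"
proof -
  show "continuous_on {0..1} \<psi>" "\<And>t. t \<in> {0..1} \<Longrightarrow> 0 \<le> \<psi> t"
    using assms unfolding profile_def by blast+
  fix r :: real assume "r \<in> {0..1}"
  then have "u r = u 0 - integral {0..r} (slope \<psi>)"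
    using assms unfolding profile_def slope_def[abs_def] by blast
  then show "integral {0..r} (slope \<psi>) = u 0 - u r" by linarith
qed

lemma continuous_slope:
  assumes "continuous_on {0..1} \<psi>" "\<And>t. t \<in> {0..1} \<Longrightarrow> 0 \<le> \<psi> t"
  shows "continuous_on {0..1} (slope \<psi>)"
proof -
  have "0 \<le> s * rmean \<psi> s" if "s \<in> {0..1}" for s
    using that rmean_nonneg[OF assms(1) that assms(2)] by simp
  moreover have "continuous_on {0..1} (\<lambda>s. s * rmean \<psi> s)"
    by (intro continuous_intros continuous_rmean assms)
  ultimately show ?thesis
    unfolding slope_def[abs_def] using q_pos by (intro continuous_on_powr') auto
qed

lemma profile_continuous_slope: "profile \<psi> u \<Longrightarrow> continuous_on {0..1} (slope \<psi>)"
  by (rule continuous_slope) (rule profileD, assumption+)+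

lemma slope_nonneg: "0 \<le> slope \<psi> s"
  by (simp add: slope_def)

lemma profile_has_derivative:
  assumes "profile \<psi> u" "r \<in> {0..1}"
  shows "(u has_real_derivative - slope \<psi> r) (at r within {0..1})"
proof -
  have "((\<lambda>r. u 0 - integral {0..r} (slope \<psi>)) has_real_derivative - slope \<psi> r) (at r within {0..1})"
    using DERIV_diff[OF DERIV_const integral_has_real_derivative[OF profile_continuous_slope[OF assms(1)] assms(2)]]
    by simp
  then show ?thesis
    by (rule has_field_derivative_transform_within[where d = 1, OF _ _ assms(2)])
       (use profileD(3)[OF assms(1)] in simp_all)
qed

lemma profile_continuous: "profile \<psi> u \<Longrightarrow> continuous_on {0..1} u"
  by (rule DERIV_continuous_on) (rule profile_has_derivative)

lemma profile_antimono:
  assumes "profile \<psi> u" "0 \<le> r" "r \<le> s" "s \<le> 1"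
  shows "u s \<le> u r"
proof -
  have "integral {0..r} (slope \<psi>) \<le> integral {0..s} (slope \<psi>)"
    using assms slope_nonneg
    by (intro integral_subset_le integrable_on_01_initial profile_continuous_slope) auto
  then show ?thesis
    using profileD(3)[OF assms(1), of r] profileD(3)[OF assms(1), of s] assms(2-4) by auto
qed

lemma profile_rmean_pos:
  assumes "profile \<psi> u" "0 < \<psi> 0" "s \<in> {0..1}"
  shows "0 < rmean \<psi> s"
  using assms profileD[OF assms(1)] by (intro rmean_pos) auto

lemma profile_slope_pos:
  assumes "profile \<psi> u" "0 < \<psi> 0" "0 < s" "s \<le> 1"
  shows "0 < slope \<psi> s"
  using profile_rmean_pos[OF assms(1,2), of s] assms(3,4) by (simp add: slope_def)

lemma profile_strict_antimono:
  assumes "profile \<psi> u" "0 < \<psi> 0" "0 \<le> r" "r < s" "s \<le> 1"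
  shows "u s < u r"
proof (rule DERIV_neg_imp_decreasing_open[OF assms(4)])
  show "continuous_on {r..s} u"
    by (rule continuous_on_subset[OF profile_continuous[OF assms(1)]]) (use assms in auto)
next
  fix x assume x: "r < x" "x < s"
  then have "(u has_real_derivative - slope \<psi> x) (at x)"
    using assms by (intro has_real_derivative_inside profile_has_derivative) auto
  then show "\<exists>y. (u has_real_derivative y) (at x) \<and> y < 0"
    using profile_slope_pos[OF assms(1,2), of x] x assms by (intro exI[of _ "- slope \<psi> x"]) auto
qed

text \<open>The operator is homogeneous of degree p - 1, and (\<alpha>^(p-1))^q = \<alpha> passes
  the factor through the slope. The normalisation to initial value 1 rests on this.\<close>

lemma profile_cmult:
  assumes "profile \<psi> u" "0 \<le> \<alpha>"
  shows "profile (\<lambda>t. \<alpha> powr (p - 1) * \<psi> t) (\<lambda>r. \<alpha> * u r)"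
proof -
  have "slope (\<lambda>t. \<alpha> powr (p - 1) * \<psi> t) s = \<alpha> * slope \<psi> s" if "s \<in> {0..1}" for s
  proof -
    have "0 \<le> s * rmean \<psi> s"
      using that profileD[OF assms(1)] by (auto intro!: mult_nonneg_nonneg rmean_nonneg)
    then show ?thesis
      using assms(2) unfolding slope_def rmean_cmult
      by (simp add: mult.left_commute powr_mult powr_q_inverse)
  qed
  then have "integral {0..r} (slope (\<lambda>t. \<alpha> powr (p - 1) * \<psi> t)) = \<alpha> * integral {0..r} (slope \<psi>)"
    if "r \<in> {0..1}" for r
    unfolding integral_mult_right[symmetric] using that by (intro integral_cong) auto
  moreover have "(\<lambda>s. (s * rmean \<eta> s) powr q) = slope \<eta>" for \<eta>
    by (rule ext) (simp add: slope_def)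
  ultimately have "\<alpha> * u r = \<alpha> * u 0
      - integral {0..r} (\<lambda>s. (s * rmean (\<lambda>t. \<alpha> powr (p - 1) * \<psi> t) s) powr q)"
    if "r \<in> {0..1}" for r
    using profileD(3)[OF assms(1) that] that by (simp add: right_diff_distrib)
  moreover have "continuous_on {0..1} (\<lambda>t. \<alpha> powr (p - 1) * \<psi> t)"
    by (intro continuous_intros profileD(1)[OF assms(1)])
  moreover have "0 \<le> \<alpha> powr (p - 1) * \<psi> t" if "t \<in> {0..1}" for t
    using profileD(2)[OF assms(1) that] by simp
  ultimately show ?thesis unfolding profile_def by blast
qed

end

section \<open>The normalised initial value problem\<close>

text \<open>Nonlinearities are controlled for values in [0,1], but an iterate of the integral
  operator may leave that range; composition with this 1-Lipschitz projection extends them to all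
  values.\<close>

definition cut01 :: "real \<Rightarrow> real" where
  "cut01 x = max 0 (min 1 x)"

lemma cut01_mem: "cut01 x \<in> {0..1}"
  and cut01_id: "x \<in> {0..1} \<Longrightarrow> cut01 x = x"
  and cut01_lipschitz: "\<bar>cut01 x - cut01 y\<bar> \<le> \<bar>x - y\<bar>"
  by (auto simp: cut01_def)

lemma continuous_cut01_comp:
  fixes k :: "real \<Rightarrow> real \<Rightarrow> real"
  assumes "continuous_on ({0..1} \<times> {0..1}) (\<lambda>(t, x). k t x)" "continuous_on {0..1} u"
  shows "continuous_on {0..1} (\<lambda>t. k t (cut01 (u t)))"
proof -
  have "continuous_on {0..1} (\<lambda>t. (t, cut01 (u t)))"
    unfolding cut01_def by (intro continuous_intros assms(2))
  then show ?thesis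
    using continuous_on_compose2[OF assms(1), of "{0..1}" "\<lambda>t. (t, cut01 (u t))"] cut01_mem by force
qed

text \<open>The lower bound m is asked for on [1/2,1] only, since the nonlinearities of interest
  vanish at x = 0. A solution starting at 1 stays in that range for a controlled initial
  time.\<close>

definition bounded_nonlinearity :: "(real \<Rightarrow> real \<Rightarrow> real) \<Rightarrow> real \<Rightarrow> real \<Rightarrow> bool" where
  "bounded_nonlinearity k m M \<longleftrightarrow> 0 < m \<and>
     (\<forall>t\<in>{0..1}. \<forall>x\<in>{0..1}. 0 \<le> k t x \<and> k t x \<le> M) \<and>
     (\<forall>t\<in>{0..1}. \<forall>x\<in>{1/2..1}. m \<le> k t x)"

context radial
begin

text \<open>The derivative q z^(q-1) decreases because q < 1, so its value at the left end c bounds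
  it. The constant blows up as c tends to 0, which is why the means must be kept away from
  0.\<close>

lemma powr_q_lipschitz:
  assumes "0 < c" "c \<le> x" "c \<le> y"
  shows "\<bar>x powr q - y powr q\<bar> \<le> c powr (q - 1) * \<bar>x - y\<bar>"
proof -
  have "norm (x powr q - y powr q) \<le> c powr (q - 1) * norm (x - y)"
  proof (rule field_differentiable_bound[of "{c..}" _ "\<lambda>z. q * z powr (q - 1)"])
    fix z assume z: "z \<in> {c..}"
    show "((\<lambda>z. z powr q) has_field_derivative q * z powr (q - 1)) (at z within {c..})"
      using z assms(1) by (auto intro!: derivative_eq_intros simp: powr_diff)
    have "z powr (q - 1) \<le> c powr (q - 1)"
      using z assms(1) q_less_1 by (intro powr_mono2') auto
    then have "q * z powr (q - 1) \<le> 1 * c powr (q - 1)"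
      using q_pos q_less_1 by (intro mult_mono) auto
    then show "norm (q * z powr (q - 1)) \<le> c powr (q - 1)"
      using q_pos by simp
  qed (use assms in auto)
  then show ?thesis by simp
qed

lemma half_inverse_bounds:
  fixes a :: real
  assumes "0 \<le> a"
  shows "0 < 1 / (2 * (1 + a))" "1 / (2 * (1 + a)) \<le> 1" "a * (1 / (2 * (1 + a))) \<le> 1 / 2"
  using assms by (auto simp: field_simps)

text \<open>The slope of w is at most M^q, so w \<ge> 1/2 up to r0 = 1/(2(1 + M^q)), and
  \<open>rmean_lower\<close> with this r0 gives the value. The 1 in the denominator keeps r0 \<le>
  1.\<close>

definition mean_bound :: "real \<Rightarrow> real \<Rightarrow> real" where
  "mean_bound m M = (1 / (2 * (1 + M powr q))) ^ N * m / N"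

lemma mean_bound_pos: "0 < m \<Longrightarrow> 0 < mean_bound m M"
  unfolding mean_bound_def using N half_inverse_bounds[of "M powr q"]
  by (intro divide_pos_pos mult_pos_pos zero_less_power) auto

lemma mean_bound_le:
  assumes "0 < m"
  shows "mean_bound m M \<le> m"
proof -
  have "(1 / (2 * (1 + M powr q))) ^ N \<le> 1"
    using half_inverse_bounds[of "M powr q"] by (intro power_le_one) auto
  then have "mean_bound m M \<le> 1 * m / N"
    unfolding mean_bound_def using assms by (intro divide_right_mono mult_right_mono) auto
  also have "\<dots> \<le> m" using N assms by (simp add: field_simps)
  finally show ?thesis .
qed

text \<open>The truncation at \<open>c\<close> makes the operator globally Lipschitz; an a priori bound shows that it is inactive.\<close>

definition trunc_slope :: "real \<Rightarrow> (real \<Rightarrow> real) \<Rightarrow> real \<Rightarrow> real" where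
  "trunc_slope c \<psi> s = (s * max c (rmean \<psi> s)) powr q"

lemma continuous_trunc_slope:
  assumes "continuous_on {0..1} \<psi>" "0 \<le> c"
  shows "continuous_on {0..1} (trunc_slope c \<psi>)"
proof -
  have "0 \<le> s * max c (rmean \<psi> s)" if "s \<in> {0..1}" for s
    using that assms(2) by (simp add: le_max_iff_disj)
  moreover have "continuous_on {0..1} (\<lambda>s. s * max c (rmean \<psi> s))"
    by (intro continuous_intros continuous_rmean assms)
  ultimately show ?thesis
    unfolding trunc_slope_def[abs_def] using q_pos by (intro continuous_on_powr') auto
qed

lemma trunc_slope_eq: "c \<le> rmean \<psi> s \<Longrightarrow> trunc_slope c \<psi> s = slope \<psi> s"
  by (simp add: trunc_slope_def slope_def max_absorb2)

lemma trunc_slope_lipschitz: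
  assumes "0 < c" "s \<in> {0..1}" "\<bar>rmean \<psi> s - rmean \<eta> s\<bar> \<le> d"
  shows "\<bar>trunc_slope c \<psi> s - trunc_slope c \<eta> s\<bar> \<le> c powr (q - 1) * d"
proof -
  let ?x = "max c (rmean \<psi> s)" and ?y = "max c (rmean \<eta> s)"
  have "\<bar>trunc_slope c \<psi> s - trunc_slope c \<eta> s\<bar> = s powr q * \<bar>?x powr q - ?y powr q\<bar>"
    using assms(1,2) by (simp add: trunc_slope_def powr_mult abs_mult flip: right_diff_distrib)
  also have "\<dots> \<le> 1 * (c powr (q - 1) * \<bar>?x - ?y\<bar>)"
    using assms(1,2) q_pos by (intro mult_mono powr_q_lipschitz powr_le1) auto
  also have "\<dots> \<le> c powr (q - 1) * d"
    using assms(3) by (auto intro!: mult_left_mono)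
  finally show ?thesis .
qed

text \<open>While \<open>w \<ge> 1/2\<close> the nonlinearity is at least \<open>m\<close>, and \<open>w\<close> cannot leave that range too early.\<close>

lemma rmean_ge_mean_bound:
  assumes k: "bounded_nonlinearity k m M" and cont: "continuous_on {0..1} (\<lambda>t. k t (cut01 (w t)))"
    and c: "0 \<le> c" "c \<le> M"
    and w: "\<And>r. r \<in> {0..1} \<Longrightarrow> integral {0..r} (trunc_slope c (\<lambda>t. k t (cut01 (w t)))) = 1 - w r"
    and s: "s \<in> {0..1}"
  shows "mean_bound m M \<le> rmean (\<lambda>t. k t (cut01 (w t))) s"
proof -
  let ?\<psi> = "\<lambda>t. k t (cut01 (w t))"
  define r0 where "r0 = 1 / (2 * (1 + M powr q))"
  have r0: "0 < r0" "r0 \<le> 1" "M powr q * r0 \<le> 1 / 2"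
    unfolding r0_def using half_inverse_bounds[of "M powr q"] by auto
  have k0: "0 \<le> ?\<psi> t" "?\<psi> t \<le> M" if "t \<in> {0..1}" for t
    using k that cut01_mem[of "w t"] unfolding bounded_nonlinearity_def by blast+
  have bd: "trunc_slope c ?\<psi> t \<le> M powr q" if t: "t \<in> {0..1}" for t
  proof -
    have "\<bar>rmean ?\<psi> t\<bar> \<le> M"
      using t k0 by (intro rmean_abs_le[OF cont]) auto
    then have "t * max c (rmean ?\<psi> t) \<le> 1 * M"
      using t c by (intro mult_mono) auto
    then show ?thesis
      unfolding trunc_slope_def using t c q_pos
      by (intro powr_mono2) (auto intro!: mult_nonneg_nonneg simp: le_max_iff_disj)
  qed
  have half: "w r \<in> {1/2..1}" if r: "r \<in> {0..r0}" for r
  proof -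
    have r1: "r \<in> {0..1}" using r r0 by auto
    have i: "trunc_slope c ?\<psi> integrable_on {0..r}"
      by (rule integrable_on_01_initial[OF continuous_trunc_slope[OF cont c(1)] r1])
    have "\<bar>integral {0..r} (trunc_slope c ?\<psi>)\<bar> \<le> M powr q * (r - 0)"
      using r1 bd i by (intro integral_abs_bound) (auto simp: trunc_slope_def)
    also have "\<dots> \<le> M powr q * r0" using r by (auto intro!: mult_left_mono)
    also have "\<dots> \<le> 1 / 2" by (rule r0(3))
    finally have "\<bar>1 - w r\<bar> \<le> 1 / 2" using w[OF r1] by simp
    moreover have "0 \<le> integral {0..r} (trunc_slope c ?\<psi>)"
      by (intro integral_nonneg i) (simp add: trunc_slope_def)
    ultimately show ?thesis using w[OF r1] by auto
  qed
  have "r0 ^ N * m / N \<le> rmean ?\<psi> s"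
  proof (rule rmean_lower[OF cont s k0(1)])
    fix t assume t: "t \<in> {0..r0}"
    have "cut01 (w t) \<in> {1/2..1}" using half[OF t] by (simp add: cut01_id)
    then show "m \<le> ?\<psi> t" using k t r0 unfolding bounded_nonlinearity_def by auto
  qed (use r0 k in \<open>auto simp: bounded_nonlinearity_def\<close>)
  then show ?thesis by (simp add: mean_bound_def r0_def)
qed

text \<open>Truncation bounds the slope of the power by c^(q-1), and neither \<open>rmean\<close>
  nor \<open>cut01\<close> increases sup distances. The summand 1 keeps the constant positive when L
  = 0.\<close>

lemma volterra_trunc_slope:
  assumes cont: "continuous_on ({0..1} \<times> {0..1}) (\<lambda>(t, x). k t x)" and c: "0 < c" and L: "0 \<le> L"
    and lip: "\<And>t x y. t \<in> {0..1} \<Longrightarrow> x \<in> {0..1} \<Longrightarrow> y \<in> {0..1} \<Longrightarrow> \<bar>k t x - k t y\<bar> \<le> L * \<bar>x - y\<bar>"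
  shows "volterra_operator (c powr (q - 1) * L + 1) (\<lambda>w. trunc_slope c (\<lambda>t. k t (cut01 (w t))))"
  unfolding volterra_operator_def
proof (intro conjI allI impI)
  show "0 < c powr (q - 1) * L + 1" using L by (intro add_nonneg_pos) auto
  show "continuous_on {0..1} (trunc_slope c (\<lambda>t. k t (cut01 (u t))))" if "continuous_on {0..1} u" for u
    using c by (intro continuous_trunc_slope continuous_cut01_comp cont that) auto
next
  fix u v :: "real \<Rightarrow> real" and s B :: real
  assume u: "continuous_on {0..1} u" and v: "continuous_on {0..1} v"
    and s: "s \<in> {0..1}" and B: "\<forall>t\<in>{0..s}. \<bar>u t - v t\<bar> \<le> B"
  have "\<bar>u 0 - v 0\<bar> \<le> B" using bspec[OF B, of 0] s by auto
  then have B0: "0 \<le> B" by linarith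
  have "\<bar>k t (cut01 (u t)) - k t (cut01 (v t))\<bar> \<le> L * B" if t: "t \<in> {0..s}" for t
  proof -
    have "\<bar>k t (cut01 (u t)) - k t (cut01 (v t))\<bar> \<le> L * \<bar>cut01 (u t) - cut01 (v t)\<bar>"
      using t s by (intro lip cut01_mem) auto
    also have "\<dots> \<le> L * B"
      using order_trans[OF cut01_lipschitz bspec[OF B t]] L by (intro mult_left_mono) auto
    finally show ?thesis .
  qed
  then have "\<bar>rmean (\<lambda>t. k t (cut01 (u t))) s - rmean (\<lambda>t. k t (cut01 (v t))) s\<bar> \<le> L * B"
    by (intro rmean_diff_le continuous_cut01_comp cont u v s)
  from trunc_slope_lipschitz[OF c s this]
  show "\<bar>trunc_slope c (\<lambda>t. k t (cut01 (u t))) s - trunc_slope c (\<lambda>t. k t (cut01 (v t))) s\<bar>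
      \<le> (c powr (q - 1) * L + 1) * B"
    using B0 by (simp add: algebra_simps)
qed

text \<open>The class contains the rescaled shooting nonlinearities \<open>K l a\<close> as well as
  the homogeneous ones \<open>hom c l\<close> with positive weight c, so existence and stability are
  proved once and the two families can be compared.\<close>

definition admissible :: "(real \<Rightarrow> real \<Rightarrow> real) \<Rightarrow> bool" where
  "admissible k \<longleftrightarrow> continuous_on ({0..1} \<times> {0..1}) (\<lambda>(t, x). k t x) \<and>
     (\<forall>t\<in>{0..1}. \<forall>x\<in>{0..1}. 0 \<le> k t x \<and> (0 < x \<longrightarrow> 0 < k t x)) \<and>
     (\<exists>L\<ge>0. \<forall>t\<in>{0..1}. \<forall>x\<in>{0..1}. \<forall>y\<in>{0..1}. \<bar>k t x - k t y\<bar> \<le> L * \<bar>x - y\<bar>)"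

lemma admissible_bounded:
  assumes "admissible k"
  obtains m M where "bounded_nonlinearity k m M"
proof -
  have c: "continuous_on ({0..1} \<times> {0..1}) (\<lambda>(t, x). k t x)"
    and pos: "\<And>t x. t \<in> {0..1} \<Longrightarrow> x \<in> {0..1} \<Longrightarrow> 0 \<le> k t x"
      "\<And>t x. t \<in> {0..1} \<Longrightarrow> x \<in> {0..1} \<Longrightarrow> 0 < x \<Longrightarrow> 0 < k t x"
    using assms unfolding admissible_def by blast+
  have "compact ({0..1::real} \<times> {0..1::real})" "{0..1::real} \<times> {0..1::real} \<noteq> {}"
    by (auto intro: compact_Times)
  then obtain M where M: "\<forall>z\<in>{0..1} \<times> {0..1}. (\<lambda>(t, x). k t x) z \<le> M"
    using continuous_attains_sup[OF _ _ c] by blast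
  have c': "continuous_on ({0..1} \<times> {1/2..1}) (\<lambda>(t, x). k t x)"
    by (rule continuous_on_subset[OF c]) auto
  have "compact ({0..1::real} \<times> {1/2..1::real})" "{0..1::real} \<times> {1/2..1::real} \<noteq> {}"
    by (auto intro: compact_Times)
  then obtain z where z: "z \<in> {0..1} \<times> {1/2..1}"
    "\<forall>w\<in>{0..1} \<times> {1/2..1}. (\<lambda>(t, x). k t x) z \<le> (\<lambda>(t, x). k t x) w"
    using continuous_attains_inf[OF _ _ c'] by blast
  obtain t x where tx: "z = (t, x)" by (cases z)
  have "0 < k t x" using z(1) tx pos(2)[of t x] by auto
  then have "bounded_nonlinearity k (k t x) M"
    unfolding bounded_nonlinearity_def using pos(1) M z(2) tx by auto
  then show thesis by (rule that)
qed

lemma admissible_continuous: "admissible k \<Longrightarrow> continuous_on ({0..1} \<times> {0..1}) (\<lambda>(t, x). k t x)"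
  by (simp add: admissible_def)

lemma admissible_lipschitz:
  assumes "admissible k"
  obtains L where "0 \<le> L"
    "\<And>t x y. t \<in> {0..1} \<Longrightarrow> x \<in> {0..1} \<Longrightarrow> y \<in> {0..1} \<Longrightarrow> \<bar>k t x - k t y\<bar> \<le> L * \<bar>x - y\<bar>"
  using assms unfolding admissible_def by blast

lemma admissible_exists:
  assumes ad: "admissible k"
  obtains w where "w 0 = 1" "profile (\<lambda>t. k t (cut01 (w t))) w"
proof -
  note cont = admissible_continuous[OF ad]
  obtain L where L: "0 \<le> L"
    and lip: "\<And>t x y. t \<in> {0..1} \<Longrightarrow> x \<in> {0..1} \<Longrightarrow> y \<in> {0..1} \<Longrightarrow> \<bar>k t x - k t y\<bar> \<le> L * \<bar>x - y\<bar>"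
    by (rule admissible_lipschitz[OF ad]) blast
  obtain m M where k: "bounded_nonlinearity k m M" by (rule admissible_bounded[OF ad])
  define c where "c = mean_bound m M"
  have "m \<le> k 0 1" "k 0 1 \<le> M" "0 < m"
    using k unfolding bounded_nonlinearity_def by auto
  then have m: "0 < m" "m \<le> M" by auto
  have c: "0 < c" "c \<le> M"
    using mean_bound_pos[OF m(1)] mean_bound_le[OF m(1), of M] m(2) by (auto simp: c_def)
  obtain w where w: "continuous_on {0..1} w"
    and eq: "\<And>r. r \<in> {0..1} \<Longrightarrow> w r = 1 - integral {0..r} (trunc_slope c (\<lambda>t. k t (cut01 (w t))))"
    using volterra_exists[OF volterra_trunc_slope[OF cont c(1) L lip]
          continuous_on_const[of "{0..1}" 1]] by blast
  let ?\<psi> = "\<lambda>t. k t (cut01 (w t))"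
  have c\<psi>: "continuous_on {0..1} ?\<psi>" by (rule continuous_cut01_comp[OF cont w])
  have *: "integral {0..r} (trunc_slope c ?\<psi>) = 1 - w r" if "r \<in> {0..1}" for r
    using eq[OF that] by linarith
  \<comment> \<open>The a priori bound holds for the truncated equation too, as long as the level c
    is at most M. The mean therefore never drops below c and the truncation can be removed.\<close>
  have "c \<le> rmean ?\<psi> s" if "s \<in> {0..1}" for s
    unfolding c_def using rmean_ge_mean_bound[OF k c\<psi> _ c(2) *] c(1) that by (simp add: c_def)
  then have "trunc_slope c ?\<psi> s = slope ?\<psi> s" if "s \<in> {0..1}" for s
    using that by (simp add: trunc_slope_eq)
  then have "integral {0..r} (slope ?\<psi>) = integral {0..r} (trunc_slope c ?\<psi>)" if "r \<in> {0..1}" for r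
    using that by (intro integral_cong) auto
  then have e: "w r = 1 - integral {0..r} (slope ?\<psi>)" if "r \<in> {0..1}" for r
    using eq[OF that] that by simp
  have w0: "w 0 = 1" using e[of 0] by simp
  have "0 \<le> ?\<psi> t" if "t \<in> {0..1}" for t
    using k that cut01_mem[of "w t"] unfolding bounded_nonlinearity_def by blast
  then have "profile ?\<psi> w"
    using c\<psi> e unfolding profile_def w0 slope_def[abs_def] by blast
  with w0 show thesis by (rule that)
qed

text \<open>A solution w' for a nearby k' is an approximate solution of the equation of k, so
  \<open>volterra_stable\<close> applies with constants that come from k alone.\<close>

lemma admissible_stable:
  assumes ad: "admissible k" and w: "w 0 = 1" "profile (\<lambda>t. k t (cut01 (w t))) w" and e: "0 < e"
  shows "\<exists>d>0. \<forall>k' w'. (\<forall>t\<in>{0..1}. \<forall>x\<in>{0..1}. 0 \<le> k' t x \<and> \<bar>k' t x - k t x\<bar> \<le> d) \<longrightarrow>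
    w' 0 = 1 \<longrightarrow> profile (\<lambda>t. k' t (cut01 (w' t))) w' \<longrightarrow> (\<forall>r\<in>{0..1}. \<bar>w r - w' r\<bar> < e)"
proof -
  note cont = admissible_continuous[OF ad]
  obtain L where L: "0 \<le> L"
    and lip: "\<And>t x y. t \<in> {0..1} \<Longrightarrow> x \<in> {0..1} \<Longrightarrow> y \<in> {0..1} \<Longrightarrow> \<bar>k t x - k t y\<bar> \<le> L * \<bar>x - y\<bar>"
    by (rule admissible_lipschitz[OF ad]) blast
  obtain m M where k: "bounded_nonlinearity k m M" by (rule admissible_bounded[OF ad])
  \<comment> \<open>Every k' within m/2 of k obeys these weakened bounds, so a single truncation
    level c serves k and all its perturbations.\<close>
  define m' M' where "m' = m / 2" and "M' = M + m / 2"
  define c where "c = mean_bound m' M'"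
  have "m \<le> k 0 1" "k 0 1 \<le> M" "0 < m"
    using k unfolding bounded_nonlinearity_def by auto
  then have m: "0 < m" "m \<le> M" by auto
  have c: "0 < c" "c \<le> M'"
    using mean_bound_pos[of m' M'] mean_bound_le[of m' M'] m by (auto simp: c_def m'_def M'_def)
  define L' where "L' = c powr (q - 1) * L + 1"
  have V: "volterra_operator L' (\<lambda>w. trunc_slope c (\<lambda>t. k t (cut01 (w t))))"
    unfolding L'_def by (rule volterra_trunc_slope[OF cont c(1) L lip])
  have kb: "0 \<le> k t x" "k t x \<le> M" if "t \<in> {0..1}" "x \<in> {0..1}" for t x
    using k that unfolding bounded_nonlinearity_def by auto
  have km: "m \<le> k t x" if "t \<in> {0..1}" "x \<in> {1/2..1}" for t x
    using k that unfolding bounded_nonlinearity_def by auto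
  have *: "c \<le> rmean (\<lambda>t. k' t (cut01 (w' t))) s"
    if "\<And>t x. t \<in> {0..1} \<Longrightarrow> x \<in> {0..1} \<Longrightarrow> 0 \<le> k' t x \<and> \<bar>k' t x - k t x\<bar> \<le> m / 2"
      and w': "w' 0 = 1" "profile (\<lambda>t. k' t (cut01 (w' t))) w'" and s: "s \<in> {0..1}" for k' w' s
  proof -
    let ?\<psi> = "\<lambda>t. k' t (cut01 (w' t))"
    have "bounded_nonlinearity k' m' M'"
      unfolding bounded_nonlinearity_def
    proof (intro conjI ballI)
      show "0 < m'" using m by (simp add: m'_def)
      fix t x :: real assume t: "t \<in> {0..1}"
      { assume "x \<in> {0..1}"
        from that(1)[OF t this] kb[OF t this]
        show "0 \<le> k' t x" "k' t x \<le> M'"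
          unfolding M'_def by linarith+ }
      { assume "x \<in> {1/2..1}"
        then have "x \<in> {0..1}" by auto
        from that(1)[OF t this] km[OF t \<open>x \<in> {1/2..1}\<close>]
        show "m' \<le> k' t x"
          unfolding m'_def by linarith }
    qed
    \<comment> \<open>Truncation at level 0 changes nothing because the means are nonnegative; this
      brings the untruncated equation of w' under the a priori bound.\<close>
    moreover have "trunc_slope 0 ?\<psi> t = slope ?\<psi> t" if "t \<in> {0..1}" for t
      using that by (intro trunc_slope_eq rmean_nonneg profileD[OF w'(2)])
    then have ts: "integral {0..r} (trunc_slope 0 ?\<psi>) = integral {0..r} (slope ?\<psi>)" if "r \<in> {0..1}" for r
      using that by (intro integral_cong) auto
    then have "integral {0..r} (trunc_slope 0 ?\<psi>) = 1 - w' r" if "r \<in> {0..1}" for r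
      using ts[OF that] profileD(3)[OF w'(2) that] w'(1) by linarith
    ultimately show ?thesis
      unfolding c_def using c s profileD(1)[OF w'(2)]
      by (intro rmean_ge_mean_bound[where c = 0]) auto
  qed
  let ?\<psi> = "\<lambda>t. k t (cut01 (w t))"
  have "c \<le> rmean ?\<psi> s" if "s \<in> {0..1}" for s
    using *[of k w s] kb m that w by auto
  then have "trunc_slope c ?\<psi> s = slope ?\<psi> s" if "s \<in> {0..1}" for s
    using that by (simp add: trunc_slope_eq)
  then have ts: "integral {0..r} (trunc_slope c ?\<psi>) = integral {0..r} (slope ?\<psi>)" if "r \<in> {0..1}" for r
    using that by (intro integral_cong) auto
  have w_eq: "w r = 1 - integral {0..r} (trunc_slope c ?\<psi>)" if "r \<in> {0..1}" for r
    using ts[OF that] profileD(3)[OF w(2) that] w(1) by linarith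
  \<comment> \<open>Replacing k by k' produces a defect of at most c^(q-1) \<eta>, which the
    stability estimate multiplies by 2 exp (2 L').\<close>
  define C where "C = 2 * exp (2 * L') * c powr (q - 1)"
  have C: "0 < C" using c by (simp add: C_def)
  define \<eta> where "\<eta> = min (m / 2) (e / (2 * C))"
  have \<eta>: "0 < \<eta>" "\<eta> \<le> m / 2" "C * \<eta> < e"
    using C m e by (auto simp: \<eta>_def min_def field_simps)
  show ?thesis
  proof (intro exI[of _ \<eta>] conjI allI impI ballI)
    fix k' :: "real \<Rightarrow> real \<Rightarrow> real" and w' :: "real \<Rightarrow> real" and r :: real
    assume near_k: "\<forall>t\<in>{0..1}. \<forall>x\<in>{0..1}. 0 \<le> k' t x \<and> \<bar>k' t x - k t x\<bar> \<le> \<eta>"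
      and w': "w' 0 = 1" "profile (\<lambda>t. k' t (cut01 (w' t))) w'" and r: "r \<in> {0..1}"
    have k': "0 \<le> k' t x \<and> \<bar>k' t x - k t x\<bar> \<le> \<eta>" if "t \<in> {0..1}" "x \<in> {0..1}" for t x
      using near_k that by blast
    let ?\<psi>' = "\<lambda>t. k' t (cut01 (w' t))" and ?\<psi>'' = "\<lambda>t. k t (cut01 (w' t))"
    have cw': "continuous_on {0..1} w'" by (rule profile_continuous[OF w'(2)])
    have c'': "continuous_on {0..1} ?\<psi>''" by (rule continuous_cut01_comp[OF cont cw'])
    have k'_near: "0 \<le> k' t x \<and> \<bar>k' t x - k t x\<bar> \<le> m / 2" if "t \<in> {0..1}" "x \<in> {0..1}" for t x
      using k'[OF that] \<eta>(2) by linarith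
    have ge: "c \<le> rmean ?\<psi>' s" if "s \<in> {0..1}" for s
      by (rule *[OF k'_near w' that])
    have near: "\<bar>trunc_slope c ?\<psi>'' s - slope ?\<psi>' s\<bar> \<le> c powr (q - 1) * \<eta>" if s: "s \<in> {0..1}" for s
    proof -
      have "\<bar>rmean ?\<psi>'' s - rmean ?\<psi>' s\<bar> \<le> \<eta>"
        using k' cut01_mem s
        by (intro rmean_diff_le c'' profileD(1)[OF w'(2)]) (auto simp: abs_minus_commute)
      from trunc_slope_lipschitz[OF c(1) s this] show ?thesis
        using ge[OF s] by (simp add: trunc_slope_eq)
    qed
    have e0: "0 \<le> c powr (q - 1) * \<eta>" using near[of 0] by auto
    have "\<bar>w r - w' r\<bar> \<le> 2 * exp (2 * L') * (c powr (q - 1) * \<eta>)"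
    proof (rule volterra_stable[OF V profile_continuous[OF w(2)] w_eq cw' _ r])
      fix x :: real assume x: "x \<in> {0..1}"
      have i: "trunc_slope c ?\<psi>'' integrable_on {0..x}" "slope ?\<psi>' integrable_on {0..x}"
        using c by (auto intro!: integrable_on_01_initial[OF _ x] continuous_trunc_slope c''
            profile_continuous_slope[OF w'(2)])
      have "\<bar>integral {0..x} (\<lambda>s. trunc_slope c ?\<psi>'' s - slope ?\<psi>' s)\<bar> \<le> c powr (q - 1) * \<eta> * (x - 0)"
        using x near i by (intro integral_abs_bound) (auto intro: integrable_diff)
      also have "\<dots> \<le> c powr (q - 1) * \<eta>" using x e0 by (auto intro: mult_left_le)
      finally show "\<bar>w' x - (1 - integral {0..x} (trunc_slope c ?\<psi>''))\<bar> \<le> c powr (q - 1) * \<eta>"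
        using profileD(3)[OF w'(2) x] w'(1) i by (simp add: integral_diff)
    qed
    then show "\<bar>w r - w' r\<bar> < e" using \<eta>(3) by (simp add: C_def mult.assoc)
  qed (rule \<eta>(1))
qed

end

lemma DERIV_nonneg_imp_le_open:
  fixes f :: "real \<Rightarrow> real"
  assumes "a \<le> b" and der: "\<And>x. a < x \<Longrightarrow> x < b \<Longrightarrow> \<exists>y. (f has_real_derivative y) (at x) \<and> 0 \<le> y"
    and cont: "continuous_on {a..b} f"
  shows "f a \<le> f b"
proof (cases "a = b")
  case False
  then have "a < b" using assms(1) by simp
  moreover have "f differentiable (at x)" if "a < x" "x < b" for x
    using der[OF that] real_differentiable_def by blast
  ultimately obtain l z where z: "a < z" "z < b" "(f has_real_derivative l) (at z)"
      "f b - f a = (b - a) * l"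
    using MVT[OF _ cont] by blast
  moreover have "0 \<le> l"
    using der[OF z(1,2)] z(3) DERIV_unique by blast
  ultimately show ?thesis
    using \<open>a < b\<close> by (metis diff_ge_0_iff_ge less_imp_le mult_nonneg_nonneg)
qed simp

context radial
begin

section \<open>Sturm comparison\<close>

lemma at_left_le_within_01:
  assumes "0 < \<rho>" "\<rho> \<le> (1::real)"
  shows "at_left \<rho> \<le> at \<rho> within {0..1}"
proof (rule filter_leI)
  fix P assume "eventually P (at \<rho> within {0..1})"
  then obtain d where d: "d > 0" "\<And>x. x \<in> {0..1} \<Longrightarrow> x \<noteq> \<rho> \<Longrightarrow> dist x \<rho> < d \<Longrightarrow> P x"
    unfolding eventually_at by auto
  show "eventually P (at_left \<rho>)"
    unfolding eventually_at_left_real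
    by (rule eventually_mono[OF eventually_at_left_real[of "max 0 (\<rho> - d)" \<rho>]])
       (use d assms in \<open>auto simp: dist_real_def\<close>)
qed

text \<open>Young's inequality with exponents p and p/(p-1), multiplied by p. It supplies the sign
  of the gradient terms in Picone's identity.\<close>

lemma young_powr:
  assumes "0 \<le> a" "0 \<le> b"
  shows "p * a * b powr (p - 1) \<le> a powr p + (p - 1) * b powr p"
proof -
  have "a * b powr (p - 1) \<le> a powr p / p + (b powr (p - 1)) powr (p / (p - 1)) / (p / (p - 1))"
    using assms p by (intro Youngs_inequality) (auto simp: field_simps)
  also have "(b powr (p - 1)) powr (p / (p - 1)) = b powr p"
    using p by (simp add: powr_powr)
  finally have "p * (a * b powr (p - 1)) \<le> p * (a powr p / p + b powr p / (p / (p - 1)))"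
    using p by (intro mult_left_mono) auto
  also have "\<dots> = a powr p + (p - 1) * b powr p"
    using p by (simp add: field_simps)
  finally show ?thesis by (simp add: mult.assoc)
qed

lemma slope_power:
  assumes "profile \<psi> u" "r \<in> {0..1}"
  shows "r ^ (N - 1) * slope \<psi> r powr (p - 1) = r ^ N * rmean \<psi> r"
proof -
  have "0 \<le> r * rmean \<psi> r"
    using rmean_nonneg[OF profileD(1)[OF assms(1)] assms(2) profileD(2)[OF assms(1)]] assms(2) by auto
  then have "slope \<psi> r powr (p - 1) = r * rmean \<psi> r"
    unfolding slope_def by (rule powr_q_inverse)
  moreover have "r ^ N = r ^ (N - 1) * r" using N by (cases N) auto
  ultimately show ?thesis by simp
qed

text \<open>
  Picone's identity: \<open>v (P\<^sub>v - (v / u)\<^sup>p\<^sup>-\<^sup>1 P\<^sub>u)\<close>, where \<open>P\<^sub>u = - r\<^sup>N\<^sup>-\<^sup>1 \<phi> (u')\<close>, is non-increasing, starts at \<open>0\<close> and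
  ends at \<open>0\<close>.
\<close>

lemma sturm_comparison:
  assumes u: "profile \<psi> u" and v: "profile \<eta> v" and \<psi>0: "0 < \<psi> 0" and \<eta>0: "0 < \<eta> 0"
    and \<rho>: "0 < \<rho>" "\<rho> \<le> 1"
    and upos: "\<And>r. 0 \<le> r \<Longrightarrow> r < \<rho> \<Longrightarrow> 0 < u r" and vpos: "\<And>r. 0 \<le> r \<Longrightarrow> r < \<rho> \<Longrightarrow> 0 < v r"
    and v\<rho>: "v \<rho> = 0" and u\<rho>: "0 \<le> u \<rho>"
    and le: "\<And>r. 0 < r \<Longrightarrow> r < \<rho> \<Longrightarrow> \<eta> r / v r powr (p - 1) \<le> \<psi> r / u r powr (p - 1)"
  shows "u \<rho> = 0" "\<And>r. 0 < r \<Longrightarrow> r < \<rho> \<Longrightarrow> \<eta> r / v r powr (p - 1) = \<psi> r / u r powr (p - 1)"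
proof -
  define Pu where "Pu r = r ^ N * rmean \<psi> r" for r
  define Pv where "Pv r = r ^ N * rmean \<eta> r" for r
  define t where "t r = v r / u r" for r
  define Q where "Q r = v r * (Pv r - t r powr (p - 1) * Pu r)" for r
  \<comment> \<open>The zero-order part of -Q', nonnegative by the hypothesis on the
    coefficients.\<close>
  define E where "E r = r ^ (N - 1) * v r powr p * (\<psi> r / u r powr (p - 1) - \<eta> r / v r powr (p - 1))" for r
  have deriv: "\<exists>d. (Q has_real_derivative d) (at r) \<and> d \<le> - E r" if r: "0 < r" "r < \<rho>" for r
  proof -
    have r1: "r \<in> {0..1}" "r < 1" using r \<rho> by auto
    note inside = has_real_derivative_inside[OF _ r(1) r1(2)]
    have ur: "0 < u r" and vr: "0 < v r" using upos vpos r by auto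
    then have tr: "0 < t r" by (simp add: t_def)
    define su where "su = slope \<psi> r"
    define sv where "sv = slope \<eta> r"
    have s0: "0 \<le> su" "0 \<le> sv" by (auto simp: su_def sv_def slope_nonneg)
    have du: "(u has_real_derivative - su) (at r)" and dv: "(v has_real_derivative - sv) (at r)"
      unfolding su_def sv_def by (intro inside profile_has_derivative u v r1)+
    have dPu: "(Pu has_real_derivative r ^ (N - 1) * \<psi> r) (at r)"
      and dPv: "(Pv has_real_derivative r ^ (N - 1) * \<eta> r) (at r)"
      unfolding Pu_def[abs_def] Pv_def[abs_def]
      by (intro inside power_rmean_has_derivative profileD[OF u] profileD[OF v] r1)+
    define t' where "t' = (t r * su - sv) / u r"
    have dt: "(t has_real_derivative t') (at r)"
      unfolding t_def[abs_def] t'_def using ur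
      by (auto intro!: derivative_eq_intros du dv simp: t_def field_simps power2_eq_square)
    have dtp: "((\<lambda>r. t r powr (p - 1)) has_real_derivative (p - 1) * t r powr (p - 2) * t') (at r)"
      using DERIV_chain2[OF has_real_derivative_powr[OF tr, of "p - 1"] dt] by simp
    have dQ: "(Q has_real_derivative
        - sv * (Pv r - t r powr (p - 1) * Pu r)
        + v r * (r ^ (N - 1) * \<eta> r - ((p - 1) * t r powr (p - 2) * t' * Pu r
            + t r powr (p - 1) * (r ^ (N - 1) * \<psi> r)))) (at r)"
      (is "(Q has_real_derivative ?D) (at r)")
      unfolding Q_def[abs_def]
      by (rule DERIV_cong[OF DERIV_mult[OF dv DERIV_diff[OF dPv DERIV_mult[OF dtp dPu]]]])
         (simp add: algebra_simps)
    have vt: "v r = t r * u r" using ur by (simp add: t_def)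
    have tp: "t r powr (p - 1) = t r * t r powr (p - 2)"
      using tr powr_mult_base[of "t r" "p - 2"] by simp
    have "v r * (t r powr (p - 2) * t') = t r powr (p - 1) * (t r * su - sv)"
      using ur by (simp add: t'_def vt tp)
    then have "?D = v r * (r ^ (N - 1) * \<eta> r - t r powr (p - 1) * (r ^ (N - 1) * \<psi> r))
        + (- sv * Pv r + sv * t r powr (p - 1) * Pu r
           - (p - 1) * (t r powr (p - 1) * (t r * su - sv)) * Pu r)"
      by algebra
    also have "v r * (r ^ (N - 1) * \<eta> r - t r powr (p - 1) * (r ^ (N - 1) * \<psi> r)) = - E r"
    proof -
      have vp: "v r powr p = v r * v r powr (p - 1)"
        using vr powr_mult_base[of "v r" "p - 1"] by simp
      have "t r powr (p - 1) = v r powr (p - 1) / u r powr (p - 1)"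
        using ur vr by (simp add: t_def powr_divide)
      then show ?thesis using vr ur by (simp add: E_def vp field_simps)
    qed
    \<comment> \<open>Expressed by the slopes, the gradient terms are Young's inequality for sv and
      t su, up to the factor r^(N-1).\<close>
    also have "- sv * Pv r + sv * t r powr (p - 1) * Pu r
           - (p - 1) * (t r powr (p - 1) * (t r * su - sv)) * Pu r
        = r ^ (N - 1) * (p * sv * (t r * su) powr (p - 1) - sv powr p - (p - 1) * (t r * su) powr p)"
    proof -
      have 1: "Pu r = r ^ (N - 1) * su powr (p - 1)" "Pv r = r ^ (N - 1) * sv powr (p - 1)"
        using slope_power[OF u r1(1)] slope_power[OF v r1(1)] by (auto simp: Pu_def Pv_def su_def sv_def)
      have 2: "x powr p = x * x powr (p - 1)" if "0 \<le> x" for x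
        using that powr_mult_base[of x "p - 1"] by simp
      have 3: "(t r * su) powr (p - 1) = t r powr (p - 1) * su powr (p - 1)"
        using tr s0 by (simp add: powr_mult)
      show ?thesis
        unfolding 1 using tr s0 by (simp add: 2 3) algebra
    qed
    also have "\<dots> \<le> r ^ (N - 1) * 0"
      using young_powr[of sv "t r * su"] s0 tr r by (intro mult_left_mono) auto
    finally have "?D \<le> - E r" by simp
    with dQ show ?thesis by blast
  qed
  have E0: "0 \<le> E r" if "0 < r" "r < \<rho>" for r
    unfolding E_def using le[OF that] that by simp
  have cu: "continuous_on {0..1} u" and cv: "continuous_on {0..1} v"
    by (auto intro: profile_continuous u v)
  have cPu: "continuous_on {0..1} Pu" and cPv: "continuous_on {0..1} Pv"
    unfolding Pu_def[abs_def] Pv_def[abs_def]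
    by (intro continuous_intros continuous_rmean profileD[OF u] profileD[OF v])+
  have sub: "{0..<\<rho>} \<subseteq> {0..1}" using \<rho> by auto
  note c0 = cu cv cPu cPv
  note c = c0[THEN continuous_on_subset, OF sub]
  have cQ: "continuous_on {0..<\<rho>} Q"
    unfolding Q_def[abs_def] t_def[abs_def]
    by (intro continuous_intros continuous_on_powr' c)
       (use upos vpos p in \<open>force simp: less_imp_le\<close>)+
  have mono: "Q s \<le> Q r" if "0 \<le> r" "r \<le> s" "s < \<rho>" for r s
  proof -
    have "- Q r \<le> - Q s"
    proof (rule DERIV_nonneg_imp_le_open[OF that(2)])
      fix x assume x: "r < x" "x < s"
      then obtain d where "(Q has_real_derivative d) (at x)" "d \<le> - E x" "0 \<le> E x"
        using deriv[of x] E0[of x] \<open>0 \<le> r\<close> \<open>s < \<rho>\<close> by auto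
      then show "\<exists>y. ((\<lambda>x. - Q x) has_real_derivative y) (at x) \<and> 0 \<le> y"
        by (intro exI[of _ "- d"]) (auto intro: DERIV_minus)
    next
      show "continuous_on {r..s} (\<lambda>x. - Q x)"
        by (intro continuous_intros continuous_on_subset[OF cQ]) (use that in auto)
    qed
    then show ?thesis by simp
  qed
  have Q0: "Q 0 = 0" using N by (simp add: Q_def Pu_def Pv_def)
  define F where "F = at_left \<rho>"
  have F: "F \<noteq> bot" by (simp add: F_def trivial_limit_at_left_real)
  have Fle: "F \<le> at \<rho> within {0..1}" unfolding F_def by (rule at_left_le_within_01[OF \<rho>])
  have \<rho>1: "\<rho> \<in> {0..1}" using \<rho> by auto
  have evF: "eventually (\<lambda>x. 0 < x \<and> x < \<rho>) F"
    unfolding F_def using eventually_at_left_real[OF \<rho>(1)] by eventually_elim auto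
  have lim: "(g \<longlongrightarrow> g \<rho>) F" if "continuous_on {0..1} g" for g :: "real \<Rightarrow> real"
    using that \<rho>1 Fle unfolding continuous_on_def by (meson tendsto_mono)
  \<comment> \<open>Q can be followed up to \<rho> only if v/u has a limit there. When both vanish
    at \<rho>, the limit is the quotient of the one-sided derivatives, and the slope of u at \<rho>
    is positive since \<psi>(0) > 0.\<close>
  have "\<exists>\<tau>\<ge>0. (t \<longlongrightarrow> \<tau>) F \<and> (u \<rho> > 0 \<longrightarrow> \<tau> = 0)"
  proof (cases "u \<rho> = 0")
    case False
    then have "(t \<longlongrightarrow> v \<rho> / u \<rho>) F"
      unfolding t_def[abs_def] by (intro tendsto_intros lim cu cv)
    then show ?thesis using v\<rho> by auto
  next
    case True
    have q: "((\<lambda>x. g x / (x - \<rho>)) \<longlongrightarrow> D) F"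
      if "(g has_real_derivative D) (at \<rho> within {0..1})" "g \<rho> = 0" for g D
      using that Fle unfolding has_field_derivative_iff by (auto intro: tendsto_mono)
    have su: "0 < slope \<psi> \<rho>" by (rule profile_slope_pos[where u = u, OF u \<psi>0 \<rho>])
    have "((\<lambda>x. (v x / (x - \<rho>)) / (u x / (x - \<rho>))) \<longlongrightarrow> - slope \<eta> \<rho> / - slope \<psi> \<rho>) F"
      using su by (intro tendsto_divide q profile_has_derivative u v \<rho>1 v\<rho> True) auto
    then have "(t \<longlongrightarrow> - slope \<eta> \<rho> / - slope \<psi> \<rho>) F"
      by (rule Lim_transform_eventually) (use evF in \<open>eventually_elim, auto simp: t_def\<close>)
    then show ?thesis using su True slope_nonneg[of \<eta> \<rho>] by (intro exI[of _ "slope \<eta> \<rho> / slope \<psi> \<rho>"]) auto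
  qed
  then obtain \<tau> where \<tau>: "0 \<le> \<tau>" "(t \<longlongrightarrow> \<tau>) F" "u \<rho> > 0 \<Longrightarrow> \<tau> = 0" by blast
  have tpos: "eventually (\<lambda>x. 0 \<le> t x) F"
    using evF by eventually_elim (use upos vpos in \<open>auto simp: t_def less_imp_le\<close>)
  have limt: "((\<lambda>x. t x powr (p - 1) * Pu x) \<longlongrightarrow> \<tau> powr (p - 1) * Pu \<rho>) F"
    using p tpos by (intro tendsto_mult tendsto_powr' \<tau>(2) lim cPu tendsto_const) auto
  have "(Q \<longlongrightarrow> v \<rho> * (Pv \<rho> - \<tau> powr (p - 1) * Pu \<rho>)) F"
    unfolding Q_def[abs_def] by (intro tendsto_mult tendsto_diff limt lim cv cPv)
  then have limQ: "(Q \<longlongrightarrow> 0) F" by (simp add: v\<rho>)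
  have Qzero: "Q r = 0" if r: "0 < r" "r < \<rho>" for r
  proof (rule antisym)
    show "Q r \<le> 0" using mono[of 0 r] r Q0 by simp
    have "eventually (\<lambda>s. Q s \<le> Q r) F"
      unfolding F_def by (rule eventually_mono[OF eventually_at_left_real[OF r(2)]])
         (use r mono in auto)
    then show "0 \<le> Q r" by (rule tendsto_upperbound[OF limQ _ F])
  qed
  show "\<eta> r / v r powr (p - 1) = \<psi> r / u r powr (p - 1)" if r: "0 < r" "r < \<rho>" for r
  proof -
    obtain d where d: "(Q has_real_derivative d) (at r)" "d \<le> - E r" using deriv[OF r] by blast
    have "((\<lambda>_. 0) has_real_derivative d) (at r)"
      by (rule has_field_derivative_transform_within_open[OF d(1), of "{0<..<\<rho>}"])
         (use r Qzero in auto)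
    then have "d = 0" using DERIV_unique[OF _ DERIV_const] by blast
    then have "E r = 0" using d(2) E0[OF r] by simp
    then show ?thesis using r vpos[of r] by (simp add: E_def)
  qed
  \<comment> \<open>If u(\<rho>) > 0, then v/u tends to 0, and Q = 0 reads \<open>Pv\<close> =
    (v/u)^(p-1) \<open>Pu\<close>, which tends to 0; but the flux \<open>Pv\<close> is positive at
    \<rho>.\<close>
  show "u \<rho> = 0"
  proof (rule ccontr)
    assume "u \<rho> \<noteq> 0"
    then have "\<tau> = 0" using \<tau>(3) u\<rho> by simp
    then have "((\<lambda>x. t x powr (p - 1) * Pu x) \<longlongrightarrow> 0) F" using limt by simp
    moreover have "eventually (\<lambda>x. t x powr (p - 1) * Pu x = Pv x) F"
      using evF
    proof eventually_elim
      case (elim x)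
      then show ?case using Qzero[of x] vpos[of x] by (simp add: Q_def)
    qed
    ultimately have "(Pv \<longlongrightarrow> 0) F" by (rule Lim_transform_eventually)
    then have "Pv \<rho> = 0" using tendsto_unique[OF F lim[OF cPv]] by simp
    moreover have "0 < Pv \<rho>"
      unfolding Pv_def using profile_rmean_pos[OF v \<eta>0 \<rho>1] \<rho> by simp
    ultimately show False by simp
  qed
qed

end

section \<open>Derivatives within the closed unit interval\<close>

lemma D01_eq:
  assumes "(u has_real_derivative d) (at r within {0..1})" "r \<in> {0..1}"
  shows "D01 u r = d"
  unfolding D01_def
  using assms by (intro vector_derivative_within_closed_interval)
    (auto simp: has_real_derivative_iff_has_vector_derivative)

lemma C1_01I:
  assumes "\<And>r. r \<in> {0..1} \<Longrightarrow> (u has_real_derivative d r) (at r within {0..1})"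
    and "continuous_on {0..1} d"
  shows "C1_01 u"
  unfolding C1_01_def
proof
  show "u differentiable_on {0..1}"
    using assms(1) unfolding differentiable_on_def
    by (meson field_differentiable_def field_differentiable_imp_differentiable)
  show "continuous_on {0..1} (D01 u)"
    using assms(2) by (rule continuous_on_eq) (simp add: D01_eq[OF assms(1)])
qed

lemma C1_01D:
  assumes "C1_01 u" "r \<in> {0..1}"
  shows "(u has_real_derivative D01 u r) (at r within {0..1})"
  using assms unfolding C1_01_def D01_def differentiable_on_def
  by (auto simp: has_real_derivative_iff_has_vector_derivative vector_derivative_works)

lemma C1_01_continuous: "C1_01 u \<Longrightarrow> continuous_on {0..1} u"
  by (rule DERIV_continuous_on) (rule C1_01D)

context radial
begin

section \<open>Solutions and profiles\<close>

lemma power_N: "(x::real) ^ N = x ^ (N - 1) * x"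
  using N by (cases N) (auto simp: mult.commute)

text \<open>Adding s^N times the mean to the weighted flux gives a function that has zero derivative
  on (0,1) and vanishes at 0. The sign of the source is left open, so that the formula can also rule
  out eigenvalues \<mu> \<le> 0.\<close>

lemma is_solution_flux:
  assumes sol: "is_solution N p g \<mu> v" and cont: "continuous_on {0..1} (\<lambda>r. \<mu> * g r (v r))"
    and s: "s \<in> {0..1}"
  shows "phi p (D01 v s) = - (s * rmean (\<lambda>r. \<mu> * g r (v r)) s)"
proof (cases "s = 0")
  case True
  then show ?thesis using sol by (simp add: is_solution_def phi_def)
next
  case False
  then have s0: "0 < s" using s by simp
  let ?\<psi> = "\<lambda>r. \<mu> * g r (v r)"
  let ?F = "\<lambda>s. s ^ (N - 1) * phi p (D01 v s) + s ^ N * rmean ?\<psi> s"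
  have cF: "continuous_on {0..1} ?F"
    using sol unfolding is_solution_def
    by (intro continuous_intros continuous_rmean cont C1_01_continuous) auto
  have "?F s = ?F 0"
  proof (rule DERIV_isconst_end[OF s0])
    show "continuous_on {0..s} ?F" by (rule continuous_on_subset[OF cF]) (use s in auto)
    fix x assume x: "0 < x" "x < s"
    have "((\<lambda>s. s ^ (N - 1) * phi p (D01 v s)) has_real_derivative - (\<mu> * x ^ (N - 1) * g x (v x))) (at x)"
      using sol x s unfolding is_solution_def by auto
    moreover have "((\<lambda>s. s ^ N * rmean ?\<psi> s) has_real_derivative x ^ (N - 1) * ?\<psi> x) (at x)"
      using x s by (intro has_real_derivative_inside[OF power_rmean_has_derivative[OF cont]]) auto
    ultimately show "(?F has_real_derivative 0) (at x)"
      by (rule DERIV_cong[OF DERIV_add]) simp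
  qed
  also have "?F 0 = 0"
    using sol N by (simp add: is_solution_def phi_def)
  finally have "s ^ (N - 1) * phi p (D01 v s) = - (s ^ N * rmean ?\<psi> s)" by linarith
  also have "\<dots> = s ^ (N - 1) * - (s * rmean ?\<psi> s)" using N by (simp add: power_N)
  finally show ?thesis
    using s0 mult_left_cancel[of "s ^ (N - 1)"] by (metis less_irrefl power_not_zero)
qed

text \<open>A nonnegative source fixes the sign of v', so phi can be inverted by the q-th power and
  the flux formula integrated once more.\<close>

lemma is_solution_imp_profile:
  assumes sol: "is_solution N p g \<mu> v" and cont: "continuous_on {0..1} (\<lambda>r. \<mu> * g r (v r))"
    and nonneg: "\<And>r. r \<in> {0..1} \<Longrightarrow> 0 \<le> \<mu> * g r (v r)"
  shows "profile (\<lambda>r. \<mu> * g r (v r)) v"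
proof -
  let ?\<psi> = "\<lambda>r. \<mu> * g r (v r)"
  have D: "D01 v s = - slope ?\<psi> s" if s: "s \<in> {0..1}" for s
    unfolding slope_def
    using is_solution_flux[OF sol cont s] rmean_nonneg[OF cont s nonneg] s
    by (intro phi_eq_minusD) auto
  have "v r = v 0 - integral {0..r} (slope ?\<psi>)" if r: "r \<in> {0..1}" for r
  proof -
    have "(v has_vector_derivative - slope ?\<psi> x) (at x within {0..r})" if "x \<in> {0..r}" for x
    proof -
      have x: "x \<in> {0..1}" using that r by auto
      have "(v has_real_derivative - slope ?\<psi> x) (at x within {0..1})"
        using C1_01D[of v x] sol x D[OF x] by (simp add: is_solution_def)
      then have "(v has_real_derivative - slope ?\<psi> x) (at x within {0..r})"
        by (rule DERIV_subset) (use r in auto)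
      then show ?thesis by (simp add: has_real_derivative_iff_has_vector_derivative)
    qed
    then have "((\<lambda>x. - slope ?\<psi> x) has_integral (v r - v 0)) {0..r}"
      using r by (intro fundamental_theorem_of_calculus) auto
    from has_integral_neg[OF this] have "integral {0..r} (slope ?\<psi>) = - (v r - v 0)"
      by (intro integral_unique) simp
    then show ?thesis by linarith
  qed
  then show ?thesis
    using cont nonneg unfolding profile_def slope_def[abs_def] by blast
qed

lemma rmean_0: "rmean \<psi> 0 = \<psi> 0 / N"
proof -
  have "((\<lambda>\<tau>. \<tau> ^ (N - 1)) has_integral (1 ^ N / N - 0 ^ N / N)) {0..1::real}"
    using N
    by (intro fundamental_theorem_of_calculus)
       (auto intro!: derivative_eq_intros simp flip: has_real_derivative_iff_has_vector_derivative)
  then have "integral {0..1} (\<lambda>\<tau>::real. \<tau> ^ (N - 1)) = 1 / N" using N by (simp add: integral_unique)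
  then show ?thesis by (simp add: rmean_def)
qed

text \<open>This makes phi(u') continuously differentiable up to the centre. At r = 0 the difference
  quotient is the mean itself, and the general formula agrees with its limit because the mean at 0
  is \<psi>(0)/N.\<close>

lemma times_rmean_has_derivative:
  assumes cont: "continuous_on {0..1} \<psi>" and r: "r \<in> {0..1}"
  shows "((\<lambda>s. s * rmean \<psi> s) has_real_derivative \<psi> r - (N - 1) * rmean \<psi> r) (at r within {0..1})"
proof (cases "r = 0")
  case True
  have "(rmean \<psi> \<longlongrightarrow> rmean \<psi> 0) (at 0 within {0..1})"
    using continuous_rmean[OF cont] by (simp add: continuous_on_def)
  then have "((\<lambda>s. (s * rmean \<psi> s - 0 * rmean \<psi> 0) / (s - 0)) \<longlongrightarrow> rmean \<psi> 0) (at 0 within {0..1})"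
    by (rule Lim_transform_eventually) (auto simp: eventually_at_filter)
  moreover have "rmean \<psi> 0 = \<psi> 0 - (N - 1) * rmean \<psi> 0"
    using N by (simp add: rmean_0 field_simps)
  ultimately show ?thesis
    using True by (simp add: has_field_derivative_iff)
next
  case False
  then have r0: "0 < r" using r by simp
  have "((\<lambda>s. s ^ N * rmean \<psi> s / s ^ (N - 1)) has_real_derivative
      (r ^ (N - 1) * \<psi> r * r ^ (N - 1) - r ^ N * rmean \<psi> r * (of_nat (N - 1) * r ^ (N - 1 - 1)))
        / (r ^ (N - 1) * r ^ (N - 1))) (at r within {0..1})"
    using r0 by (intro DERIV_divide power_rmean_has_derivative cont r)
       (auto intro!: derivative_eq_intros)
  also have "(r ^ (N - 1) * \<psi> r * r ^ (N - 1) - r ^ N * rmean \<psi> r * (of_nat (N - 1) * r ^ (N - 1 - 1)))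
        / (r ^ (N - 1) * r ^ (N - 1)) = \<psi> r - (N - 1) * rmean \<psi> r"
  proof (cases "N = 1")
    case False
    then have "r ^ (N - 1) = r * r ^ (N - 1 - 1)" using N by (cases "N - 1") auto
    then show ?thesis using r0 N unfolding power_N by (simp add: field_simps of_nat_diff)
  qed simp
  finally show ?thesis
  proof (rule has_field_derivative_transform_within[where d = r, OF _ r0 r])
    fix s assume "s \<in> {0..1}" "dist s r < r"
    then have "0 < s" by (auto simp: dist_real_def)
    then show "s ^ N * rmean \<psi> s / s ^ (N - 1) = s * rmean \<psi> s"
      unfolding power_N[of s] by simp
  qed
qed

lemma profile_is_solution:
  assumes u: "profile \<psi> u" and u1: "u 1 = 0" and \<psi>: "\<And>r. r \<in> {0..1} \<Longrightarrow> \<psi> r = \<mu> * g r (u r)"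
  shows "is_solution N p g \<mu> u" "u \<in> X p"
proof -
  have D: "D01 u r = - slope \<psi> r" if "r \<in> {0..1}" for r
    by (rule D01_eq[OF profile_has_derivative[OF u that] that])
  have C1: "C1_01 u"
    by (rule C1_01I[OF profile_has_derivative[OF u]])
       (auto intro!: continuous_intros profile_continuous_slope[OF u])
  have flux: "phi p (D01 u r) = - (r * rmean \<psi> r)" if r: "r \<in> {0..1}" for r
    unfolding D[OF r] slope_def
    using rmean_nonneg[OF profileD(1)[OF u] r profileD(2)[OF u]] r by (intro phi_minus_powr) auto
  have C1': "C1_01 (\<lambda>r. phi p (D01 u r))"
  proof (rule C1_01I)
    fix r :: real assume r: "r \<in> {0..1}"
    show "((\<lambda>r. phi p (D01 u r)) has_real_derivative - (\<psi> r - (N - 1) * rmean \<psi> r)) (at r within {0..1})"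
      by (rule has_field_derivative_transform_within[where d = 1,
            OF DERIV_minus[OF times_rmean_has_derivative[OF profileD(1)[OF u] r]] _ r])
         (auto simp: flux)
  qed (intro continuous_intros continuous_rmean profileD(1)[OF u])
  have D0: "D01 u 0 = 0" using D[of 0] by (simp add: slope_def)
  show "u \<in> X p" using C1 C1' D0 u1 by (simp add: X_def)
  have "((\<lambda>s. s ^ (N - 1) * phi p (D01 u s)) has_real_derivative - (\<mu> * r ^ (N - 1) * g r (u r))) (at r)"
    if r: "r \<in> {0<..<1}" for r
  proof -
    have 1: "((\<lambda>s. - (s ^ N * rmean \<psi> s)) has_real_derivative - (r ^ (N - 1) * \<psi> r)) (at r)"
      using r profileD(1)[OF u]
      by (intro DERIV_minus has_real_derivative_inside[OF power_rmean_has_derivative]) auto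
    have 2: "- (s ^ N * rmean \<psi> s) = s ^ (N - 1) * phi p (D01 u s)" if "s \<in> {0<..<1}" for s
      using that flux[of s] by (simp add: power_N[of s])
    have "((\<lambda>s. s ^ (N - 1) * phi p (D01 u s)) has_real_derivative - (r ^ (N - 1) * \<psi> r)) (at r)"
      by (rule has_field_derivative_transform_within_open[OF 1 open_greaterThanLessThan r 2])
    then show ?thesis using \<psi>[of r] r by (simp add: mult_ac)
  qed
  then show "is_solution N p g \<mu> u"
    unfolding is_solution_def using C1 C1' D0 u1 by blast
qed

section \<open>Linear Volterra equations\<close>

lemma volterra_linear:
  assumes \<kappa>: "continuous_on {0..1} \<kappa>" "\<And>s. s \<in> {0..1} \<Longrightarrow> \<bar>\<kappa> s\<bar> \<le> K"
    and a: "continuous_on {0..1} a" "\<And>s. s \<in> {0..1} \<Longrightarrow> \<bar>a s\<bar> \<le> A"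
  shows "volterra_operator (K * A + 1) (\<lambda>y s. \<kappa> s * rmean (\<lambda>t. a t * y t) s)"
  unfolding volterra_operator_def
proof (intro conjI allI impI)
  have KA: "0 \<le> K" "0 \<le> A" using \<kappa>(2)[of 0] a(2)[of 0] by auto
  then show "0 < K * A + 1" by (intro add_nonneg_pos) auto
  show "continuous_on {0..1} (\<lambda>s. \<kappa> s * rmean (\<lambda>t. a t * u t) s)" if "continuous_on {0..1} u" for u
    by (intro continuous_intros continuous_rmean \<kappa> a that)
  fix u v :: "real \<Rightarrow> real" and s B :: real
  assume u: "continuous_on {0..1} u" and v: "continuous_on {0..1} v"
    and s: "s \<in> {0..1}" and B: "\<forall>t\<in>{0..s}. \<bar>u t - v t\<bar> \<le> B"
  have B0: "0 \<le> B" using bspec[OF B, of 0] s by auto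
  have "\<bar>a t * u t - a t * v t\<bar> \<le> A * B" if "t \<in> {0..s}" for t
    using a(2)[of t] B that s KA
    by (auto simp: abs_mult simp flip: right_diff_distrib intro!: mult_mono)
  then have "\<bar>rmean (\<lambda>t. a t * u t) s - rmean (\<lambda>t. a t * v t) s\<bar> \<le> A * B"
    by (intro rmean_diff_le continuous_intros a u v s)
  then have "\<bar>\<kappa> s\<bar> * \<bar>rmean (\<lambda>t. a t * u t) s - rmean (\<lambda>t. a t * v t) s\<bar> \<le> K * (A * B)"
    using \<kappa>(2)[OF s] KA by (intro mult_mono) auto
  also have "\<dots> \<le> (K * A + 1) * B" using B0 by (simp add: algebra_simps)
  finally show "\<bar>\<kappa> s * rmean (\<lambda>t. a t * u t) s - \<kappa> s * rmean (\<lambda>t. a t * v t) s\<bar> \<le> (K * A + 1) * B"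
    unfolding abs_mult[symmetric] right_diff_distrib .
qed

text \<open>The linearised integral equation: \<kappa> holds the derivative of the q-th power, a
  that of the nonlinearity, and b an initial value or a forcing term.\<close>

definition linear_solution ::
    "(real \<Rightarrow> real) \<Rightarrow> (real \<Rightarrow> real) \<Rightarrow> (real \<Rightarrow> real) \<Rightarrow> (real \<Rightarrow> real) \<Rightarrow> bool" where
  "linear_solution \<kappa> a b y \<longleftrightarrow> continuous_on {0..1} \<kappa> \<and> continuous_on {0..1} a \<and>
     continuous_on {0..1} y \<and>
     (\<forall>r\<in>{0..1}. y r = b r - integral {0..r} (\<lambda>s. \<kappa> s * rmean (\<lambda>t. a t * y t) s))"

lemma linear_solutionD:
  assumes "linear_solution \<kappa> a b y"
  shows "continuous_on {0..1} \<kappa>" "continuous_on {0..1} a" "continuous_on {0..1} y"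
    "\<And>r. r \<in> {0..1} \<Longrightarrow> y r = b r - integral {0..r} (\<lambda>s. \<kappa> s * rmean (\<lambda>t. a t * y t) s)"
proof -
  note * = assms[unfolded linear_solution_def]
  from * show "continuous_on {0..1} \<kappa>" "continuous_on {0..1} a" "continuous_on {0..1} y"
    by blast+
  from * have "\<forall>r\<in>{0..1}. y r = b r - integral {0..r} (\<lambda>s. \<kappa> s * rmean (\<lambda>t. a t * y t) s)"
    by (elim conjE)
  then show "y r = b r - integral {0..r} (\<lambda>s. \<kappa> s * rmean (\<lambda>t. a t * y t) s)" if "r \<in> {0..1}" for r
    using that by (rule bspec)
qed

lemma linear_solutionI:
  assumes "continuous_on {0..1} \<kappa>" "continuous_on {0..1} a" "continuous_on {0..1} y"
    "\<And>r. r \<in> {0..1} \<Longrightarrow> y r = b r - integral {0..r} (\<lambda>s. \<kappa> s * rmean (\<lambda>t. a t * y t) s)"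
  shows "linear_solution \<kappa> a b y"
  unfolding linear_solution_def by (intro conjI ballI assms)

lemma linear_solution_exists:
  assumes "continuous_on {0..1} \<kappa>" "continuous_on {0..1} a" "continuous_on {0..1} b"
  shows "\<exists>y. linear_solution \<kappa> a b y"
proof -
  obtain K where K: "\<And>s. s \<in> {0..1} \<Longrightarrow> \<bar>\<kappa> s\<bar> \<le> K" using continuous_on_01_bound[OF assms(1)] by blast
  obtain A where A: "\<And>s. s \<in> {0..1} \<Longrightarrow> \<bar>a s\<bar> \<le> A" using continuous_on_01_bound[OF assms(2)] by blast
  show ?thesis
    using volterra_exists[OF volterra_linear[OF assms(1) K assms(2) A] assms(3)]
      linear_solutionI[OF assms(1,2)] by metis
qed

lemma linear_solution_unique:
  assumes y: "linear_solution \<kappa> a b y" and z: "linear_solution \<kappa> a b z" and r: "r \<in> {0..1}"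
  shows "y r = z r"
proof -
  note yD = linear_solutionD[OF y]
  obtain K where K: "\<And>s. s \<in> {0..1} \<Longrightarrow> \<bar>\<kappa> s\<bar> \<le> K" using continuous_on_01_bound[OF yD(1)] by blast
  obtain A where A: "\<And>s. s \<in> {0..1} \<Longrightarrow> \<bar>a s\<bar> \<le> A" using continuous_on_01_bound[OF yD(2)] by blast
  show ?thesis
    by (rule volterra_unique[OF volterra_linear[OF yD(1) K yD(2) A] yD(3,4) linear_solutionD(3,4)[OF z] r])
qed

lemma linear_solution_integrable:
  assumes "linear_solution \<kappa> a b y" "r \<in> {0..1}"
  shows "(\<lambda>s. \<kappa> s * rmean (\<lambda>t. a t * y t) s) integrable_on {0..r}"
  by (intro integrable_on_01_initial[OF _ assms(2)] continuous_intros continuous_rmean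
      linear_solutionD[OF assms(1)])

lemma linear_solution_combine:
  assumes y: "linear_solution \<kappa> a b y" and z: "linear_solution \<kappa> a c z"
  shows "linear_solution \<kappa> a (\<lambda>r. \<alpha> * b r + \<beta> * c r) (\<lambda>r. \<alpha> * y r + \<beta> * z r)"
proof -
  note cont = linear_solutionD(1-3)[OF y] linear_solutionD(3)[OF z]
  let ?V = "\<lambda>y s. \<kappa> s * rmean (\<lambda>t. a t * y t) s"
  have V: "?V (\<lambda>r. \<alpha> * y r + \<beta> * z r) s = \<alpha> * ?V y s + \<beta> * ?V z s" if s: "s \<in> {0..1}" for s
  proof -
    have "rmean (\<lambda>t. a t * (\<alpha> * y t + \<beta> * z t)) s = rmean (\<lambda>t. \<alpha> * (a t * y t) + \<beta> * (a t * z t)) s"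
      by (rule rmean_cong) (use s in \<open>auto simp: algebra_simps\<close>)
    also have "\<dots> = \<alpha> * rmean (\<lambda>t. a t * y t) s + \<beta> * rmean (\<lambda>t. a t * z t) s"
      by (subst rmean_add) (auto intro!: continuous_intros cont simp: rmean_cmult s[simplified])
    finally show ?thesis by (simp add: algebra_simps)
  qed
  have "\<alpha> * y r + \<beta> * z r = \<alpha> * b r + \<beta> * c r - integral {0..r} (?V (\<lambda>r. \<alpha> * y r + \<beta> * z r))"
    if r: "r \<in> {0..1}" for r
  proof -
    have "integral {0..r} (?V (\<lambda>r. \<alpha> * y r + \<beta> * z r)) = integral {0..r} (\<lambda>s. \<alpha> * ?V y s + \<beta> * ?V z s)"
      by (rule integral_cong) (use V r in auto)
    also have "\<dots> = \<alpha> * integral {0..r} (?V y) + \<beta> * integral {0..r} (?V z)"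
      by (subst integral_add)
         (auto intro!: integrable_on_mult_right linear_solution_integrable[OF y r] linear_solution_integrable[OF z r])
    finally show ?thesis
      using linear_solutionD(4)[OF y r] linear_solutionD(4)[OF z r] by (simp only: right_diff_distrib)
  qed
  then show ?thesis
    by (intro linear_solutionI cont continuous_intros)
qed

end

section \<open>Uniform limits on the unit interval\<close>

lemma uniform_limit_mult01:
  fixes g k :: "'i \<Rightarrow> real \<Rightarrow> real"
  assumes "uniform_limit {0..1} g g0 F" "uniform_limit {0..1} k k0 F"
    "continuous_on {0..1} g0" "continuous_on {0..1} k0"
  shows "uniform_limit {0..1} (\<lambda>i t. g i t * k i t) (\<lambda>t. g0 t * k0 t) F"
  by (rule uniform_lim_mult[OF assms(1,2)])
     (intro compact_imp_bounded compact_continuous_image assms compact_Icc)+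

lemma uniform_limit_of_tendsto:
  assumes "(c \<longlongrightarrow> c0) F"
  shows "uniform_limit S (\<lambda>i t. c i) (\<lambda>t. c0) F"
proof (rule uniform_limitI)
  fix e :: real assume "0 < e"
  from tendstoD[OF assms this] show "\<forall>\<^sub>F i in F. \<forall>t\<in>S. dist (c i) c0 < e"
    by (rule eventually_mono) auto
qed

lemma uniform_limit_integral01:
  fixes g :: "'i \<Rightarrow> real \<Rightarrow> real"
  assumes lim: "uniform_limit {0..1} g g0 F" and c: "eventually (\<lambda>i. continuous_on {0..1} (g i)) F"
    and c0: "continuous_on {0..1} g0"
  shows "uniform_limit {0..1} (\<lambda>i r. integral {0..r} (g i)) (\<lambda>r. integral {0..r} g0) F"
proof (rule uniform_limitI)
  fix e :: real assume e: "0 < e"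
  then have "0 < e / 2" by simp
  from uniform_limitD[OF lim this] c
  show "\<forall>\<^sub>F i in F. \<forall>r\<in>{0..1}. dist (integral {0..r} (g i)) (integral {0..r} g0) < e"
  proof (eventually_elim, intro ballI)
    fix i r assume near: "\<forall>t\<in>{0..1}. dist (g i t) (g0 t) < e / 2" and c: "continuous_on {0..1} (g i)"
      and r: "r \<in> {0..1::real}"
    have i: "g i integrable_on {0..r}" "g0 integrable_on {0..r}"
      by (intro integrable_on_01_initial[OF _ r] c c0)+
    have "\<bar>integral {0..r} (\<lambda>t. g i t - g0 t)\<bar> \<le> e / 2 * (r - 0)"
    proof (rule integral_abs_bound)
      show "\<bar>g i x - g0 x\<bar> \<le> e / 2" if "x \<in> {0..r}" for x
        using bspec[OF near, of x] that r by (auto simp: dist_real_def)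
    qed (use r i in \<open>auto intro: integrable_diff\<close>)
    also have "\<dots> \<le> e / 2" using r e by (simp add: mult_left_le)
    finally show "dist (integral {0..r} (g i)) (integral {0..r} g0) < e"
      using e i by (simp add: dist_real_def integral_diff)
  qed
qed

section \<open>Averaged slopes\<close>

text \<open>Mean of a derivative along the segment from x to y. It represents a difference quotient
  exactly, and continuously up to x = y, where the bare quotient is undefined.\<close>

definition avg :: "(real \<Rightarrow> real) \<Rightarrow> real \<Rightarrow> real \<Rightarrow> real" where
  "avg g x y = integral {0..1} (\<lambda>\<theta>. g (x + \<theta> * (y - x)))"

lemma segment_mem:
  fixes x y :: real
  assumes "convex I" "x \<in> I" "y \<in> I" "\<theta> \<in> {0..1}"
  shows "x + \<theta> * (y - x) \<in> I"
  using convexD_alt[OF assms(1-3), of \<theta>] assms(4) by (simp add: algebra_simps)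

lemma avg_diff:
  assumes "convex I" "x \<in> I" "y \<in> I"
    and "\<And>z. z \<in> I \<Longrightarrow> (G has_real_derivative g z) (at z)"
  shows "G y - G x = avg g x y * (y - x)"
proof -
  have "((\<lambda>\<theta>. g (x + \<theta> * (y - x)) * (y - x)) has_integral
      (G (x + 1 * (y - x)) - G (x + 0 * (y - x)))) {0..1}"
  proof (rule fundamental_theorem_of_calculus)
    fix \<theta> :: real assume "\<theta> \<in> {0..1}"
    then have G: "(G has_real_derivative g (x + \<theta> * (y - x))) (at (x + \<theta> * (y - x)))"
      by (intro assms(4) segment_mem assms(1-3))
    have "((\<lambda>\<theta>. x + \<theta> * (y - x)) has_real_derivative (y - x)) (at \<theta> within {0..1})"
      by (auto intro!: derivative_eq_intros)
    from DERIV_chain2[OF G this]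
    show "((\<lambda>\<theta>. G (x + \<theta> * (y - x))) has_vector_derivative g (x + \<theta> * (y - x)) * (y - x)) (at \<theta> within {0..1})"
      by (simp add: has_real_derivative_iff_has_vector_derivative)
  qed simp
  from integral_unique[OF this] show ?thesis
    unfolding avg_def integral_mult_left by simp
qed

lemma continuous_avg:
  fixes x y :: "real \<Rightarrow> real" and g :: "real \<Rightarrow> real \<Rightarrow> real"
  assumes g: "continuous_on ({0..1} \<times> I) (\<lambda>(t, z). g t z)" and I: "convex I"
    and x: "continuous_on {0..1} x" "\<And>t. t \<in> {0..1} \<Longrightarrow> x t \<in> I"
    and y: "continuous_on {0..1} y" "\<And>t. t \<in> {0..1} \<Longrightarrow> y t \<in> I"
  shows "continuous_on {0..1} (\<lambda>t. avg (g t) (x t) (y t))"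
proof -
  let ?P = "\<lambda>z::real \<times> real. (fst z, x (fst z) + snd z * (y (fst z) - x (fst z)))"
  have "continuous_on ({0..1} \<times> cbox 0 1) ?P"
    by (intro continuous_intros continuous_on_compose2[OF x(1)] continuous_on_compose2[OF y(1)]) auto
  moreover have "?P ` ({0..1} \<times> cbox 0 1) \<subseteq> {0..1} \<times> I"
    using segment_mem[OF I x(2) y(2)] by auto
  ultimately have "continuous_on ({0..1} \<times> cbox 0 1) (\<lambda>z. (\<lambda>(t, z). g t z) (?P z))"
    by (rule continuous_on_compose2[OF g])
  then have "continuous_on ({0..1} \<times> cbox 0 1) (\<lambda>(t, \<theta>). g t (x t + \<theta> * (y t - x t)))"
    by (simp add: split_beta)
  from integral_continuous_on_param[OF this] show ?thesis by (simp add: avg_def)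
qed

text \<open>By compactness g varies uniformly little around the graph of z. Segments stay in small
  balls about z(t) by convexity, and the margin \<delta> keeps these balls inside I, which is the
  positive half-line when g is the derivative of the q-th power.\<close>

lemma avg_uniform_limit:
  fixes z :: "real \<Rightarrow> real" and g :: "real \<Rightarrow> real \<Rightarrow> real"
  assumes g: "continuous_on ({0..1} \<times> I) (\<lambda>(t, z). g t z)"
    and z: "continuous_on {0..1} z" and \<delta>: "0 < \<delta>" "\<And>t. t \<in> {0..1} \<Longrightarrow> cball (z t) \<delta> \<subseteq> I"
    and x: "uniform_limit {0..1} x z F" and y: "uniform_limit {0..1} y z F"
  shows "uniform_limit {0..1} (\<lambda>i t. avg (g t) (x i t) (y i t)) (\<lambda>t. g t (z t)) F"
proof (rule uniform_limitI)
  fix e :: real assume e: "0 < e"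
  let ?P = "\<lambda>w::real \<times> real. (snd w, z (snd w) + fst w)"
  have "continuous_on (cball 0 \<delta> \<times> {0..1}) ?P"
    by (intro continuous_intros continuous_on_compose2[OF z]) auto
  moreover have "?P ` (cball 0 \<delta> \<times> {0..1}) \<subseteq> {0..1} \<times> I"
    using \<delta>(2) by (fastforce simp: dist_real_def)
  ultimately have cont: "continuous_on (cball 0 \<delta> \<times> {0..1}) (\<lambda>w. (\<lambda>(t, z). g t z) (?P w))"
    by (rule continuous_on_compose2[OF g])
  have mem: "(0::real) \<in> cball 0 \<delta>" using \<delta> by simp
  have e2: "0 < e / 2" using e by simp
  obtain X0 where X0: "0 \<in> X0" "open X0"
    and close: "\<forall>w\<in>X0 \<inter> cball 0 \<delta>. \<forall>t\<in>{0..1}.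
      dist ((\<lambda>(t, z). g t z) (?P (w, t))) ((\<lambda>(t, z). g t z) (?P (0, t))) \<le> e / 2"
    by (rule continuous_on_prod_compactE[OF cont compact_Icc mem e2])
  obtain d0 where d0: "0 < d0" "ball 0 d0 \<subseteq> X0" using X0 openE by blast
  define d where "d = min d0 \<delta>"
  have d: "0 < d" using d0 \<delta> by (simp add: d_def)
  have close': "\<bar>g t w - g t (z t)\<bar> \<le> e / 2" if "t \<in> {0..1}" "w \<in> ball (z t) d" for t w
  proof -
    have "w - z t \<in> X0 \<inter> cball 0 \<delta>"
      using that d0 by (auto simp: d_def dist_real_def)
    from bspec[OF bspec[OF close this] that(1)] show ?thesis by (simp add: dist_real_def)
  qed
  have "eventually (\<lambda>i. (\<forall>t\<in>{0..1}. dist (x i t) (z t) < d) \<and> (\<forall>t\<in>{0..1}. dist (y i t) (z t) < d)) F"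
    by (intro eventually_conj uniform_limitD[OF x] uniform_limitD[OF y] d)
  then show "\<forall>\<^sub>F i in F. \<forall>t\<in>{0..1}. dist (avg (g t) (x i t) (y i t)) (g t (z t)) < e"
  proof (rule eventually_mono, intro ballI)
    fix i t assume near: "(\<forall>t\<in>{0..1}. dist (x i t) (z t) < d) \<and> (\<forall>t\<in>{0..1}. dist (y i t) (z t) < d)"
      and t: "t \<in> {0..1::real}"
    have seg: "x i t + \<theta> * (y i t - x i t) \<in> ball (z t) d" if "\<theta> \<in> {0..1}" for \<theta>
      using near t that by (intro segment_mem convex_ball) (auto simp: dist_commute)
    have sub: "ball (z t) d \<subseteq> I" using \<delta>(2)[OF t] by (auto simp: d_def)
    have "continuous_on {0..1} (\<lambda>\<theta>. (\<lambda>(t, z). g t z) (t, x i t + \<theta> * (y i t - x i t)))"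
      by (rule continuous_on_compose2[OF g]) (use seg sub t in \<open>auto intro!: continuous_intros\<close>)
    then have int: "(\<lambda>\<theta>. g t (x i t + \<theta> * (y i t - x i t))) integrable_on {0..1}"
      by (intro integrable_continuous_real) simp
    have "\<bar>integral {0..1} (\<lambda>\<theta>. g t (x i t + \<theta> * (y i t - x i t)) - g t (z t))\<bar> \<le> e / 2 * (1 - 0)"
      by (intro integral_abs_bound integrable_diff int close' t seg) auto
    also have "integral {0..1} (\<lambda>\<theta>. g t (x i t + \<theta> * (y i t - x i t)) - g t (z t))
        = avg (g t) (x i t) (y i t) - g t (z t)"
      unfolding avg_def using int by (subst integral_diff) auto
    finally show "dist (avg (g t) (x i t) (y i t)) (g t (z t)) < e"
      using e by (simp add: dist_real_def)
  qed
qed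

section \<open>The shooting problem\<close>

locale nonlinearity = radial +
  fixes f f' :: "real \<Rightarrow> real \<Rightarrow> real"
  assumes f_cont: "continuous_on ({0..1} \<times> UNIV) (\<lambda>(t, x). f t x)"
    and f'_cont: "continuous_on ({0..1} \<times> UNIV) (\<lambda>(t, x). f' t x)"
    and f_deriv: "t \<in> {0..1} \<Longrightarrow> (f t has_real_derivative f' t x) (at x)"
    and f_pos: "t \<in> {0..1} \<Longrightarrow> x \<noteq> 0 \<Longrightarrow> 0 < f t x"
    and f_zero: "t \<in> {0..1} \<Longrightarrow> f t 0 = 0"
begin

text \<open>A shooting solution may turn negative before r = 1, where (H3) to (H5) say nothing about
  f. With the source switched off there it goes on decreasing, and only values of f at nonnegative
  arguments matter.\<close>

definition h :: "real \<Rightarrow> real \<Rightarrow> real" where "h t x = f t (max 0 x)"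
definition h' :: "real \<Rightarrow> real \<Rightarrow> real" where "h' t x = f' t (max 0 x)"

lemma continuous_comp_max:
  fixes g :: "real \<Rightarrow> real \<Rightarrow> real"
  assumes "continuous_on ({0..1} \<times> UNIV) (\<lambda>(t, x). g t x)"
  shows "continuous_on ({0..1} \<times> UNIV) (\<lambda>(t, x). g t (max 0 x))"
proof -
  have "continuous_on ({0..1} \<times> UNIV) (\<lambda>z. (\<lambda>(t, x). g t x) (fst z, max 0 (snd z)))"
    by (rule continuous_on_compose2[OF assms]) (auto intro!: continuous_intros)
  then show ?thesis by (simp add: split_beta)
qed

lemma h_cont: "continuous_on ({0..1} \<times> UNIV) (\<lambda>(t, x). h t x)"
  using continuous_comp_max[OF f_cont] by (simp only: h_def)

lemma h'_cont: "continuous_on ({0..1} \<times> UNIV) (\<lambda>(t, x). h' t x)"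
  using continuous_comp_max[OF f'_cont] by (simp only: h'_def)

lemma f_nonneg: "t \<in> {0..1} \<Longrightarrow> 0 \<le> f t x"
  using f_pos[of t x] f_zero[of t] by (cases "x = 0") auto

lemma h_nonneg: "t \<in> {0..1} \<Longrightarrow> 0 \<le> h t x"
  by (simp add: h_def f_nonneg)

lemma h_pos: "t \<in> {0..1} \<Longrightarrow> 0 < x \<Longrightarrow> 0 < h t x"
  by (simp add: h_def f_pos)

lemma h_eq: "0 \<le> x \<Longrightarrow> h t x = f t x"
  by (simp add: h_def)

text \<open>By (H2) the function f t is nonnegative on the whole real line and vanishes at 0, so 0
  is an interior minimum. Hence switching f off for negative x keeps it C^1.\<close>

lemma f'_zero:
  assumes "t \<in> {0..1}"
  shows "f' t 0 = 0"
  by (rule DERIV_local_min[OF f_deriv[OF assms] zero_less_one])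
     (simp only: f_zero[OF assms] f_nonneg[OF assms] simp_thms)

lemma h_deriv:
  assumes t: "t \<in> {0..1}"
  shows "(h t has_real_derivative h' t x) (at x)"
proof -
  consider "x < 0" | "x = 0" | "0 < x" by linarith
  then show ?thesis
  proof cases
    case 1
    have "((\<lambda>_. 0) has_real_derivative 0) (at x)" by simp
    then have "(h t has_real_derivative 0) (at x)"
      by (rule has_field_derivative_transform_within_open[of _ _ _ "{..<0}"])
         (use 1 f_zero[OF t] in \<open>auto simp: h_def\<close>)
    then show ?thesis using 1 f'_zero[OF t] by (simp add: h'_def)
  next
    case 2
    have lim: "((\<lambda>y. f t y / y) \<longlongrightarrow> 0) (at 0)"
      using f_deriv[OF t, of 0] f_zero[OF t] f'_zero[OF t] by (simp add: has_field_derivative_iff)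
    have "eventually (\<lambda>y. norm (h t y / y) \<le> \<bar>f t y / y\<bar>) (at 0)"
    proof (intro always_eventually allI)
      show "norm (h t y / y) \<le> \<bar>f t y / y\<bar>" for y
      proof (cases "y \<le> 0")
        case True
        then have "h t y / y = 0" by (simp add: h_def f_zero[OF t])
        then show ?thesis by (simp only: norm_zero abs_ge_zero)
      qed (simp add: h_def)
    qed
    from Lim_null_comparison[OF this tendsto_rabs_zero[OF lim]] show ?thesis
      using 2 f_zero[OF t] f'_zero[OF t] by (simp add: has_field_derivative_iff h_def h'_def)
  next
    case 3
    have "(h t has_real_derivative f' t x) (at x)"
      by (rule has_field_derivative_transform_within_open[OF f_deriv[OF t], of "{0<..}"])
         (use 3 in \<open>auto simp: h_def\<close>)
    then show ?thesis using 3 by (simp add: h'_def)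
  qed
qed

lemma continuous_h_comp:
  "continuous_on {0..1} u \<Longrightarrow> continuous_on {0..1} (\<lambda>t. h t (u t))"
  "continuous_on {0..1} u \<Longrightarrow> continuous_on {0..1} (\<lambda>t. h' t (u t))"
proof -
  assume "continuous_on {0..1} u"
  then have c: "continuous_on {0..1} (\<lambda>t. (t, u t))" by (intro continuous_intros)
  have "continuous_on {0..1} (\<lambda>t. (\<lambda>(t, x). h t x) (t, u t))"
    by (rule continuous_on_compose2[OF h_cont c]) auto
  then show "continuous_on {0..1} (\<lambda>t. h t (u t))" by simp
  have "continuous_on {0..1} (\<lambda>t. (\<lambda>(t, x). h' t x) (t, u t))"
    by (rule continuous_on_compose2[OF h'_cont c]) auto
  then show "continuous_on {0..1} (\<lambda>t. h' t (u t))" by simp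
qed

text \<open>The nonlinearity seen by \<open>u / a\<close> when \<open>u\<close> starts at \<open>a\<close>.\<close>

definition K :: "real \<Rightarrow> real \<Rightarrow> real \<Rightarrow> real \<Rightarrow> real" where
  "K l a t x = l * h t (a * x) / a powr (p - 1)"

lemma K_cont:
  "continuous_on (({0<..} \<times> {0<..}) \<times> ({0..1} \<times> {0..1})) (\<lambda>(z, w). K (fst z) (snd z) (fst w) (snd w))"
proof -
  have "continuous_on (({0<..} \<times> {0<..}) \<times> ({0..1} \<times> {0..1}))
      (\<lambda>y::(real \<times> real) \<times> (real \<times> real). (\<lambda>(t, x). h t x) (fst (snd y), snd (fst y) * snd (snd y)))"
    by (rule continuous_on_compose2[OF h_cont]) (auto intro!: continuous_intros)
  then show ?thesis
    unfolding K_def split_beta by (auto intro!: continuous_intros)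
qed

lemma K_nonneg: "0 < l \<Longrightarrow> t \<in> {0..1} \<Longrightarrow> 0 \<le> K l a t x"
  by (simp add: K_def h_nonneg)

lemma admissible_K:
  assumes "0 < l" "0 < a"
  shows "admissible (K l a)"
  unfolding admissible_def
proof (intro conjI ballI impI)
  have "continuous_on ({0..1} \<times> {0..1})
      (\<lambda>w. (\<lambda>(z, w). K (fst z) (snd z) (fst w) (snd w)) ((l, a), w))"
    by (rule continuous_on_compose2[OF K_cont]) (use assms in \<open>auto intro!: continuous_intros\<close>)
  then show "continuous_on ({0..1} \<times> {0..1}) (\<lambda>(t, x). K l a t x)" by (simp add: split_beta)
  show "0 \<le> K l a t x" if "t \<in> {0..1}" for t x using assms that by (simp add: K_nonneg)
  show "0 < K l a t x" if "t \<in> {0..1}" "0 < x" for t x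
    using assms that by (simp add: K_def h_pos)
  have "bounded ((\<lambda>(t, x). h' t x) ` ({0..1} \<times> {0..a}))"
    by (intro compact_imp_bounded compact_continuous_image continuous_on_subset[OF h'_cont] compact_Times)
       auto
  then obtain B where B: "0 < B" "\<And>t x. t \<in> {0..1} \<Longrightarrow> x \<in> {0..a} \<Longrightarrow> \<bar>h' t x\<bar> \<le> B"
    unfolding bounded_pos by fastforce
  show "\<exists>L\<ge>0. \<forall>t\<in>{0..1}. \<forall>x\<in>{0..1}. \<forall>y\<in>{0..1}. \<bar>K l a t x - K l a t y\<bar> \<le> L * \<bar>x - y\<bar>"
  proof (intro exI[of _ "l * (B * a) / a powr (p - 1)"] conjI ballI)
    show "0 \<le> l * (B * a) / a powr (p - 1)" using assms B by simp
    fix t x y :: real assume t: "t \<in> {0..1}" and x: "x \<in> {0..1}" and y: "y \<in> {0..1}"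
    have "norm (h t (a * x) - h t (a * y)) \<le> B * norm (a * x - a * y)"
      by (rule field_differentiable_bound[of "{0..a}" _ "h' t"])
         (use B(2)[OF t] x y assms in
           \<open>auto intro: has_field_derivative_at_within[OF h_deriv[OF t]] simp: mult_left_le\<close>)
    then have "\<bar>h t (a * x) - h t (a * y)\<bar> \<le> B * a * \<bar>x - y\<bar>"
      using assms by (simp add: abs_mult flip: right_diff_distrib)
    then have "l * \<bar>h t (a * x) - h t (a * y)\<bar> / a powr (p - 1) \<le> l * (B * a * \<bar>x - y\<bar>) / a powr (p - 1)"
      using assms by (intro divide_right_mono mult_left_mono) auto
    then show "\<bar>K l a t x - K l a t y\<bar> \<le> l * (B * a) / a powr (p - 1) * \<bar>x - y\<bar>"
      using assms unfolding K_def
      by (simp add: abs_mult mult.assoc flip: right_diff_distrib diff_divide_distrib)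
  qed
qed

definition sol :: "real \<Rightarrow> real \<Rightarrow> (real \<Rightarrow> real) \<Rightarrow> bool" where
  "sol l a u \<longleftrightarrow> 0 < l \<and> 0 < a \<and> u 0 = a \<and> profile (\<lambda>t. l * h t (u t)) u"

text \<open>Only the upper cut has to be excluded: for x < 0 the arguments a x and 0 give the same
  value of \<open>h\<close>.\<close>

lemma K_cut01:
  assumes "0 < a" "x \<le> 1"
  shows "a powr (p - 1) * K l a t (cut01 x) = l * h t (a * x)"
proof -
  have "h t (a * cut01 x) = h t (a * x)"
    using assms by (auto simp: h_def cut01_def max_def mult_le_0_iff zero_le_mult_iff)
  then show ?thesis using assms by (simp add: K_def)
qed

lemma profile_cong:
  assumes "profile \<psi> u" "\<And>t. t \<in> {0..1} \<Longrightarrow> \<psi> t = \<eta> t"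
  shows "profile \<eta> u"
proof -
  have "integral {0..r} (slope \<eta>) = u 0 - u r" if r: "r \<in> {0..1}" for r
  proof -
    have "integral {0..r} (slope \<eta>) = integral {0..r} (slope \<psi>)"
      by (rule integral_cong) (use assms(2) r in \<open>auto simp: slope_def intro!: arg_cong2[where f = "(powr)"] arg_cong2[where f = "(*)"] rmean_cong\<close>)
    then show ?thesis using profileD(3)[OF assms(1) r] by simp
  qed
  then have "u r = u 0 - integral {0..r} (slope \<eta>)" if "r \<in> {0..1}" for r
    using that by simp
  moreover have "continuous_on {0..1} \<eta>"
    by (rule continuous_on_eq[OF profileD(1)[OF assms(1)] assms(2)])
  moreover have "0 \<le> \<eta> t" if "t \<in> {0..1}" for t
    using profileD(2)[OF assms(1) that] assms(2)[OF that] by simp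
  ultimately show ?thesis unfolding profile_def slope_def[abs_def] by blast
qed

text \<open>Homogeneity moves the initial value a into the nonlinearity. Profiles are
  non-increasing, so w \<le> 1 and the cut at 1 never acts.\<close>

lemma sol_scale_iff:
  assumes l: "0 < l" and a: "0 < a"
  shows "sol l a (\<lambda>r. a * w r) \<longleftrightarrow> w 0 = 1 \<and> profile (\<lambda>t. K l a t (cut01 (w t))) w"
proof
  assume s: "sol l a (\<lambda>r. a * w r)"
  then have w0: "w 0 = 1" using a by (simp add: sol_def)
  have pr: "profile (\<lambda>t. l * h t (a * w t)) (\<lambda>r. a * w r)" using s by (simp add: sol_def)
  have le: "w t \<le> 1" if "t \<in> {0..1}" for t
    using profile_antimono[OF pr, of 0 t] that w0 a by simp
  have "profile (\<lambda>t. (1 / a) powr (p - 1) * (l * h t (a * w t))) (\<lambda>r. 1 / a * (a * w r))"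
    by (rule profile_cmult[OF pr]) (use a in simp)
  then have "profile (\<lambda>t. (1 / a) powr (p - 1) * (l * h t (a * w t))) w" using a by simp
  then have "profile (\<lambda>t. K l a t (cut01 (w t))) w"
  proof (rule profile_cong)
    fix t :: real assume t: "t \<in> {0..1}"
    show "(1 / a) powr (p - 1) * (l * h t (a * w t)) = K l a t (cut01 (w t))"
      unfolding K_cut01[OF a le[OF t], of l t, symmetric] using a by (simp add: powr_divide)
  qed
  then show "w 0 = 1 \<and> profile (\<lambda>t. K l a t (cut01 (w t))) w" using w0 by simp
next
  assume w: "w 0 = 1 \<and> profile (\<lambda>t. K l a t (cut01 (w t))) w"
  then have le: "w t \<le> 1" if "t \<in> {0..1}" for t
    using profile_antimono[of _ w 0 t] that by fastforce
  have "profile (\<lambda>t. a powr (p - 1) * K l a t (cut01 (w t))) (\<lambda>r. a * w r)"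
    by (rule profile_cmult) (use w a in auto)
  then have "profile (\<lambda>t. l * h t (a * w t)) (\<lambda>r. a * w r)"
    by (rule profile_cong) (simp add: K_cut01[OF a le])
  then show "sol l a (\<lambda>r. a * w r)" using w l a by (simp add: sol_def)
qed

lemma sol_positive: "sol l a u \<Longrightarrow> 0 < l" "sol l a u \<Longrightarrow> 0 < a"
  by (auto simp: sol_def)

lemma sol_normalise:
  assumes "sol l a u"
  shows "u 0 / a = 1" "profile (\<lambda>t. K l a t (cut01 (u t / a))) (\<lambda>r. u r / a)"
  using sol_scale_iff[OF sol_positive[OF assms], of "\<lambda>r. u r / a"] assms sol_positive[OF assms] by auto

lemma sol_exists:
  assumes "0 < l" "0 < a"
  obtains u where "sol l a u"
proof -
  obtain w where "w 0 = 1" "profile (\<lambda>t. K l a t (cut01 (w t))) w"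
    by (rule admissible_exists[OF admissible_K[OF assms]])
  then show thesis using sol_scale_iff[OF assms] that by blast
qed

text \<open>\<open>K\<close> is jointly continuous and its last two arguments range over a compact
  square, so parameters near (l, a) give a uniformly close nonlinearity and
  \<open>admissible_stable\<close> applies. The solutions \<open>us\<close> are arbitrary, which
  later yields uniqueness as well.\<close>

lemma sol_limit:
  assumes ls: "(ls \<longlongrightarrow> l) F" and as: "(as \<longlongrightarrow> a) F"
    and u: "eventually (\<lambda>i. sol (ls i) (as i) (us i)) F" and v: "sol l a v"
  shows "uniform_limit {0..1} us v F"
proof -
  note l = ls sol_positive(1)[OF v] and a = as sol_positive(2)[OF v]
  have "continuous_on {0..1} v" using v profile_continuous by (auto simp: sol_def)
  then have cw: "continuous_on {0..1} (\<lambda>t. v t / a)" using a(2) by (intro continuous_intros) auto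
  have pos: "eventually (\<lambda>i. 0 < as i) F" by (rule order_tendstoD(1)[OF a])
  have lim: "uniform_limit {0..1} (\<lambda>i t. us i t / as i) (\<lambda>t. v t / a) F"
  proof (rule uniform_limitI)
    fix e :: real assume "0 < e"
    then obtain d where d: "0 < d" and stable: "\<forall>k' w'.
      (\<forall>t\<in>{0..1}. \<forall>x\<in>{0..1}. 0 \<le> k' t x \<and> \<bar>k' t x - K l a t x\<bar> \<le> d) \<longrightarrow>
      w' 0 = 1 \<longrightarrow> profile (\<lambda>t. k' t (cut01 (w' t))) w' \<longrightarrow> (\<forall>r\<in>{0..1}. \<bar>v r / a - w' r\<bar> < e)"
      using admissible_stable[OF admissible_K[OF l(2) a(2)] sol_normalise[OF v]] by blast
    have c2: "compact ({0..1::real} \<times> {0..1::real})" by (intro compact_Times) auto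
    have mem: "(l, a) \<in> {0<..} \<times> {0<..}" using l a by auto
    obtain X0 where X0: "(l, a) \<in> X0" "open X0"
      and close: "\<forall>z\<in>X0 \<inter> ({0<..} \<times> {0<..}). \<forall>w\<in>{0..1} \<times> {0..1}.
        dist ((\<lambda>(z, w). K (fst z) (snd z) (fst w) (snd w)) (z, w))
             ((\<lambda>(z, w). K (fst z) (snd z) (fst w) (snd w)) ((l, a), w)) \<le> d"
      by (rule continuous_on_prod_compactE[OF K_cont c2 mem d])
    have "((\<lambda>i. (ls i, as i)) \<longlongrightarrow> (l, a)) F" by (intro tendsto_Pair ls as)
    then have "eventually (\<lambda>i. (ls i, as i) \<in> X0) F" by (rule topological_tendstoD[OF _ X0(2,1)])
    then show "\<forall>\<^sub>F i in F. \<forall>t\<in>{0..1}. dist (us i t / as i) (v t / a) < e"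
      using order_tendstoD(1)[OF l] pos u
    proof eventually_elim
      case (elim i)
      have "\<forall>s\<in>{0..1}. \<forall>x\<in>{0..1}. 0 \<le> K (ls i) (as i) s x \<and> \<bar>K (ls i) (as i) s x - K l a s x\<bar> \<le> d"
      proof (intro ballI conjI)
        fix s x :: real assume "s \<in> {0..1}" "x \<in> {0..1}"
        then show "0 \<le> K (ls i) (as i) s x" "\<bar>K (ls i) (as i) s x - K l a s x\<bar> \<le> d"
          using bspec[OF bspec[OF close, of "(ls i, as i)"], of "(s, x)"] elim K_nonneg
          by (auto simp: dist_real_def)
      qed
      from stable[THEN spec, of "K (ls i) (as i)", THEN spec, of "\<lambda>r. us i r / as i", THEN mp, OF this]
      show ?case
        using sol_normalise[OF elim(4)] by (simp add: dist_real_def abs_minus_commute)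
    qed
  qed
  have "uniform_limit {0..1} (\<lambda>i t. as i * (us i t / as i)) (\<lambda>t. a * (v t / a)) F"
    by (intro uniform_limit_mult01 uniform_limit_of_tendsto as lim cw continuous_on_const)
  moreover have "eventually (\<lambda>i. \<forall>t\<in>{0..1}. as i * (us i t / as i) = us i t) F"
    using pos by (rule eventually_mono) auto
  ultimately show ?thesis
    using a(2) by (subst (asm) uniform_limit_cong) auto
qed

end

lemma first_nonpos:
  fixes y :: "real \<Rightarrow> real"
  assumes c: "continuous_on {a..b} y" and y: "0 < y a" "y b \<le> 0" and ab: "a \<le> b"
  obtains \<rho> where "a < \<rho>" "\<rho> \<le> b" "y \<rho> = 0" "\<And>s. a \<le> s \<Longrightarrow> s < \<rho> \<Longrightarrow> 0 < y s"
proof -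
  define Z where "Z = {s \<in> {a..b}. y s \<le> 0}"
  have "Z = {a..b} \<inter> y -` {..0}" by (auto simp: Z_def)
  then have "closed Z"
    using continuous_closed_preimage[OF c closed_atLeastAtMost closed_atMost[of 0]] by (simp only:)
  moreover have "bounded Z"
    by (rule bounded_subset[OF compact_imp_bounded[OF compact_Icc[of a b]]]) (auto simp: Z_def)
  ultimately have "compact Z" by (simp add: compact_eq_bounded_closed)
  moreover have "b \<in> Z" using y ab by (auto simp: Z_def)
  ultimately obtain \<rho> where \<rho>: "\<rho> \<in> Z" "\<And>s. s \<in> Z \<Longrightarrow> \<rho> \<le> s"
    using compact_attains_inf[of Z] by auto
  have \<rho>b: "a \<le> \<rho>" "\<rho> \<le> b" "y \<rho> \<le> 0" using \<rho>(1) by (auto simp: Z_def)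
  have "\<exists>x\<ge>a. x \<le> \<rho> \<and> y x = 0"
    by (rule IVT2') (use \<rho>b y in \<open>auto intro: continuous_on_subset[OF c]\<close>)
  then obtain x where x: "a \<le> x" "x \<le> \<rho>" "y x = 0" by blast
  then have "\<rho> \<le> x" using \<rho>b by (intro \<rho>(2)) (auto simp: Z_def)
  then have y\<rho>: "y \<rho> = 0" using x by simp
  show thesis
  proof (rule that[OF _ \<rho>b(2) y\<rho>])
    show "a < \<rho>" using \<rho>b(1) y\<rho> y by (cases "\<rho> = a") auto
    show "0 < y s" if "a \<le> s" "s < \<rho>" for s
      using \<rho>(2)[of s] that \<rho>b by (force simp: Z_def)
  qed
qed

context radial
begin

lemma rmean_uniform_limit:
  assumes lim: "uniform_limit {0..1} g g0 F" and c: "eventually (\<lambda>i. continuous_on {0..1} (g i)) F"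
    and c0: "continuous_on {0..1} g0"
  shows "uniform_limit {0..1} (\<lambda>i. rmean (g i)) (rmean g0) F"
proof (rule uniform_limitI)
  fix e :: real assume e: "0 < e"
  then have "0 < e / 2" by simp
  from uniform_limitD[OF lim this] c
  show "\<forall>\<^sub>F i in F. \<forall>r\<in>{0..1}. dist (rmean (g i) r) (rmean g0 r) < e"
  proof (eventually_elim, intro ballI)
    fix i r assume near: "\<forall>t\<in>{0..1}. dist (g i t) (g0 t) < e / 2" and c: "continuous_on {0..1} (g i)"
      and r: "r \<in> {0..1::real}"
    have "\<bar>rmean (g i) r - rmean g0 r\<bar> \<le> e / 2"
    proof (rule rmean_diff_le[OF c c0 r])
      show "\<bar>g i x - g0 x\<bar> \<le> e / 2" if "x \<in> {0..r}" for x
        using bspec[OF near, of x] that r by (auto simp: dist_real_def)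
    qed
    then show "dist (rmean (g i) r) (rmean g0 r) < e" using e by (simp add: dist_real_def)
  qed
qed

text \<open>The limit y is inserted into the i-th equation: its residual tends to 0 uniformly, and
  \<open>volterra_stable\<close> compares it with \<open>z i\<close>. The bounds K + 1 and A + 1
  eventually hold for all coefficients, so the stability constant does not depend on i.\<close>

lemma linear_solution_limit:
  assumes y: "linear_solution \<kappa> a b y"
    and z: "eventually (\<lambda>i. linear_solution (\<kappa>' i) (a' i) (b' i) (z i)) F"
    and \<kappa>: "uniform_limit {0..1} \<kappa>' \<kappa> F" and a: "uniform_limit {0..1} a' a F"
    and b: "uniform_limit {0..1} b' b F"
  shows "uniform_limit {0..1} z y F"
proof (rule uniform_limitI)
  fix e :: real assume e: "0 < e"
  note c = linear_solutionD(1-3)[OF y]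
  obtain K where K: "0 < K" "\<And>s. s \<in> {0..1} \<Longrightarrow> \<bar>\<kappa> s\<bar> \<le> K" using continuous_on_01_bound[OF c(1)] by blast
  obtain A where A: "0 < A" "\<And>s. s \<in> {0..1} \<Longrightarrow> \<bar>a s\<bar> \<le> A" using continuous_on_01_bound[OF c(2)] by blast
  define L where "L = (K + 1) * (A + 1) + 1"
  define C where "C = 2 * exp (2 * L)"
  have C: "0 < C" by (simp add: C_def)
  define d where "d = e / (2 * C)"
  have d: "0 < d" "C * d < e" using C e by (auto simp: d_def)
  define R where "R i r = b' i r - integral {0..r} (\<lambda>s. \<kappa>' i s * rmean (\<lambda>t. a' i t * y t) s)" for i r
  have cont: "eventually (\<lambda>i. continuous_on {0..1} (\<kappa>' i) \<and> continuous_on {0..1} (a' i)) F"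
    using z by (rule eventually_mono) (blast dest: linear_solutionD)
  have "uniform_limit {0..1} (\<lambda>i t. a' i t * y t) (\<lambda>t. a t * y t) F"
    by (intro uniform_limit_mult01 a uniform_limit_const c)
  then have "uniform_limit {0..1} (\<lambda>i. rmean (\<lambda>t. a' i t * y t)) (rmean (\<lambda>t. a t * y t)) F"
    by (rule rmean_uniform_limit)
       (use cont c in \<open>auto elim!: eventually_mono intro: continuous_on_mult\<close>)
  from uniform_limit_mult01[OF \<kappa> this c(1) continuous_rmean[OF continuous_on_mult[OF c(2,3)]]]
  have "uniform_limit {0..1} (\<lambda>i r. integral {0..r} (\<lambda>s. \<kappa>' i s * rmean (\<lambda>t. a' i t * y t) s))
      (\<lambda>r. integral {0..r} (\<lambda>s. \<kappa> s * rmean (\<lambda>t. a t * y t) s)) F"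
    by (rule uniform_limit_integral01)
       (use cont c in \<open>auto elim!: eventually_mono intro: continuous_on_mult continuous_rmean\<close>)
  from uniform_limit_minus[OF b this] have "uniform_limit {0..1} R y F"
    unfolding R_def by (rule uniform_limit_cong'[THEN iffD1, rotated 2]) (simp_all add: linear_solutionD(4)[OF y])
  from uniform_limitD[OF \<kappa> zero_less_one] uniform_limitD[OF a zero_less_one] uniform_limitD[OF this d(1)] z
  show "\<forall>\<^sub>F i in F. \<forall>s\<in>{0..1}. dist (z i s) (y s) < e"
  proof (eventually_elim, intro ballI)
    fix i r assume near: "\<forall>s\<in>{0..1}. dist (\<kappa>' i s) (\<kappa> s) < 1" "\<forall>s\<in>{0..1}. dist (a' i s) (a s) < 1"
      "\<forall>s\<in>{0..1}. dist (R i s) (y s) < d" and zi: "linear_solution (\<kappa>' i) (a' i) (b' i) (z i)"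
      and r: "r \<in> {0..1::real}"
    note zD = linear_solutionD[OF zi]
    have K': "\<bar>\<kappa>' i s\<bar> \<le> K + 1" and A': "\<bar>a' i s\<bar> \<le> A + 1" if "s \<in> {0..1}" for s
      using K(2)[OF that] A(2)[OF that] bspec[OF near(1) that] bspec[OF near(2) that]
      unfolding dist_real_def by linarith+
    have ny: "\<bar>y s - (b' i s - integral {0..s} (\<lambda>s. \<kappa>' i s * rmean (\<lambda>t. a' i t * y t) s))\<bar> \<le> d"
      if "s \<in> {0..1}" for s
      using bspec[OF near(3) that] by (simp add: R_def dist_real_def abs_minus_commute)
    have "\<bar>z i r - y r\<bar> \<le> 2 * exp (2 * L) * d"
      unfolding L_def by (rule volterra_stable[OF volterra_linear[OF zD(1) K' zD(2) A'] zD(3,4) c(3) ny r])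
    then show "dist (z i r) (y r) < e" using d(2) by (simp add: C_def dist_real_def)
  qed
qed

end

context nonlinearity
begin

section \<open>Differences of solutions\<close>

definition flux_mean :: "real \<Rightarrow> (real \<Rightarrow> real) \<Rightarrow> real \<Rightarrow> real" where
  "flux_mean l u s = l * rmean (\<lambda>t. h t (u t)) s"

definition dpow :: "real \<Rightarrow> real" where
  "dpow x = q * x powr (q - 1)"

text \<open>The factor of the difference of two flux means in the difference of the slopes. Flux
  means are positive, so the derivative of the q-th power stays finite on the segment between
  them.\<close>

definition wgt :: "real \<Rightarrow> (real \<Rightarrow> real) \<Rightarrow> real \<Rightarrow> (real \<Rightarrow> real) \<Rightarrow> real \<Rightarrow> real" where
  "wgt l1 u1 l2 u2 s = s powr q * avg dpow (flux_mean l1 u1 s) (flux_mean l2 u2 s)"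

definition hslope :: "(real \<Rightarrow> real) \<Rightarrow> (real \<Rightarrow> real) \<Rightarrow> real \<Rightarrow> real" where
  "hslope u1 u2 t = avg (h' t) (u1 t) (u2 t)"

text \<open>The contribution of the change in \<lambda> to the difference, per unit of l2 - l1 and
  before the feedback through the solution.\<close>

definition forcing :: "real \<Rightarrow> (real \<Rightarrow> real) \<Rightarrow> real \<Rightarrow> (real \<Rightarrow> real) \<Rightarrow> real \<Rightarrow> real" where
  "forcing l1 u1 l2 u2 r =
     - integral {0..r} (\<lambda>s. wgt l1 u1 l2 u2 s * rmean (\<lambda>t. h t (u2 t)) s)"

text \<open>
  The difference of two solutions is \<open>(a\<^sub>2 - a\<^sub>1) Y + (\<lambda>\<^sub>2 - \<lambda>\<^sub>1) Z\<close>, so that on the diagonal \<open>Y\<close> and \<open>Z\<close> are the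
  partial derivatives of the shooting solution in its initial value and in \<open>\<lambda>\<close>.
\<close>

definition Ysol :: "real \<Rightarrow> (real \<Rightarrow> real) \<Rightarrow> real \<Rightarrow> (real \<Rightarrow> real) \<Rightarrow> real \<Rightarrow> real" where
  "Ysol l1 u1 l2 u2 = (SOME y. linear_solution (\<lambda>s. l1 * wgt l1 u1 l2 u2 s) (hslope u1 u2) (\<lambda>_. 1) y)"

definition Zsol :: "real \<Rightarrow> (real \<Rightarrow> real) \<Rightarrow> real \<Rightarrow> (real \<Rightarrow> real) \<Rightarrow> real \<Rightarrow> real" where
  "Zsol l1 u1 l2 u2 =
     (SOME y. linear_solution (\<lambda>s. l1 * wgt l1 u1 l2 u2 s) (hslope u1 u2) (forcing l1 u1 l2 u2) y)"

lemma avg_self: "avg g x x = g x"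
  by (simp add: avg_def)

lemma sol_continuous: "sol l a u \<Longrightarrow> continuous_on {0..1} u"
  unfolding sol_def by (blast intro: profile_continuous)

lemma sol_flux_mean_pos:
  assumes "sol l a u" "s \<in> {0..1}"
  shows "0 < flux_mean l u s"
proof -
  have "0 < l * h 0 (u 0)" using assms h_pos[of 0 a] by (simp add: sol_def)
  then have "0 < rmean (\<lambda>t. l * h t (u t)) s"
    using assms unfolding sol_def by (intro profile_rmean_pos[of "\<lambda>t. l * h t (u t)" u]) auto
  then show ?thesis by (simp add: flux_mean_def rmean_cmult)
qed

lemma continuous_flux_mean: "continuous_on {0..1} u \<Longrightarrow> continuous_on {0..1} (flux_mean l u)"
  unfolding flux_mean_def by (intro continuous_intros continuous_rmean continuous_h_comp)

lemma dpow_cont: "continuous_on ({0..1} \<times> {0<..}) (\<lambda>(t, z). dpow z)"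
  unfolding dpow_def split_beta by (intro continuous_intros) auto

lemma continuous_powr_q: "continuous_on {0..1} (\<lambda>s::real. s powr q)"
  using q_pos by (intro continuous_on_powr' continuous_intros) auto

lemma continuous_wgt:
  assumes "sol l1 a1 u1" "sol l2 a2 u2"
  shows "continuous_on {0..1} (wgt l1 u1 l2 u2)"
  unfolding wgt_def
  using sol_flux_mean_pos assms
  by (intro continuous_on_mult continuous_powr_q continuous_avg[OF dpow_cont] continuous_flux_mean sol_continuous)
     (auto simp: convex_real_interval)

lemma continuous_hslope:
  assumes "continuous_on {0..1} u1" "continuous_on {0..1} u2"
  shows "continuous_on {0..1} (hslope u1 u2)"
  unfolding hslope_def by (rule continuous_avg[OF h'_cont]) (use assms in auto)

lemma continuous_forcing_integrand:
  assumes "sol l1 a1 u1" "sol l2 a2 u2"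
  shows "continuous_on {0..1} (\<lambda>s. wgt l1 u1 l2 u2 s * rmean (\<lambda>t. h t (u2 t)) s)"
  by (intro continuous_on_mult continuous_wgt[OF assms] continuous_rmean continuous_h_comp
      sol_continuous[OF assms(2)])

lemma Ysol_Zsol:
  assumes "sol l1 a1 u1" "sol l2 a2 u2"
  shows "linear_solution (\<lambda>s. l1 * wgt l1 u1 l2 u2 s) (hslope u1 u2) (\<lambda>_. 1) (Ysol l1 u1 l2 u2)"
    "linear_solution (\<lambda>s. l1 * wgt l1 u1 l2 u2 s) (hslope u1 u2) (forcing l1 u1 l2 u2) (Zsol l1 u1 l2 u2)"
proof -
  have 1: "continuous_on {0..1} (\<lambda>s. l1 * wgt l1 u1 l2 u2 s)"
    by (intro continuous_on_mult continuous_on_const continuous_wgt[OF assms])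
  have 2: "continuous_on {0..1} (hslope u1 u2)"
    by (intro continuous_hslope sol_continuous[OF assms(1)] sol_continuous[OF assms(2)])
  have 3: "continuous_on {0..1} (forcing l1 u1 l2 u2)"
    unfolding forcing_def
    by (intro continuous_on_minus continuous_on_01_integral continuous_forcing_integrand[OF assms])
  show "linear_solution (\<lambda>s. l1 * wgt l1 u1 l2 u2 s) (hslope u1 u2) (\<lambda>_. 1) (Ysol l1 u1 l2 u2)"
    unfolding Ysol_def by (rule someI_ex[OF linear_solution_exists[OF 1 2 continuous_on_const]])
  show "linear_solution (\<lambda>s. l1 * wgt l1 u1 l2 u2 s) (hslope u1 u2) (forcing l1 u1 l2 u2) (Zsol l1 u1 l2 u2)"
    unfolding Zsol_def by (rule someI_ex[OF linear_solution_exists[OF 1 2 3]])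
qed

lemma slope_flux_mean:
  assumes "sol l a u" "s \<in> {0..1}"
  shows "slope (\<lambda>t. l * h t (u t)) s = s powr q * flux_mean l u s powr q"
  using sol_flux_mean_pos[OF assms] assms(2) unfolding slope_def rmean_cmult flux_mean_def[symmetric]
  by (simp add: powr_mult)

text \<open>No linearisation error occurs, because averaged slopes express the increments of the
  q-th power and of \<open>h\<close> exactly. The difference solves a linear equation whose data
  superpose the constant 1 and the forcing, so uniqueness for that equation concludes.\<close>

lemma sol_difference:
  assumes s1: "sol l1 a1 u1" and s2: "sol l2 a2 u2"
    and r: "r \<in> {0..1}"
  shows "u2 r - u1 r = (a2 - a1) * Ysol l1 u1 l2 u2 r + (l2 - l1) * Zsol l1 u1 l2 u2 r"
proof -
  let ?w = "wgt l1 u1 l2 u2" and ?a = "hslope u1 u2" and ?d = "\<lambda>r. u2 r - u1 r"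
  note c = sol_continuous[OF s1] sol_continuous[OF s2]
  have cw: "continuous_on {0..1} ?w" by (rule continuous_wgt[OF s1 s2])
  have ca: "continuous_on {0..1} ?a" by (rule continuous_hslope[OF c])
  have pr: "profile (\<lambda>t. l1 * h t (u1 t)) u1" "profile (\<lambda>t. l2 * h t (u2 t)) u2"
    "u1 0 = a1" "u2 0 = a2"
    using s1 s2 by (auto simp: sol_def)
  have key: "slope (\<lambda>t. l2 * h t (u2 t)) s - slope (\<lambda>t. l1 * h t (u1 t)) s
      = (l2 - l1) * (?w s * rmean (\<lambda>t. h t (u2 t)) s) + (l1 * ?w s) * rmean (\<lambda>t. ?a t * ?d t) s"
    if s: "s \<in> {0..1}" for s
  proof -
    have "((\<lambda>x. x powr q) has_real_derivative dpow z) (at z)" if "z \<in> {0<..}" for z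
      using has_real_derivative_powr[of z q] that by (simp add: dpow_def)
    then have "flux_mean l2 u2 s powr q - flux_mean l1 u1 s powr q
        = avg dpow (flux_mean l1 u1 s) (flux_mean l2 u2 s) * (flux_mean l2 u2 s - flux_mean l1 u1 s)"
      using sol_flux_mean_pos[OF s1 s] sol_flux_mean_pos[OF s2 s]
      by (intro avg_diff[of "{0<..}"]) (auto simp: convex_real_interval)
    moreover have "rmean (\<lambda>t. h t (u2 t)) s - rmean (\<lambda>t. h t (u1 t)) s = rmean (\<lambda>t. ?a t * ?d t) s"
    proof -
      have "rmean (\<lambda>t. ?a t * ?d t) s = rmean (\<lambda>t. h t (u2 t) - h t (u1 t)) s"
      proof (rule rmean_cong[OF _ s])
        fix t assume "t \<in> {0..s}"
        then have t: "t \<in> {0..1}" using s by auto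
        show "?a t * ?d t = h t (u2 t) - h t (u1 t)"
          unfolding hslope_def
          by (rule avg_diff[of UNIV, symmetric]) (use h_deriv[OF t] in auto)
      qed
      also have "\<dots> = rmean (\<lambda>t. h t (u2 t)) s - rmean (\<lambda>t. h t (u1 t)) s"
        by (intro rmean_diff continuous_h_comp c s)
      finally show ?thesis by simp
    qed
    \<comment> \<open>The split l2 m2 - l1 m1 = (l2 - l1) m2 + l1 (m2 - m1) is the reason for u2 in
      the forcing and for l1 in the kernel.\<close>
    then have "flux_mean l2 u2 s - flux_mean l1 u1 s
        = (l2 - l1) * rmean (\<lambda>t. h t (u2 t)) s + l1 * rmean (\<lambda>t. ?a t * ?d t) s"
      by (simp add: flux_mean_def algebra_simps)
    ultimately have "s powr q * (flux_mean l2 u2 s powr q - flux_mean l1 u1 s powr q)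
        = ?w s * ((l2 - l1) * rmean (\<lambda>t. h t (u2 t)) s + l1 * rmean (\<lambda>t. ?a t * ?d t) s)"
      by (simp add: wgt_def)
    then show ?thesis
      by (simp add: slope_flux_mean[OF s1 s] slope_flux_mean[OF s2 s] algebra_simps)
  qed
  have lin: "linear_solution (\<lambda>s. l1 * ?w s) ?a
      (\<lambda>r. (a2 - a1) * 1 + (l2 - l1) * forcing l1 u1 l2 u2 r) ?d"
  proof (rule linear_solutionI)
    fix r :: real assume r: "r \<in> {0..1}"
    let ?A = "\<lambda>s. ?w s * rmean (\<lambda>t. h t (u2 t)) s" and ?B = "\<lambda>s. (l1 * ?w s) * rmean (\<lambda>t. ?a t * ?d t) s"
    have i: "?A integrable_on {0..r}" "?B integrable_on {0..r}"
      by (intro integrable_on_01_initial[OF _ r] continuous_on_mult continuous_on_const continuous_rmean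
          continuous_on_diff continuous_h_comp cw ca c)+
    have isl: "slope (\<lambda>t. l2 * h t (u2 t)) integrable_on {0..r}" "slope (\<lambda>t. l1 * h t (u1 t)) integrable_on {0..r}"
      by (intro integrable_on_01_initial[OF _ r] profile_continuous_slope[OF pr(1)]
          profile_continuous_slope[OF pr(2)])+
    have "integral {0..r} (slope (\<lambda>t. l2 * h t (u2 t))) - integral {0..r} (slope (\<lambda>t. l1 * h t (u1 t)))
        = integral {0..r} (\<lambda>s. (l2 - l1) * ?A s + ?B s)"
      unfolding integral_diff[OF isl, symmetric]
      by (rule integral_cong) (use key r in auto)
    also have "\<dots> = (l2 - l1) * integral {0..r} ?A + integral {0..r} ?B"
      using integral_add[OF integrable_on_mult_right[OF i(1), of "l2 - l1"] i(2)] by simp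
    finally show "?d r = (a2 - a1) * 1 + (l2 - l1) * forcing l1 u1 l2 u2 r - integral {0..r} ?B"
      using profileD(3)[OF pr(1) r] profileD(3)[OF pr(2) r] pr(3,4) by (simp add: forcing_def)
  qed (intro continuous_on_mult continuous_on_const continuous_on_diff cw ca c)+
  show ?thesis
    by (rule linear_solution_unique[OF lin linear_solution_combine[OF Ysol_Zsol[OF s1 s2]] r])
qed

lemma h_uniform_limit:
  assumes "uniform_limit {0..1} us u F" "continuous_on {0..1} u"
  shows "uniform_limit {0..1} (\<lambda>i t. h t (us i t)) (\<lambda>t. h t (u t)) F"
  using avg_uniform_limit[OF h_cont assms(2) zero_less_one _ assms(1,1)] by (simp add: avg_self)

lemma flux_mean_uniform_limit:
  assumes lim: "uniform_limit {0..1} us u F" and c: "eventually (\<lambda>i. continuous_on {0..1} (us i)) F"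
    and c0: "continuous_on {0..1} u" and l: "(ls \<longlongrightarrow> l) F"
  shows "uniform_limit {0..1} (\<lambda>i. flux_mean (ls i) (us i)) (flux_mean l u) F"
  unfolding flux_mean_def
proof (rule uniform_limit_mult01[OF uniform_limit_of_tendsto[OF l]])
  show "uniform_limit {0..1} (\<lambda>i. rmean (\<lambda>t. h t (us i t))) (rmean (\<lambda>t. h t (u t))) F"
    by (rule rmean_uniform_limit[OF h_uniform_limit[OF lim c0]])
       (use c in \<open>auto elim!: eventually_mono intro: continuous_h_comp c0\<close>)
qed (intro continuous_on_const continuous_rmean continuous_h_comp c0)+

text \<open>Two independent families are allowed to move: with one of them constant this serves
  differentiability, with both moving together it serves continuity of the derivative.\<close>

lemma Ysol_Zsol_limit:
  assumes 1: "(ls1 \<longlongrightarrow> l) F" "(as1 \<longlongrightarrow> a) F" and 2: "(ls2 \<longlongrightarrow> l) F" "(as2 \<longlongrightarrow> a) F"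
    and u1: "eventually (\<lambda>i. sol (ls1 i) (as1 i) (us1 i)) F"
    and u2: "eventually (\<lambda>i. sol (ls2 i) (as2 i) (us2 i)) F"
    and v: "sol l a v"
  shows "uniform_limit {0..1} (\<lambda>i. Ysol (ls1 i) (us1 i) (ls2 i) (us2 i)) (Ysol l v l v) F"
    "uniform_limit {0..1} (\<lambda>i. Zsol (ls1 i) (us1 i) (ls2 i) (us2 i)) (Zsol l v l v) F"
proof -
  let ?w = "\<lambda>i. wgt (ls1 i) (us1 i) (ls2 i) (us2 i)"
  note cv = sol_continuous[OF v]
  have lim: "uniform_limit {0..1} us1 v F" "uniform_limit {0..1} us2 v F"
    by (rule sol_limit[OF 1 u1 v] sol_limit[OF 2 u2 v])+
  have c1: "eventually (\<lambda>i. continuous_on {0..1} (us1 i)) F" using u1 by eventually_elim (rule sol_continuous)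
  have c2: "eventually (\<lambda>i. continuous_on {0..1} (us2 i)) F" using u2 by eventually_elim (rule sol_continuous)
  have good: "eventually (\<lambda>i. sol (ls1 i) (as1 i) (us1 i) \<and> sol (ls2 i) (as2 i) (us2 i)) F"
    by (intro eventually_conj u1 u2)
  \<comment> \<open>The flux mean of v has a positive lower bound c, so a margin of c/2 keeps the
    averaging segments where \<open>dpow\<close> is continuous.\<close>
  obtain c where c: "0 < c" "\<And>s. s \<in> {0..1} \<Longrightarrow> c \<le> flux_mean l v s"
    using continuous_on_01_pos_bound[OF continuous_flux_mean[OF cv] sol_flux_mean_pos[OF v]] by blast
  have al: "uniform_limit {0..1} (\<lambda>i t. avg dpow (flux_mean (ls1 i) (us1 i) t) (flux_mean (ls2 i) (us2 i) t))
      (\<lambda>t. dpow (flux_mean l v t)) F"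
  proof (rule avg_uniform_limit[OF dpow_cont continuous_flux_mean[OF cv], of "c / 2"])
    fix t :: real assume t: "t \<in> {0..1}"
    show "cball (flux_mean l v t) (c / 2) \<subseteq> {0<..}"
    proof
      fix x assume "x \<in> cball (flux_mean l v t) (c / 2)"
      then have "\<bar>flux_mean l v t - x\<bar> \<le> c / 2" by (simp add: dist_real_def)
      then show "x \<in> {0<..}" using c(2)[OF t] c(1) unfolding greaterThan_iff by linarith
    qed
  qed (use c in \<open>auto intro!: flux_mean_uniform_limit lim c1 c2 cv 1 2\<close>)
  have wgt_diag: "wgt l v l v = (\<lambda>s. s powr q * dpow (flux_mean l v s))"
    by (rule ext) (simp add: wgt_def avg_self)
  have w: "uniform_limit {0..1} ?w (wgt l v l v) F"
    unfolding wgt_diag unfolding wgt_def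
  proof (rule uniform_limit_mult01[OF _ al])
    show "uniform_limit {0..1} (\<lambda>i s. s powr q) (\<lambda>s. s powr q) F" by (rule uniform_limit_const)
    have "continuous_on {0..1} (\<lambda>t. (\<lambda>(t, z). dpow z) (t, flux_mean l v t))"
      by (rule continuous_on_compose2[OF dpow_cont])
         (use sol_flux_mean_pos[OF v] in \<open>auto intro!: continuous_intros continuous_flux_mean cv\<close>)
    then show "continuous_on {0..1} (\<lambda>t. dpow (flux_mean l v t))" by simp
  qed (rule continuous_powr_q)
  have cw: "continuous_on {0..1} (wgt l v l v)" by (rule continuous_wgt[OF v v])
  have k: "uniform_limit {0..1} (\<lambda>i s. ls1 i * ?w i s) (\<lambda>s. l * wgt l v l v s) F"
    by (intro uniform_limit_mult01 uniform_limit_of_tendsto 1 w continuous_on_const cw)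
  have hslope_diag: "hslope v v = (\<lambda>t. h' t (v t))"
    by (rule ext) (simp add: hslope_def avg_self)
  have hs: "uniform_limit {0..1} (\<lambda>i. hslope (us1 i) (us2 i)) (hslope v v) F"
    unfolding hslope_diag unfolding hslope_def
    by (rule avg_uniform_limit[OF h'_cont cv zero_less_one _ lim]) simp
  have "uniform_limit {0..1} (\<lambda>i s. ?w i s * rmean (\<lambda>t. h t (us2 i t)) s)
      (\<lambda>s. wgt l v l v s * rmean (\<lambda>t. h t (v t)) s) F"
  proof (rule uniform_limit_mult01[OF w])
    show "uniform_limit {0..1} (\<lambda>i. rmean (\<lambda>t. h t (us2 i t))) (rmean (\<lambda>t. h t (v t))) F"
      by (rule rmean_uniform_limit[OF h_uniform_limit[OF lim(2) cv]])
         (use c2 in \<open>auto elim!: eventually_mono intro: continuous_h_comp cv\<close>)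
  qed (intro cw continuous_rmean continuous_h_comp cv)+
  then have "uniform_limit {0..1} (\<lambda>i r. integral {0..r} (\<lambda>s. ?w i s
        * rmean (\<lambda>t. h t (us2 i t)) s))
      (\<lambda>r. integral {0..r} (\<lambda>s. wgt l v l v s * rmean (\<lambda>t. h t (v t)) s)) F"
  proof (rule uniform_limit_integral01)
    show "eventually (\<lambda>i. continuous_on {0..1} (\<lambda>s. ?w i s
        * rmean (\<lambda>t. h t (us2 i t)) s)) F"
      using good by (rule eventually_mono) (blast intro: continuous_forcing_integrand)
    show "continuous_on {0..1} (\<lambda>s. wgt l v l v s * rmean (\<lambda>t. h t (v t)) s)"
      by (rule continuous_forcing_integrand[OF v v])
  qed
  then have fc: "uniform_limit {0..1} (\<lambda>i. forcing (ls1 i) (us1 i) (ls2 i) (us2 i)) (forcing l v l v) F"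
    unfolding forcing_def by (rule uniform_limit_uminus)
  have ly: "eventually (\<lambda>i. linear_solution (\<lambda>s. ls1 i * ?w i s)
      (hslope (us1 i) (us2 i)) (\<lambda>_. 1) (Ysol (ls1 i) (us1 i) (ls2 i) (us2 i))) F"
    using good by (rule eventually_mono) (blast intro: Ysol_Zsol(1))
  have lz: "eventually (\<lambda>i. linear_solution (\<lambda>s. ls1 i * ?w i s)
      (hslope (us1 i) (us2 i)) (forcing (ls1 i) (us1 i) (ls2 i) (us2 i)) (Zsol (ls1 i) (us1 i) (ls2 i) (us2 i))) F"
    using good by (rule eventually_mono) (blast intro: Ysol_Zsol(2))
  show "uniform_limit {0..1} (\<lambda>i. Ysol (ls1 i) (us1 i) (ls2 i) (us2 i)) (Ysol l v l v) F"
    by (rule linear_solution_limit[OF Ysol_Zsol(1)[OF v v] ly k hs uniform_limit_const])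
  show "uniform_limit {0..1} (\<lambda>i. Zsol (ls1 i) (us1 i) (ls2 i) (us2 i)) (Zsol l v l v) F"
    by (rule linear_solution_limit[OF Ysol_Zsol(2)[OF v v] lz k hs fc])
qed

section \<open>Non-degeneracy\<close>

text \<open>
  The Wronskian-type function \<open>W\<close> of the solution \<open>v\<close> and its linearisation \<open>y\<close> is non-decreasing
  by (H3) as long as \<open>y \<ge> 0\<close>, and \<open>(y / v)'\<close> has the sign of \<open>W\<close>.
\<close>

lemma Ysol_pos:
  assumes v: "sol l a v" and v1: "v 1 = 0"
    and H3: "\<And>t x. t \<in> {0..1} \<Longrightarrow> 0 \<le> x \<Longrightarrow> f' t x * x \<le> (p - 1) * f t x"
    and \<delta>: "0 < \<delta>" and \<epsilon>: "0 < \<epsilon>"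
    and strict: "\<And>t x. t \<in> {1 - \<delta><..1} \<Longrightarrow> x \<in> {0<..<\<epsilon>} \<Longrightarrow> f' t x * x < (p - 1) * f t x"
  shows "0 < Ysol l v l v 1"
proof -
  note l = sol_positive(1)[OF v] and a = sol_positive(2)[OF v]
  define y where "y = Ysol l v l v"
  define X where "X = flux_mean l v"
  define R where "R s = rmean (\<lambda>t. h' t (v t) * y t) s" for s
  define \<kappa> where "\<kappa> s = l * (s powr q * dpow (X s))" for s
  note cv = sol_continuous[OF v]
  have pr: "profile (\<lambda>t. l * h t (v t)) v" "v 0 = a" using v by (auto simp: sol_def)
  have lin: "linear_solution \<kappa> (\<lambda>t. h' t (v t)) (\<lambda>_. 1) y"
    using Ysol_Zsol(1)[OF v v]
    by (simp add: y_def \<kappa>_def[abs_def] X_def wgt_def hslope_def[abs_def] avg_self)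
  note linD = linear_solutionD[OF lin]
  have Xpos: "0 < X s" if "s \<in> {0..1}" for s unfolding X_def by (rule sol_flux_mean_pos[OF v that])
  have vpos: "0 < v r" if "0 \<le> r" "r < 1" for r
    using profile_strict_antimono[OF pr(1), of r 1] that v1 pr(2) l a h_pos[of 0 a] by simp
  have vnonneg: "0 \<le> v r" if "r \<in> {0..1}" for r
    using vpos[of r] v1 that by (cases "r = 1") (auto simp: less_imp_le)
  have y0: "y 0 = 1" using linD(4)[of 0] by simp
  have cR: "continuous_on {0..1} (\<lambda>t. h' t (v t) * y t)"
    by (intro continuous_on_mult linD)
  have dv: "(v has_real_derivative - (r powr q * X r powr q)) (at r within {0..1})" if "r \<in> {0..1}" for r
    using profile_has_derivative[OF pr(1) that] slope_flux_mean[OF v that] by (simp add: X_def)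
  have dy: "(y has_real_derivative - (\<kappa> r * R r)) (at r within {0..1})" if r: "r \<in> {0..1}" for r
  proof -
    have "continuous_on {0..1} (\<lambda>s. \<kappa> s * R s)"
      unfolding R_def by (intro continuous_on_mult linD(1) continuous_rmean cR)
    from DERIV_diff[OF DERIV_const integral_has_real_derivative[OF this r], of 1]
    have "((\<lambda>r. 1 - integral {0..r} (\<lambda>s. \<kappa> s * R s)) has_real_derivative - (\<kappa> r * R r)) (at r within {0..1})"
      by simp
    then show ?thesis
      by (rule has_field_derivative_transform_within[where d = 1, OF _ _ r])
         (use linD(4) in \<open>simp_all add: R_def\<close>)
  qed
  define P where "P r = r ^ N * X r" for r
  \<comment> \<open>\<open>P\<close> is the flux of v and \<open>l * (r ^ N * R r)\<close> the
    linearised flux in direction y. The factor p - 1 is the degree of homogeneity of phi.\<close>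
  define W where "W r = (p - 1) * P r * y r - l * (r ^ N * R r) * v r" for r
  define W' where "W' r = l * r ^ (N - 1) * y r * ((p - 1) * h r (v r) - h' r (v r) * v r)" for r
  have dW: "(W has_real_derivative W' r) (at r)" if r: "0 < r" "r < 1" for r
  proof -
    have r1: "r \<in> {0..1}" using r by auto
    have "((\<lambda>s. s ^ N * rmean (\<lambda>t. h t (v t)) s) has_real_derivative r ^ (N - 1) * h r (v r)) (at r)"
      by (rule has_real_derivative_inside[OF power_rmean_has_derivative[OF continuous_h_comp(1)[OF cv] r1] r])
    from DERIV_cmult[OF this, of l] have dP: "(P has_real_derivative l * (r ^ (N - 1) * h r (v r))) (at r)"
      by (simp add: P_def[abs_def] X_def flux_mean_def mult_ac)
    have dR: "((\<lambda>s. s ^ N * R s) has_real_derivative r ^ (N - 1) * (h' r (v r) * y r)) (at r)"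
      unfolding R_def by (rule has_real_derivative_inside[OF power_rmean_has_derivative[OF cR r1] r])
    note dv' = has_real_derivative_inside[OF dv[OF r1] r] and dy' = has_real_derivative_inside[OF dy[OF r1] r]
    have "(W has_real_derivative
        (p - 1) * (l * (r ^ (N - 1) * h r (v r)) * y r + - (\<kappa> r * R r) * P r)
        - l * (r ^ (N - 1) * (h' r (v r) * y r) * v r + - (r powr q * X r powr q) * (r ^ N * R r))) (at r)"
      (is "(W has_real_derivative ?D) (at r)")
      unfolding W_def[abs_def] mult.assoc
      by (intro DERIV_diff DERIV_cmult DERIV_mult[OF dP dy', unfolded mult.assoc]
          DERIV_mult[OF dR dv', unfolded mult.assoc])
    \<comment> \<open>The terms containing \<open>R\<close> cancel since q (p - 1) = 1; what remains
      is the expression that (H3) makes nonnegative.\<close>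
    also have "?D = W' r"
    proof -
      have "X r powr q = X r * X r powr (q - 1)"
        using powr_mult_base[of "X r" "q - 1"] Xpos[OF r1] by simp
      then have "(p - 1) * (\<kappa> r * P r) = l * (r powr q * X r powr q) * r ^ N * (q * (p - 1))"
        by (simp add: \<kappa>_def P_def dpow_def)
      then have 1: "(p - 1) * (\<kappa> r * P r) = l * (r powr q * X r powr q) * r ^ N"
        by (simp add: q_times)
      have "?D = W' r + R r * (l * (r powr q * X r powr q) * r ^ N - (p - 1) * (\<kappa> r * P r))"
        unfolding W'_def by (simp add: algebra_simps)
      then show ?thesis unfolding 1 by simp
    qed
    finally show ?thesis .
  qed
  have cW: "continuous_on {0..1} W"
    unfolding W_def[abs_def] P_def X_def R_def
    by (intro continuous_on_diff continuous_on_mult continuous_on_const continuous_on_power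
        continuous_on_id continuous_flux_mean continuous_rmean cR cv linD)
  have W0: "W 0 = 0" using N by (simp add: W_def P_def)
  have bracket: "0 \<le> (p - 1) * h r (v r) - h' r (v r) * v r" if "r \<in> {0..1}" for r
    using H3[OF that vnonneg[OF that]] vnonneg[OF that] by (simp add: h_def h'_def)
  have Wmono: "W r \<le> W s" if "0 \<le> r" "r \<le> s" "s \<le> 1" "\<And>x. r < x \<Longrightarrow> x < s \<Longrightarrow> 0 < y x" for r s
  proof (rule DERIV_nonneg_imp_le_open[OF that(2)])
    show "continuous_on {r..s} W" by (rule continuous_on_subset[OF cW]) (use that in auto)
    fix x assume x: "r < x" "x < s"
    have "0 \<le> W' x"
      unfolding W'_def using that x l
      by (intro mult_nonneg_nonneg bracket) (auto simp: less_imp_le)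
    then show "\<exists>z. (W has_real_derivative z) (at x) \<and> 0 \<le> z"
      using dW[of x] x that by auto
  qed
  \<comment> \<open>Up to a first zero of y, W \<ge> 0 makes y/v non-decreasing, so y/v stays at
    least 1/a and cannot vanish there. The argument stops before r = 1, where v = 0.\<close>
  have ypos: "0 < y r" if r: "0 \<le> r" "r < 1" for r
  proof (rule ccontr)
    assume "\<not> 0 < y r"
    moreover have "0 < y 0" by (simp add: y0)
    ultimately obtain \<rho> where \<rho>: "0 < \<rho>" "\<rho> \<le> r" "y \<rho> = 0" "\<And>s. 0 \<le> s \<Longrightarrow> s < \<rho> \<Longrightarrow> 0 < y s"
      using first_nonpos[OF continuous_on_subset[OF linD(3)], of 0 r] r by auto
    have "y 0 / v 0 \<le> y \<rho> / v \<rho>"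
    proof (rule DERIV_nonneg_imp_le_open[where f = "\<lambda>r. y r / v r"])
      show "0 \<le> \<rho>" using \<rho> by simp
      have "{0..\<rho>} \<subseteq> {0..1}" using \<rho>(2) r(2) by auto
      then have "continuous_on {0..\<rho>} y" "continuous_on {0..\<rho>} v"
        by (rule continuous_on_subset[OF linD(3)], rule continuous_on_subset[OF cv])
      moreover have "v x \<noteq> 0" if "x \<in> {0..\<rho>}" for x
        using vpos[of x] that \<rho>(2) r(2) by auto
      ultimately show "continuous_on {0..\<rho>} (\<lambda>r. y r / v r)"
        by (intro continuous_on_divide) auto
    next
      fix x assume x: "0 < x" "x < \<rho>"
      then have x1: "x < 1" "x \<in> {0..1}" using \<rho> r by auto
      note dv' = has_real_derivative_inside[OF dv[OF x1(2)] x(1) x1(1)]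
        and dy' = has_real_derivative_inside[OF dy[OF x1(2)] x(1) x1(1)]
      have vx: "0 < v x" using vpos x x1 by simp
      have num: "- (\<kappa> x * R x) * v x - y x * - (x powr q * X x powr q)
          = x powr q * X x powr (q - 1) * q * (W x / x ^ N)"
      proof -
        have "X x powr q = X x * X x powr (q - 1)"
          using powr_mult_base[of "X x" "q - 1"] Xpos[OF x1(2)] by simp
        moreover have "W x / x ^ N = (p - 1) * X x * y x - l * R x * v x"
          using x by (simp add: W_def P_def field_simps)
        moreover have "X x powr (q - 1) * X x * y x = q * (p - 1) * (X x powr (q - 1) * X x * y x)"
          by (simp add: q_times)
        ultimately show ?thesis unfolding \<kappa>_def dpow_def by algebra
      qed
      have "0 \<le> W x"
        using Wmono[of 0 x] W0 \<rho> x x1 by auto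
      then have "0 \<le> (- (\<kappa> x * R x) * v x - y x * - (x powr q * X x powr q)) / (v x * v x)"
        unfolding num using q_pos x by simp
      moreover have "((\<lambda>r. y r / v r) has_real_derivative
          (- (\<kappa> x * R x) * v x - y x * - (x powr q * X x powr q)) / (v x * v x)) (at x)"
        by (rule DERIV_divide[OF dy' dv']) (use vx in simp)
      ultimately show "\<exists>z. ((\<lambda>r. y r / v r) has_real_derivative z) (at x) \<and> 0 \<le> z" by blast
    qed
    then show False using \<rho>(3) y0 pr(2) a by simp
  qed
  have "((\<lambda>r. v r) \<longlongrightarrow> 0) (at 1 within {0..1})"
    using cv v1 unfolding continuous_on_def by (metis atLeastAtMost_iff order_refl zero_le_one)
  then have "eventually (\<lambda>r. v r < \<epsilon>) (at 1 within {0..1})" by (rule order_tendstoD(2)[OF _ \<epsilon>])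
  then obtain d where d: "0 < d" "\<And>r. r \<in> {0..1} \<Longrightarrow> r \<noteq> 1 \<Longrightarrow> dist r 1 < d \<Longrightarrow> v r < \<epsilon>"
    unfolding eventually_at by blast
  \<comment> \<open>Close enough to 1 that the strict part of (H3) applies on (r1,1): r exceeds 1 -
    \<delta> and v is below \<epsilon>. W then grows strictly there.\<close>
  define r1 where "r1 = 1 - min (min d \<delta>) 1 / 2"
  have r1: "0 < r1" "r1 < 1" "1 - d < r1" "1 - \<delta> < r1"
    using d(1) \<delta> by (auto simp: r1_def min_def field_simps)
  have "W r1 < W 1"
  proof (rule DERIV_pos_imp_increasing_open[OF r1(2)])
    show "continuous_on {r1..1} W" by (rule continuous_on_subset[OF cW]) (use r1 in auto)
    fix x assume x: "r1 < x" "x < 1"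
    have "v x < \<epsilon>" using d(2)[of x] x r1 by (auto simp: dist_real_def)
    moreover have vx: "0 < v x" using vpos x r1 by simp
    ultimately have "f' x (v x) * v x < (p - 1) * f x (v x)" using x r1 by (intro strict) auto
    then have "0 < W' x"
      unfolding W'_def using vx x r1 l ypos[of x]
      by (intro mult_pos_pos) (auto simp: h_def h'_def)
    then show "\<exists>z. (W has_real_derivative z) (at x) \<and> 0 < z" using dW[of x] x r1 by auto
  qed
  moreover have "0 \<le> W r1" using Wmono[of 0 r1] W0 r1 ypos by auto
  \<comment> \<open>At r = 1 the second term of W drops out with v, so the sign of W(1) is that of
    y(1).\<close>
  ultimately have "0 < (p - 1) * X 1 * y 1" by (simp add: W_def P_def v1)
  moreover have "0 < (p - 1) * X 1" using Xpos[of 1] p by simp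
  ultimately have "0 < y 1" by (rule zero_less_mult_pos)
  then show ?thesis by (simp add: y_def)
qed

end

context radial
begin

section \<open>Eigenfunctions\<close>

definition eigenprofile :: "(real \<Rightarrow> real) \<Rightarrow> real \<Rightarrow> (real \<Rightarrow> real) \<Rightarrow> bool" where
  "eigenprofile c \<mu> v \<longleftrightarrow> profile (\<lambda>t. \<mu> * (c t * phi p (v t))) v \<and>
     (\<forall>r. 0 \<le> r \<and> r < 1 \<longrightarrow> 0 < v r) \<and> v 1 = 0"

lemma eigenprofileD:
  assumes "eigenprofile c \<mu> v"
  shows "profile (\<lambda>t. \<mu> * (c t * phi p (v t))) v" "\<And>r. 0 \<le> r \<Longrightarrow> r < 1 \<Longrightarrow> 0 < v r" "v 1 = 0"
  using assms unfolding eigenprofile_def by blast+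

lemma phi_pos: "0 < x \<Longrightarrow> 0 < phi p x"
  by (simp add: phi_nonneg)

lemma phi_nonneg_imp: "0 \<le> phi p d \<Longrightarrow> 0 \<le> d"
  using phi_pos[of "- d"] phi_minus[of d] by (cases "0 \<le> d") auto

lemma eigen_ratio: "0 < x \<Longrightarrow> \<mu> * (c * phi p x) / x powr (p - 1) = \<mu> * c"
  by (simp add: phi_nonneg)

text \<open>If \<mu> \<le> 0, the flux formula gives v' \<ge> 0 and hence v(0) \<le> v(1) = 0,
  against positivity. With \<mu> > 0 the source is nonnegative and v is a profile.\<close>

lemma principal_eigenvalue_profile:
  assumes c: "continuous_on {0..1} c" "\<And>t. t \<in> {0..1} \<Longrightarrow> 0 < c t"
    and ev: "principal_eigenvalue N p c \<mu>"
  shows "0 < \<mu>" "\<exists>v. eigenprofile c \<mu> v"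
proof -
  obtain v where v: "is_solution N p (\<lambda>r \<xi>. c r * phi p \<xi>) \<mu> v" and pos: "\<And>r. r \<in> {0..<1} \<Longrightarrow> 0 < v r"
    using ev unfolding principal_eigenvalue_def by blast
  have v1: "v 1 = 0" and C1: "C1_01 v" using v by (auto simp: is_solution_def)
  have nonneg: "0 \<le> v r" if "r \<in> {0..1}" for r
    using pos[of r] v1 that by (cases "r = 1") (auto simp: less_imp_le)
  have "continuous_on {0..1} (\<lambda>r. v r powr (p - 1))"
    using p nonneg by (intro continuous_on_powr' continuous_on_const C1_01_continuous[OF C1]) auto
  then have "continuous_on {0..1} (\<lambda>r. phi p (v r))"
    by (rule continuous_on_eq) (simp add: phi_nonneg nonneg)
  from continuous_on_mult[OF c(1) this] have cc: "continuous_on {0..1} (\<lambda>r. c r * phi p (v r))" .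
  from continuous_on_mult[OF continuous_on_const this]
  have c\<psi>: "continuous_on {0..1} (\<lambda>r. \<mu> * (c r * phi p (v r)))" .
  have cphi: "0 \<le> c r * phi p (v r)" if "r \<in> {0..1}" for r
    using c(2)[OF that] nonneg[OF that] by (simp add: phi_nonneg)
  show \<mu>: "0 < \<mu>"
  proof (rule ccontr)
    assume "\<not> 0 < \<mu>"
    have D: "0 \<le> D01 v s" if s: "s \<in> {0..1}" for s
    proof (rule phi_nonneg_imp)
      have "phi p (D01 v s) = - (s * (\<mu> * rmean (\<lambda>r. c r * phi p (v r)) s))"
        using is_solution_flux[OF v c\<psi> s] by (simp add: rmean_cmult)
      moreover have "s * (\<mu> * rmean (\<lambda>r. c r * phi p (v r)) s) \<le> 0"
        using s \<open>\<not> 0 < \<mu>\<close> rmean_nonneg[OF cc s cphi]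
        by (intro mult_nonneg_nonpos mult_nonpos_nonneg) auto
      ultimately show "0 \<le> phi p (D01 v s)" by simp
    qed
    have "v 0 \<le> v 1"
    proof (rule DERIV_nonneg_imp_le_open[where f = v])
      fix x :: real assume x: "0 < x" "x < 1"
      then show "\<exists>y. (v has_real_derivative y) (at x) \<and> 0 \<le> y"
        using D[of x] has_real_derivative_inside[OF C1_01D[OF C1]] by (intro exI[of _ "D01 v x"]) auto
    qed (use C1_01_continuous[OF C1] in auto)
    then show False using pos[of 0] v1 by simp
  qed
  have "profile (\<lambda>r. \<mu> * (c r * phi p (v r))) v"
    using is_solution_imp_profile[OF v c\<psi>] \<mu> cphi by simp
  then show "\<exists>v. eigenprofile c \<mu> v"
    using pos v1 unfolding eigenprofile_def by auto
qed

section \<open>Homogeneous limit problems\<close>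

text \<open>For weight \<open>finf\<close> this is the limit of \<open>K l a\<close> as a tends to
  infinity.\<close>

definition hom :: "(real \<Rightarrow> real) \<Rightarrow> real \<Rightarrow> real \<Rightarrow> real \<Rightarrow> real" where
  "hom c l t x = l * (c t * x powr (p - 1))"

text \<open>Since p > 2, x^(p-2) \<le> 1 on [0,1], so (p-1) x - x^(p-1) is non-decreasing
  there.\<close>

lemma powr_lipschitz01:
  assumes "x \<in> {0..1}" "y \<in> {0..1}"
  shows "\<bar>x powr (p - 1) - y powr (p - 1)\<bar> \<le> (p - 1) * \<bar>x - y\<bar>"
proof -
  have *: "\<bar>x powr (p - 1) - y powr (p - 1)\<bar> \<le> (p - 1) * \<bar>x - y\<bar>"
    if "0 \<le> x" "x \<le> y" "y \<le> 1" for x y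
  proof -
    have "(p - 1) * x - x powr (p - 1) \<le> (p - 1) * y - y powr (p - 1)"
    proof (rule DERIV_nonneg_imp_le_open[where f = "\<lambda>x. (p - 1) * x - x powr (p - 1)"])
      show "continuous_on {x..y} (\<lambda>x. (p - 1) * x - x powr (p - 1))"
        using p that by (intro continuous_intros continuous_on_powr') auto
      fix z assume z: "x < z" "z < y"
      have "((\<lambda>x. (p - 1) * x - x powr (p - 1)) has_real_derivative (p - 1) - (p - 1) * z powr (p - 1 - 1)) (at z)"
        using DERIV_diff[OF DERIV_cmult_Id has_real_derivative_powr[of z "p - 1"], of "p - 1"] z that by simp
      moreover have "z powr (p - 1 - 1) \<le> 1"
        using z that p by (intro powr_le1) auto
      then have "(p - 1) * z powr (p - 1 - 1) \<le> (p - 1) * 1"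
        using p by (intro mult_left_mono) auto
      ultimately show "\<exists>d. ((\<lambda>x. (p - 1) * x - x powr (p - 1)) has_real_derivative d) (at z) \<and> 0 \<le> d"
        by (intro exI conjI) auto
    qed (use that in auto)
    moreover have "x powr (p - 1) \<le> y powr (p - 1)" using that p by (intro powr_mono2) auto
    moreover have "(p - 1) * \<bar>x - y\<bar> = (p - 1) * y - (p - 1) * x"
      using that by (simp add: abs_if right_diff_distrib)
    ultimately show ?thesis by linarith
  qed
  show ?thesis
    using *[of x y] *[of y x] assms by (cases "x \<le> y") (auto simp: abs_minus_commute)
qed

lemma admissible_hom:
  assumes c: "continuous_on {0..1} c" "\<And>t. t \<in> {0..1} \<Longrightarrow> 0 < c t" and l: "0 < l"
  shows "admissible (hom c l)"
  unfolding admissible_def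
proof (intro conjI ballI impI)
  have "continuous_on ({0..1} \<times> {0..1}) (\<lambda>z::real \<times> real. l * (c (fst z) * snd z powr (p - 1)))"
    using p
    by (intro continuous_on_mult continuous_on_const continuous_on_compose2[OF c(1)] continuous_on_powr'
        continuous_on_fst continuous_on_snd continuous_on_id) auto
  then show "continuous_on ({0..1} \<times> {0..1}) (\<lambda>(t, x). hom c l t x)" by (simp add: hom_def split_beta)
  show "0 \<le> hom c l t x" if "t \<in> {0..1}" for t x
    using l c(2)[OF that] by (simp add: hom_def)
  show "0 < hom c l t x" if "t \<in> {0..1}" "0 < x" for t x
    using l c(2)[OF that(1)] that(2) by (simp add: hom_def)
  obtain B where B: "0 < B" "\<And>t. t \<in> {0..1} \<Longrightarrow> \<bar>c t\<bar> \<le> B"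
    using continuous_on_01_bound[OF c(1)] by blast
  show "\<exists>L\<ge>0. \<forall>t\<in>{0..1}. \<forall>x\<in>{0..1}. \<forall>y\<in>{0..1}. \<bar>hom c l t x - hom c l t y\<bar> \<le> L * \<bar>x - y\<bar>"
  proof (intro exI[of _ "l * (B * (p - 1))"] conjI ballI)
    show "0 \<le> l * (B * (p - 1))" using l B p by simp
    fix t x y :: real assume t: "t \<in> {0..1}" and x: "x \<in> {0..1}" and y: "y \<in> {0..1}"
    have "\<bar>hom c l t x - hom c l t y\<bar> = l * (\<bar>c t\<bar> * \<bar>x powr (p - 1) - y powr (p - 1)\<bar>)"
      using l by (simp add: hom_def abs_mult flip: right_diff_distrib)
    also have "\<dots> \<le> l * (B * ((p - 1) * \<bar>x - y\<bar>))"
      using l B t powr_lipschitz01[OF x y] by (intro mult_left_mono mult_mono) auto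
    finally show "\<bar>hom c l t x - hom c l t y\<bar> \<le> l * (B * (p - 1)) * \<bar>x - y\<bar>" by (simp add: mult.assoc)
  qed
qed

lemma hom_solution:
  assumes c: "\<And>t. t \<in> {0..1} \<Longrightarrow> 0 < c t" and l: "0 < l"
    and w: "w 0 = 1" "profile (\<lambda>t. hom c l t (cut01 (w t))) w"
  shows "0 < hom c l 0 (cut01 (w 0))"
    "\<And>t. t \<in> {0..1} \<Longrightarrow> 0 < w t \<Longrightarrow> hom c l t (cut01 (w t)) / w t powr (p - 1) = l * c t"
proof -
  show "0 < hom c l 0 (cut01 (w 0))" using l c[of 0] w(1) by (simp add: hom_def cut01_def)
  fix t :: real assume t: "t \<in> {0..1}" "0 < w t"
  then have "w t \<le> 1" using profile_antimono[OF w(2), of 0 t] w(1) by simp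
  then have "cut01 (w t) = w t" using t by (simp add: cut01_id)
  then show "hom c l t (cut01 (w t)) / w t powr (p - 1) = l * c t" using t by (simp add: hom_def)
qed

text \<open>If w had a first zero \<rho>, comparison with the eigenfunction, whose coefficient \<mu>
  c is larger, would force equal coefficients on (0,\<rho>), that is l = \<mu>.\<close>

lemma hom_below_eigenvalue:
  assumes c: "\<And>t. t \<in> {0..1} \<Longrightarrow> 0 < c t" and l: "0 < l" "l < \<mu>" and v: "eigenprofile c \<mu> v"
    and w: "w 0 = 1" "profile (\<lambda>t. hom c l t (cut01 (w t))) w"
  shows "0 < w 1"
proof (rule ccontr)
  assume n: "\<not> 0 < w 1"
  have hs: "0 < hom c l 0 (cut01 (w 0))"
    "\<And>t. t \<in> {0..1} \<Longrightarrow> 0 < w t \<Longrightarrow> hom c l t (cut01 (w t)) / w t powr (p - 1) = l * c t"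
    by (rule hom_solution[OF c l(1) w]; assumption)+
  note vD = eigenprofileD[OF v]
  have "0 < w 0" "w 1 \<le> 0" using w n by auto
  then obtain \<rho> where \<rho>: "0 < \<rho>" "\<rho> \<le> 1" "w \<rho> = 0" "\<And>s. 0 \<le> s \<Longrightarrow> s < \<rho> \<Longrightarrow> 0 < w s"
    using first_nonpos[OF profile_continuous[OF w(2)]] zero_le_one by blast
  have v0: "0 < \<mu> * (c 0 * phi p (v 0))" using l c[of 0] vD(2)[of 0] by (simp add: phi_pos)
  have v\<rho>: "0 \<le> v \<rho>" using vD(2)[of \<rho>] vD(3) \<rho> by (cases "\<rho> = 1") (auto simp: less_imp_le)
  have vpos: "0 < v r" if "0 \<le> r" "r < \<rho>" for r using vD(2)[of r] that \<rho>(2) by simp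
  define r where "r = \<rho> / 2"
  have r: "0 < r" "r < \<rho>" "r \<in> {0..1}" using \<rho> by (auto simp: r_def)
  have "hom c l r (cut01 (w r)) / w r powr (p - 1) = \<mu> * (c r * phi p (v r)) / v r powr (p - 1)"
  proof (rule sturm_comparison(2)[OF vD(1) w(2) v0 hs(1) \<rho>(1,2) vpos \<rho>(4) \<rho>(3) v\<rho> _ r(1,2)])
    fix s assume s: "0 < s" "s < \<rho>"
    then have s1: "s \<in> {0..1}" using \<rho> by simp
    show "hom c l s (cut01 (w s)) / w s powr (p - 1) \<le> \<mu> * (c s * phi p (v s)) / v s powr (p - 1)"
      unfolding hs(2)[OF s1 \<rho>(4)[OF less_imp_le[OF s(1)] s(2)]] eigen_ratio[OF vpos[OF less_imp_le[OF s(1)] s(2)]]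
      using c[OF s1] l by simp
  qed
  then have "l * c r = \<mu> * c r"
    using hs(2)[OF r(3)] \<rho>(4)[of r] vpos[of r] r eigen_ratio[of "v r" \<mu> "c r"] by simp
  then show False using l c[OF r(3)] by simp
qed

end

section \<open>Monotonicity of f / phi and its limits at 0 and infinity\<close>

locale bvp = nonlinearity +
  fixes f0 finf :: "real \<Rightarrow> real"
  assumes H3: "t \<in> {0..1} \<Longrightarrow> 0 \<le> x \<Longrightarrow> f' t x * x \<le> (p - 1) * f t x"
    and H3_strict: "\<exists>\<delta>>0. \<exists>\<epsilon>>0. \<forall>t\<in>{1 - \<delta><..1}. \<forall>x\<in>{0<..<\<epsilon>}. f' t x * x < (p - 1) * f t x"
    and f0_lim: "t \<in> {0..1} \<Longrightarrow> ((\<lambda>x. f t x / x powr (p - 1)) \<longlongrightarrow> f0 t) (at_right 0)"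
    and f0_cont: "continuous_on {0..1} f0"
    and finf_lim: "t \<in> {0..1} \<Longrightarrow> ((\<lambda>x. f t x / x powr (p - 1)) \<longlongrightarrow> finf t) at_top"
    and finf_cont: "continuous_on {0..1} finf"
    and H4: "0 < e \<Longrightarrow> eventually (\<lambda>x. \<forall>t\<in>{0..1}. \<bar>f t x / x powr (p - 1) - f0 t\<bar> < e) (at_right 0)"
    and H5: "0 < e \<Longrightarrow> eventually (\<lambda>x. \<forall>t\<in>{0..1}. \<bar>f t x / x powr (p - 1) - finf t\<bar> < e) at_top"
begin

definition g :: "real \<Rightarrow> real \<Rightarrow> real" where
  "g t x = f t x / x powr (p - 1)"

lemma g_has_derivative:
  assumes "t \<in> {0..1}" "0 < x"
  shows "(g t has_real_derivative (f' t x * x - (p - 1) * f t x) / x powr p) (at x)"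
proof -
  have "(g t has_real_derivative
      (f' t x * x powr (p - 1) - f t x * ((p - 1) * x powr (p - 1 - 1))) / (x powr (p - 1) * x powr (p - 1))) (at x)"
    unfolding g_def[abs_def] using assms
    by (intro DERIV_divide f_deriv has_real_derivative_powr) auto
  also have "(f' t x * x powr (p - 1) - f t x * ((p - 1) * x powr (p - 1 - 1))) / (x powr (p - 1) * x powr (p - 1))
      = (f' t x * x - (p - 1) * f t x) / x powr p"
  proof -
    define z where "z = x powr (p - 1 - 1)"
    have z: "0 < z" using assms by (simp add: z_def)
    have 1: "x powr (p - 1) = x * z" using powr_mult_base[of x "p - 1 - 1"] assms by (simp add: z_def)
    have 2: "x powr p = x * (x * z)" using powr_mult_base[of x "p - 1"] assms 1 by simp
    show ?thesis unfolding 1 2 z_def[symmetric] using assms z by (simp add: field_simps)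
  qed
  finally show ?thesis .
qed

lemma g_antimono:
  assumes "t \<in> {0..1}" "0 < x" "x \<le> y"
  shows "g t y \<le> g t x"
proof (rule DERIV_nonpos_imp_nonincreasing[OF assms(3)])
  fix z assume "x \<le> z" "z \<le> y"
  then have z: "0 < z" using assms(2) by simp
  have "(f' t z * z - (p - 1) * f t z) / z powr p \<le> 0"
    using H3[OF assms(1), of z] z by (intro divide_nonpos_nonneg) auto
  then show "\<exists>d. (g t has_real_derivative d) (at z) \<and> d \<le> 0"
    using g_has_derivative[OF assms(1) z] by blast
qed

lemma g_strict:
  obtains \<delta> \<epsilon> where "0 < \<delta>" "0 < \<epsilon>"
    "\<And>t x y. t \<in> {0..1} \<Longrightarrow> 1 - \<delta> < t \<Longrightarrow> 0 < x \<Longrightarrow> x < y \<Longrightarrow> y < \<epsilon> \<Longrightarrow> g t y < g t x"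
proof -
  obtain \<delta> \<epsilon> where \<delta>: "0 < \<delta>" "0 < \<epsilon>" "\<forall>t\<in>{1 - \<delta><..1}. \<forall>x\<in>{0<..<\<epsilon>}. f' t x * x < (p - 1) * f t x"
    using H3_strict by blast
  show thesis
  proof (rule that[OF \<delta>(1,2)])
    fix t x y assume t: "t \<in> {0..1}" "1 - \<delta> < t" and x: "0 < x" "x < y" "y < \<epsilon>"
    show "g t y < g t x"
    proof (rule DERIV_neg_imp_decreasing[OF x(2)])
      fix z assume z: "x \<le> z" "z \<le> y"
      then have z0: "0 < z" using x by simp
      have "f' t z * z < (p - 1) * f t z" using \<delta>(3) t x z by auto
      then have "(f' t z * z - (p - 1) * f t z) / z powr p < 0"
        using z0 by (intro divide_neg_pos) auto
      then show "\<exists>d. (g t has_real_derivative d) (at z) \<and> d < 0"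
        using g_has_derivative[OF t(1) z0] by blast
    qed
  qed
qed

lemma g_le_f0:
  assumes "t \<in> {0..1}" "0 < x"
  shows "g t x \<le> f0 t"
proof (rule tendsto_lowerbound[OF f0_lim[OF assms(1)]])
  show "\<forall>\<^sub>F y in at_right 0. g t x \<le> f t y / y powr (p - 1)"
    by (rule eventually_mono[OF eventually_at_right_real[OF assms(2)]])
       (use g_antimono[OF assms(1)] in \<open>auto simp: g_def\<close>)
qed simp

lemma finf_le_g:
  assumes "t \<in> {0..1}" "0 < x"
  shows "finf t \<le> g t x"
proof (rule tendsto_upperbound[OF finf_lim[OF assms(1)]])
  show "\<forall>\<^sub>F y in at_top. f t y / y powr (p - 1) \<le> g t x"
    by (rule eventually_mono[OF eventually_ge_at_top[of x]])
       (use g_antimono[OF assms] in \<open>auto simp: g_def\<close>)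
qed simp

lemma g_pos: "t \<in> {0..1} \<Longrightarrow> 0 < x \<Longrightarrow> 0 < g t x"
  using f_pos[of t x] by (simp add: g_def)

lemma f0_pos: "t \<in> {0..1} \<Longrightarrow> 0 < f0 t"
  using g_pos[of t 1] g_le_f0[of t 1] by simp

lemma finf_nonneg: "t \<in> {0..1} \<Longrightarrow> 0 \<le> finf t"
proof -
  assume t: "t \<in> {0..1}"
  show "0 \<le> finf t"
  proof (rule tendsto_lowerbound[OF finf_lim[OF t]])
    show "\<forall>\<^sub>F y in at_top. 0 \<le> f t y / y powr (p - 1)"
      by (intro always_eventually allI) (simp add: f_nonneg[OF t])
  qed simp
qed

text \<open>(H3) is strict only for r near 1 and small arguments, but one strict step at tiny
  arguments followed by monotonicity covers every x > 0. The point t excludes equality in the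
  comparisons that involve \<open>f0\<close>.\<close>

lemma g_lt_f0_near_1:
  obtains t where "0 < t" "t < 1" "\<And>x. 0 < x \<Longrightarrow> g t x < f0 t" "finf t < f0 t"
proof -
  obtain \<delta> \<epsilon> where \<delta>: "0 < \<delta>" "0 < \<epsilon>"
    "\<And>t x y. t \<in> {0..1} \<Longrightarrow> 1 - \<delta> < t \<Longrightarrow> 0 < x \<Longrightarrow> x < y \<Longrightarrow> y < \<epsilon> \<Longrightarrow> g t y < g t x"
    by (rule g_strict) blast
  define t where "t = 1 - min \<delta> 1 / 2"
  have t: "0 < t" "t < 1" "1 - \<delta> < t" "t \<in> {0..1}" using \<delta>(1) by (auto simp: t_def min_def)
  have lt: "g t x < f0 t" if x: "0 < x" for x
  proof -
    define y where "y = min x \<epsilon> / 2"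
    have y: "0 < y" "y < x" "y < \<epsilon>" using x \<delta>(2) by (auto simp: y_def min_def)
    have "g t x \<le> g t y" using y by (intro g_antimono[OF t(4)]) auto
    also have "\<dots> < g t (y / 2)" using y t by (intro \<delta>(3)) auto
    also have "\<dots> \<le> f0 t" using y by (intro g_le_f0[OF t(4)]) auto
    finally show ?thesis .
  qed
  show thesis
    by (rule that[OF t(1,2) lt]) (use lt[of 1] finf_le_g[OF t(4), of 1] in auto)
qed

section \<open>Sign of the shooting function for extreme parameters\<close>

lemma sol_ratio: "0 < u t \<Longrightarrow> l * h t (u t) / u t powr (p - 1) = l * g t (u t)"
  by (simp add: h_eq g_def)

lemma sol_profile:
  assumes "sol l a u"
  shows "profile (\<lambda>t. l * h t (u t)) u" "u 0 = a" "0 < l * h 0 (u 0)"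
  using assms h_pos[of 0 a] by (auto simp: sol_def)

lemma sol_pos_before_1:
  assumes "sol l a u" "0 \<le> u 1" "0 \<le> r" "r < 1"
  shows "0 < u r"
  using profile_strict_antimono[OF sol_profile(1,3)[OF assms(1)] assms(3,4) order_refl] assms(2) by simp

text \<open>As g \<le> f0, a first zero \<rho> of u would force the eigenfunction to vanish at
  \<rho> too. Then \<rho> = 1 and the coefficients agree on (0,1), which fails where g < f0.\<close>

lemma sol_at_l0:
  assumes l0: "0 < l0" and v: "eigenprofile f0 l0 v" and u: "sol l0 a u"
  shows "0 < u 1"
proof (rule ccontr)
  assume n: "\<not> 0 < u 1"
  note a = sol_positive(2)[OF u]
  note uD = sol_profile[OF u] and vD = eigenprofileD[OF v]
  have "0 < u 0" "u 1 \<le> 0" using uD(2) a n by auto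
  then obtain \<rho> where \<rho>: "0 < \<rho>" "\<rho> \<le> 1" "u \<rho> = 0" "\<And>s. 0 \<le> s \<Longrightarrow> s < \<rho> \<Longrightarrow> 0 < u s"
    using first_nonpos[OF profile_continuous[OF uD(1)]] zero_le_one by blast
  have v0: "0 < l0 * (f0 0 * phi p (v 0))" using l0 f0_pos[of 0] vD(2)[of 0] by (simp add: phi_pos)
  have v\<rho>: "0 \<le> v \<rho>" using vD(2)[of \<rho>] vD(3) \<rho> by (cases "\<rho> = 1") (auto simp: less_imp_le)
  have vpos: "0 < v r" if "0 \<le> r" "r < \<rho>" for r using vD(2)[of r] that \<rho>(2) by simp
  have le: "l0 * h s (u s) / u s powr (p - 1) \<le> l0 * (f0 s * phi p (v s)) / v s powr (p - 1)"
    if "0 < s" "s < \<rho>" for s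
    using that \<rho> l0 vpos[of s] \<rho>(4)[of s] g_le_f0[of s "u s"] by (simp add: sol_ratio eigen_ratio)
  note st = sturm_comparison[OF vD(1) uD(1) v0 uD(3) \<rho>(1,2) vpos \<rho>(4) \<rho>(3) v\<rho> le]
  have "v \<rho> = 0" by (rule st(1))
  then have \<rho>1: "\<rho> = 1" using vD(2)[of \<rho>] \<rho> by (cases "\<rho> = 1") auto
  obtain t where t: "0 < t" "t < 1" "\<And>x. 0 < x \<Longrightarrow> g t x < f0 t"
    by (rule g_lt_f0_near_1) blast
  have "l0 * h t (u t) / u t powr (p - 1) = l0 * (f0 t * phi p (v t)) / v t powr (p - 1)"
    using t \<rho>1 by (intro st(2)) auto
  then have "l0 * g t (u t) = l0 * f0 t"
    using \<rho>(4)[of t] vpos[of t] t \<rho>1 by (simp add: sol_ratio eigen_ratio)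
  then show False using l0 t(3)[of "u t"] \<rho>(4)[of t] t \<rho>1 by simp
qed

text \<open>If u(1) \<ge> 0, comparison with the eigenfunction gives g(t, u(t)) = finf(t) on (0,1)
  and u(1) = 0. Near r = 1 the value u(t) is so small that g still decreases strictly beyond it, and
  would fall below its lower bound finf(t).\<close>

lemma sol_at_linf:
  assumes pos: "\<And>t. t \<in> {0..1} \<Longrightarrow> 0 < finf t" and li: "0 < li" and v: "eigenprofile finf li v"
    and u: "sol li a u"
  shows "u 1 < 0"
proof (rule ccontr)
  assume "\<not> u 1 < 0"
  then have n: "0 \<le> u 1" by simp
  note uD = sol_profile[OF u] and vD = eigenprofileD[OF v]
  have upos: "0 < u r" if "0 \<le> r" "r < 1" for r by (rule sol_pos_before_1[OF u n that])
  have v0: "0 < li * (finf 0 * phi p (v 0))" using li pos[of 0] vD(2)[of 0] by (simp add: phi_pos)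
  have le: "li * (finf s * phi p (v s)) / v s powr (p - 1) \<le> li * h s (u s) / u s powr (p - 1)"
    if "0 < s" "s < 1" for s
    using that li vD(2)[of s] upos[of s] finf_le_g[of s "u s"] by (simp add: sol_ratio eigen_ratio)
  note st = sturm_comparison[OF uD(1) vD(1) uD(3) v0 zero_less_one order_refl upos vD(2,3) n le]
  have u1: "u 1 = 0" by (rule st(1))
  have eq: "finf t = g t (u t)" if t: "0 < t" "t < 1" for t
  proof -
    have "li * (finf t * phi p (v t)) / v t powr (p - 1) = li * h t (u t) / u t powr (p - 1)"
      by (rule st(2)) (use t in auto)
    then show ?thesis using upos[of t] vD(2)[of t] t li by (simp add: sol_ratio eigen_ratio)
  qed
  obtain \<delta> \<epsilon> where \<delta>: "0 < \<delta>" "0 < \<epsilon>"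
    "\<And>t x y. t \<in> {0..1} \<Longrightarrow> 1 - \<delta> < t \<Longrightarrow> 0 < x \<Longrightarrow> x < y \<Longrightarrow> y < \<epsilon> \<Longrightarrow> g t y < g t x"
    by (rule g_strict) blast
  have "(u \<longlongrightarrow> 0) (at_left 1)"
  proof (rule tendsto_mono[OF at_left_le_within_01])
    show "(u \<longlongrightarrow> 0) (at 1 within {0..1})"
      using profile_continuous[OF uD(1)] u1 unfolding continuous_on_def by (metis atLeastAtMost_iff order_refl zero_le_one)
  qed auto
  then have "eventually (\<lambda>t. u t < \<epsilon>) (at_left 1)" by (rule order_tendstoD(2)[OF _ \<delta>(2)])
  moreover have "eventually (\<lambda>t. t \<in> {max 0 (1 - \<delta>)<..<1}) (at_left 1)"
    using \<delta>(1) by (intro eventually_at_left_real) auto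
  ultimately have "eventually (\<lambda>t. u t < \<epsilon> \<and> t \<in> {max 0 (1 - \<delta>)<..<1}) (at_left 1)"
    by (rule eventually_conj)
  then obtain t where t: "u t < \<epsilon>" "t \<in> {max 0 (1 - \<delta>)<..<1}"
    using eventually_happens'[OF trivial_limit_at_left_real] by blast
  then have t1: "0 < t" "t < 1" "1 - \<delta> < t" "t \<in> {0..1}" by auto
  have ut: "0 < u t" using upos[of t] t1 by simp
  define y where "y = (u t + \<epsilon>) / 2"
  have y: "u t < y" "y < \<epsilon>" using t(1) by (auto simp: y_def)
  have "g t y < g t (u t)" using \<delta>(3)[OF t1(4,3) ut y] .
  moreover have "finf t \<le> g t y" using finf_le_g[OF t1(4), of y] y ut by simp
  ultimately show False using eq[OF t1(1,2)] by simp
qed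

text \<open>If li \<le> l0, then li finf \<le> l0 f0, and comparing the two eigenfunctions forces
  equality on (0,1); this fails where finf < f0.\<close>

lemma l0_less_linf:
  assumes l0: "0 < l0" and v: "eigenprofile f0 l0 v"
    and pos: "\<And>t. t \<in> {0..1} \<Longrightarrow> 0 < finf t" and li: "0 < li" and w: "eigenprofile finf li w"
  shows "l0 < li"
proof (rule ccontr)
  assume n: "\<not> l0 < li"
  note wD = eigenprofileD[OF w] and vD = eigenprofileD[OF v]
  have v0: "0 < l0 * (f0 0 * phi p (v 0))" using l0 f0_pos[of 0] vD(2)[of 0] by (simp add: phi_pos)
  have w0: "0 < li * (finf 0 * phi p (w 0))" using li pos[of 0] wD(2)[of 0] by (simp add: phi_pos)
  have finf_f0: "li * finf t \<le> l0 * f0 t" if "t \<in> {0..1}" for t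
    using that n l0 li finf_le_g[OF that, of 1] g_le_f0[OF that, of 1] finf_nonneg[OF that]
    by (intro mult_mono) auto
  have le: "li * (finf s * phi p (w s)) / w s powr (p - 1) \<le> l0 * (f0 s * phi p (v s)) / v s powr (p - 1)"
    if "0 < s" "s < 1" for s
    using that vD(2)[of s] wD(2)[of s] finf_f0[of s] by (simp add: eigen_ratio)
  have v1: "0 \<le> v 1" using vD(3) by simp
  note st = sturm_comparison(2)[OF vD(1) wD(1) v0 w0 zero_less_one order_refl vD(2) wD(2,3) v1 le]
  obtain t where t: "0 < t" "t < 1" "finf t < f0 t"
    by (rule g_lt_f0_near_1) blast
  have "li * (finf t * phi p (w t)) / w t powr (p - 1) = l0 * (f0 t * phi p (v t)) / v t powr (p - 1)"
    by (rule st) (use t in auto)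
  then have "li * finf t = l0 * f0 t"
    using vD(2)[of t] wD(2)[of t] t by (simp add: eigen_ratio)
  moreover have "li * finf t \<le> l0 * finf t"
    using n t finf_nonneg[of t] by (intro mult_right_mono) auto
  moreover have "l0 * finf t < l0 * f0 t" using l0 t by simp
  ultimately show False by simp
qed

lemma K_eq:
  assumes "0 < a" "0 \<le> x" "t \<in> {0..1}"
  shows "K l a t x = l * (g t (a * x) * x powr (p - 1))"
proof (cases "x = 0")
  case True
  then show ?thesis using assms by (simp add: K_def h_def f_zero)
next
  case False
  then show ?thesis using assms by (simp add: K_def h_eq g_def powr_mult)
qed

text \<open>(H5) controls only large arguments a x. Below the threshold b, p > 2 gives x^(p-1) \<le>
  x \<le> b/a, so the weight is small while g - finf stays within a bound of f0.\<close>

lemma K_near_infinity: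
  assumes l: "0 < l" and d: "0 < d"
  obtains a0 where "0 < a0" "\<And>a t x. a0 < a \<Longrightarrow> t \<in> {0..1} \<Longrightarrow> x \<in> {0..1} \<Longrightarrow>
    \<bar>K l a t x - hom finf l t x\<bar> \<le> d"
proof -
  have "0 < d / l" using l d by simp
  from H5[OF this] obtain b0 where b0: "\<And>x. b0 \<le> x \<Longrightarrow> \<forall>t\<in>{0..1}. \<bar>f t x / x powr (p - 1) - finf t\<bar> < d / l"
    unfolding eventually_at_top_linorder by blast
  define b where "b = max b0 1"
  have b: "1 \<le> b" "\<And>x. b \<le> x \<Longrightarrow> \<forall>t\<in>{0..1}. \<bar>f t x / x powr (p - 1) - finf t\<bar> < d / l"
    using b0 by (auto simp: b_def)
  obtain B where B: "0 < B" "\<And>t. t \<in> {0..1} \<Longrightarrow> \<bar>f0 t\<bar> \<le> B"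
    using continuous_on_01_bound[OF f0_cont] by blast
  \<comment> \<open>The second entry makes l (b/a) B \<le> d for all a > a0.\<close>
  define a0 where "a0 = max b (l * (B * b) / d)"
  show thesis
  proof (rule that[of a0])
    show "0 < a0" using b(1) by (simp add: a0_def)
    fix a t x :: real assume a: "a0 < a" and t: "t \<in> {0..1}" and x: "x \<in> {0..1}"
    have a': "b < a" "l * (B * b) / d < a" "0 < a" using a b(1) by (auto simp: a0_def)
    show "\<bar>K l a t x - hom finf l t x\<bar> \<le> d"
    proof (cases "x = 0")
      case True
      then show ?thesis using d t a' by (simp add: K_def hom_def h_def f_zero)
    next
      case False
      then have x0: "0 < x" "x \<le> 1" using x by auto
      have ax: "0 < a * x" using a' x0 by simp
      have "K l a t x - hom finf l t x = l * (x powr (p - 1) * (g t (a * x) - finf t))"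
        using K_eq[OF a'(3) _ t, of x l] x0 by (simp add: hom_def algebra_simps)
      then have eq: "\<bar>K l a t x - hom finf l t x\<bar> = l * (x powr (p - 1) * \<bar>g t (a * x) - finf t\<bar>)"
        using l by (simp add: abs_mult)
      show ?thesis
      proof (cases "b \<le> a * x")
        case True
        have gf: "\<bar>g t (a * x) - finf t\<bar> \<le> d / l"
          using b(2)[OF True] t by (force simp: g_def)
        have "l * (x powr (p - 1) * \<bar>g t (a * x) - finf t\<bar>) \<le> l * (1 * (d / l))"
          using gf l x0 p by (intro mult_left_mono mult_mono powr_le1) auto
        also have "\<dots> = d" using l by simp
        finally show ?thesis unfolding eq .
      next
        case False
        then have xb: "x \<le> b / a" using a' by (simp add: field_simps)
        have "x powr (p - 1) \<le> x powr 1" using x0 p by (intro powr_mono') auto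
        then have xp: "x powr (p - 1) \<le> b / a" using xb x0 by simp
        have "\<bar>g t (a * x) - finf t\<bar> \<le> B"
          using finf_le_g[OF t ax] g_le_f0[OF t ax] finf_nonneg[OF t] B(2)[OF t] by linarith
        then have "l * (x powr (p - 1) * \<bar>g t (a * x) - finf t\<bar>) \<le> l * (b / a * B)"
          using xp l a' b(1) by (intro mult_left_mono mult_mono) auto
        also have "\<dots> = l * (B * b) / a" by simp
        also have "\<dots> \<le> d" using a' d by (simp add: field_simps)
        finally show ?thesis unfolding eq .
      qed
    qed
  qed
qed

text \<open>As \<open>g t\<close> is non-increasing and \<open>u \<le> a\<close>, the coefficient \<open>l * g t (u t)\<close> of \<open>u\<close> dominates \<open>l * g t a\<close>.\<close>

lemma sol_neg:
  assumes l0: "0 < l0" and v: "eigenprofile f0 l0 v" and u: "sol l a u"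
    and less: "\<And>t. t \<in> {0..1} \<Longrightarrow> l0 * f0 t < l * g t a"
  shows "u 1 < 0"
proof (rule ccontr)
  assume "\<not> u 1 < 0"
  then have n: "0 \<le> u 1" by simp
  note l = sol_positive(1)[OF u] and a = sol_positive(2)[OF u]
  note uD = sol_profile[OF u] and vD = eigenprofileD[OF v]
  have upos: "0 < u r" if "0 \<le> r" "r < 1" for r by (rule sol_pos_before_1[OF u n that])
  have v0: "0 < l0 * (f0 0 * phi p (v 0))" using l0 f0_pos[of 0] vD(2)[of 0] by (simp add: phi_pos)
  have lt: "l0 * (f0 s * phi p (v s)) / v s powr (p - 1) < l * h s (u s) / u s powr (p - 1)"
    if s: "0 < s" "s < 1" for s
  proof -
    have "l * g s a \<le> l * g s (u s)"
      using s l upos[of s] profile_antimono[OF uD(1), of 0 s] uD(2) by (intro mult_left_mono g_antimono) auto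
    then show ?thesis
      using s vD(2)[of s] upos[of s] less[of s] by (simp add: sol_ratio eigen_ratio)
  qed
  note st = sturm_comparison(2)[OF uD(1) vD(1) uD(3) v0 zero_less_one order_refl upos vD(2,3) n
      less_imp_le[OF lt]]
  have "l0 * (f0 (1/2) * phi p (v (1/2))) / v (1/2) powr (p - 1) = l * h (1/2) (u (1/2)) / u (1/2) powr (p - 1)"
    by (rule st) auto
  then show False using lt[of "1/2"] by simp
qed

lemma sol_small:
  assumes l0: "0 < l0" "l0 < l" and v: "eigenprofile f0 l0 v"
  obtains a0 where "0 < a0" "\<And>a u. 0 < a \<Longrightarrow> a < a0 \<Longrightarrow> sol l a u \<Longrightarrow> u 1 < 0"
proof -
  have l: "0 < l" using l0 by simp
  obtain c where c: "0 < c" "\<And>t. t \<in> {0..1} \<Longrightarrow> c \<le> f0 t"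
    using continuous_on_01_pos_bound[OF f0_cont f0_pos] by blast
  \<comment> \<open>The tolerance for f0 - g is chosen so that l (f0 - g) < (l - l0) c \<le> (l -
    l0) f0, which says l0 f0 < l g.\<close>
  have "0 < (l - l0) * c / l" using l0 c l by simp
  from H4[OF this] obtain b where b: "0 < b"
    "\<And>x. 0 < x \<Longrightarrow> x < b \<Longrightarrow> \<forall>t\<in>{0..1}. \<bar>f t x / x powr (p - 1) - f0 t\<bar> < (l - l0) * c / l"
    unfolding eventually_at_right_field by blast
  show thesis
  proof (rule that[OF b(1)])
    fix a u assume a: "0 < a" "a < b" and u: "sol l a u"
    show "u 1 < 0"
    proof (rule sol_neg[OF l0(1) v u])
      fix t :: real assume t: "t \<in> {0..1}"
      have "f0 t - g t a < (l - l0) * c / l"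
        using bspec[OF b(2)[OF a] t] by (simp add: g_def)
      then have "l * (f0 t - g t a) < (l - l0) * c" using l by (simp add: field_simps)
      also have "\<dots> \<le> (l - l0) * f0 t" using l0 c(2)[OF t] by (intro mult_left_mono) auto
      finally show "l0 * f0 t < l * g t a" by (simp add: algebra_simps)
    qed
  qed
qed

text \<open>For l below the eigenvalue the homogeneous solution w has w(1) > 0. For large a the
  rescaled solution differs from w by less than w(1), so it is positive at 1 too.\<close>

lemma sol_large:
  assumes pos: "\<And>t. t \<in> {0..1} \<Longrightarrow> 0 < finf t" and l: "0 < l" "l < li" and v: "eigenprofile finf li v"
  obtains a0 where "0 < a0" "\<And>a u. a0 < a \<Longrightarrow> sol l a u \<Longrightarrow> 0 < u 1"
proof -
  have ad: "admissible (hom finf l)" by (rule admissible_hom[OF finf_cont pos l(1)])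
  obtain w where w: "w 0 = 1" "profile (\<lambda>t. hom finf l t (cut01 (w t))) w"
    by (rule admissible_exists[OF ad])
  have w1: "0 < w 1" by (rule hom_below_eigenvalue[OF pos l v w])
  obtain d where d: "0 < d" and stable: "\<forall>k' w'.
      (\<forall>t\<in>{0..1}. \<forall>x\<in>{0..1}. 0 \<le> k' t x \<and> \<bar>k' t x - hom finf l t x\<bar> \<le> d) \<longrightarrow>
      w' 0 = 1 \<longrightarrow> profile (\<lambda>t. k' t (cut01 (w' t))) w' \<longrightarrow> (\<forall>r\<in>{0..1}. \<bar>w r - w' r\<bar> < w 1)"
    using admissible_stable[OF ad w w1] by blast
  obtain a0 where a0: "0 < a0" "\<And>a t x. a0 < a \<Longrightarrow> t \<in> {0..1} \<Longrightarrow> x \<in> {0..1} \<Longrightarrow>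
    \<bar>K l a t x - hom finf l t x\<bar> \<le> d"
    using K_near_infinity[OF l(1) d] by blast
  show thesis
  proof (rule that[OF a0(1)])
    fix a u assume a: "a0 < a" and u: "sol l a u"
    have ap: "0 < a" using a a0(1) by simp
    have "\<forall>t\<in>{0..1}. \<forall>x\<in>{0..1}. 0 \<le> K l a t x \<and> \<bar>K l a t x - hom finf l t x\<bar> \<le> d"
      using a0(2)[OF a] K_nonneg[OF l(1)] by blast
    from stable[THEN spec, of "K l a", THEN spec, of "\<lambda>r. u r / a", THEN mp, OF this]
    have "\<forall>r\<in>{0..1}. \<bar>w r - u r / a\<bar> < w 1"
      using sol_normalise[OF u] by blast
    then have "\<bar>w 1 - u 1 / a\<bar> < w 1" by simp
    then have "0 < u 1 / a" by linarith
    then show "0 < u 1" using ap by (simp add: zero_less_divide_iff)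
  qed
qed

text \<open>A source of at most b < 1 gives slope at most b^q < 1, too little to bring w from 1 down
  to 0 over an interval of length 1.\<close>

lemma slope_le_one_integral:
  assumes pr: "profile \<psi> w" and w0: "w 0 = 1" and b: "\<And>t. t \<in> {0..1} \<Longrightarrow> \<psi> t \<le> b" and b1: "0 \<le> b" "b < 1"
  shows "0 < w 1"
proof -
  have "integral {0..1} (slope \<psi>) \<le> integral {0..1} (\<lambda>_::real. b powr q)"
  proof (rule integral_le)
    show "slope \<psi> integrable_on {0..1}"
      by (intro integrable_continuous_real profile_continuous_slope[OF pr])
    fix s :: real assume s: "s \<in> {0..1}"
    have "\<bar>rmean \<psi> s\<bar> \<le> b"
      using s b profileD(2)[OF pr] by (intro rmean_abs_le profileD(1)[OF pr]) auto
    then have "s * rmean \<psi> s \<le> 1 * b" using s b1 by (intro mult_mono') (auto intro: rmean_nonneg profileD[OF pr])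
    moreover have "0 \<le> s * rmean \<psi> s" using s rmean_nonneg[OF profileD(1)[OF pr] s profileD(2)[OF pr]] by simp
    ultimately show "slope \<psi> s \<le> b powr q"
      unfolding slope_def using q_pos by (intro powr_mono2) auto
  qed auto
  also have "\<dots> = b powr q" by simp
  also have "\<dots> < 1 powr q" using b1 q_pos by (intro powr_less_mono2) auto
  finally show ?thesis using profileD(3)[OF pr, of 1] w0 by simp
qed

text \<open>Here \<open>K l a\<close> tends to 0 uniformly as a grows; 1/2 stands for any positive
  bound below 1.\<close>

lemma sol_large_sublinear:
  assumes zero: "\<And>t. t \<in> {0..1} \<Longrightarrow> finf t = 0" and l: "0 < l"
  obtains a0 where "0 < a0" "\<And>a u. a0 < a \<Longrightarrow> sol l a u \<Longrightarrow> 0 < u 1"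
proof -
  obtain a0 where a0: "0 < a0" "\<And>a t x. a0 < a \<Longrightarrow> t \<in> {0..1} \<Longrightarrow> x \<in> {0..1} \<Longrightarrow>
    \<bar>K l a t x - hom finf l t x\<bar> \<le> 1 / 2"
    using K_near_infinity[OF l, of "1 / 2"] by auto
  show thesis
  proof (rule that[OF a0(1)])
    fix a u assume a: "a0 < a" and u: "sol l a u"
    have ap: "0 < a" using a a0(1) by simp
    have "0 < u 1 / a"
    proof (rule slope_le_one_integral[OF sol_normalise(2)[OF u] sol_normalise(1)[OF u], of "1/2"])
      show "K l a t (cut01 (u t / a)) \<le> 1 / 2" if "t \<in> {0..1}" for t
        using a0(2)[OF a that cut01_mem[of "u t / a"]] zero[OF that] by (simp add: hom_def)
    qed auto
    then show "0 < u 1" using ap by (simp add: zero_less_divide_iff)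
  qed
qed

text \<open>For fixed a, g(., a) has a positive lower bound c, so l g exceeds l0 f0 once l > l0 B /
  c. This drives the blow-up of the norm when the right end of the interval is infinite.\<close>

lemma sol_neg_large_lambda:
  assumes l0: "0 < l0" and v: "eigenprofile f0 l0 v" and a: "0 < a"
  obtains l1 where "0 < l1" "\<And>l u. l1 < l \<Longrightarrow> sol l a u \<Longrightarrow> u 1 < 0"
proof -
  have "continuous_on {0..1} (\<lambda>t. h t a / a powr (p - 1))"
    using a by (intro continuous_intros continuous_h_comp) auto
  then have cg: "continuous_on {0..1} (\<lambda>t. g t a)" using a by (simp add: h_eq g_def)
  obtain c where c: "0 < c" "\<And>t. t \<in> {0..1} \<Longrightarrow> c \<le> g t a"
    by (rule continuous_on_01_pos_bound[OF cg]) (auto intro: g_pos a)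
  obtain B where B: "0 < B" "\<And>t. t \<in> {0..1} \<Longrightarrow> \<bar>f0 t\<bar> \<le> B"
    using continuous_on_01_bound[OF f0_cont] by blast
  show thesis
  proof (rule that[of "l0 * B / c"])
    show pos: "0 < l0 * B / c" using l0 B c by simp
    fix l u assume l: "l0 * B / c < l" and u: "sol l a u"
    have l': "0 < l" using l pos by linarith
    show "u 1 < 0"
    proof (rule sol_neg[OF l0 v u])
      fix t :: real assume t: "t \<in> {0..1}"
      have "l0 * f0 t \<le> l0 * B" using l0 B(2)[OF t] by (intro mult_left_mono) auto
      also have "\<dots> < l * c" using l c by (simp add: field_simps)
      also have "\<dots> \<le> l * g t a" using l' c(2)[OF t] by (intro mult_left_mono) auto
      finally show "l0 * f0 t < l * g t a" .
    qed
  qed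
qed

end

section \<open>Uniqueness of an upward crossing\<close>

lemma unique_crossing:
  fixes s :: "real \<Rightarrow> real"
  assumes c: "continuous_on {0<..} s"
    and neg: "0 < a0" "\<And>a. 0 < a \<Longrightarrow> a < a0 \<Longrightarrow> s a < 0"
    and pos: "\<And>a. a1 < a \<Longrightarrow> 0 < s a"
    and cross: "\<And>a. 0 < a \<Longrightarrow> s a = 0 \<Longrightarrow>
      \<exists>d>0. \<forall>b>0. \<bar>b - a\<bar> < d \<longrightarrow> (b < a \<longrightarrow> s b < 0) \<and> (a < b \<longrightarrow> 0 < s b)"
  shows "\<exists>z>0. s z = 0 \<and> (\<forall>a. 0 < a \<and> a < z \<longrightarrow> s a < 0) \<and> (\<forall>a>z. 0 < s a)"
proof -
  have sub: "continuous_on {a..b} s" if "0 < a" for a b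
    by (rule continuous_on_subset[OF c]) (use that in auto)
  have up: "0 < s b" if ab: "0 < a" "a < b" "0 < s a" for a b
  proof (rule ccontr)
    assume "\<not> 0 < s b"
    then have "s b \<le> 0" by simp
    then obtain \<rho> where \<rho>: "a < \<rho>" "s \<rho> = 0" "\<And>x. a \<le> x \<Longrightarrow> x < \<rho> \<Longrightarrow> 0 < s x"
      using first_nonpos[OF sub[OF ab(1)] ab(3) _ less_imp_le[OF ab(2)]] by blast
    have "0 < \<rho>" using \<rho>(1) ab(1) by simp
    from cross[OF this \<rho>(2)] obtain d where d: "0 < d"
      "\<And>b. 0 < b \<Longrightarrow> \<bar>b - \<rho>\<bar> < d \<Longrightarrow> b < \<rho> \<Longrightarrow> s b < 0" by blast
    \<comment> \<open>A point of [a,\<rho>) within d of \<rho>: s is positive there since \<rho> is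
      the first zero after a, and negative by the crossing direction at \<rho>.\<close>
    define x where "x = max a (\<rho> - d / 2)"
    have "a \<le> x" "x < \<rho>" "0 < x" "\<bar>x - \<rho>\<bar> < d" using \<rho>(1) ab(1) d(1) by (auto simp: x_def)
    then show False using \<rho>(3)[of x] d(2)[of x] by simp
  qed
  define x0 where "x0 = a0 / 2"
  define x1 where "x1 = max a1 x0 + 1"
  have x0: "0 < x0" "s x0 < 0" using neg by (auto simp: x0_def)
  have x1: "0 < s x1" "x0 \<le> x1" by (auto simp: x1_def intro: pos)
  obtain z where z: "x0 \<le> z" "z \<le> x1" "s z = 0"
    using IVT'[of s x0 0 x1] x0 x1 sub[OF x0(1)] by (auto simp: less_imp_le)
  have z0: "0 < z" using z x0 by simp
  from cross[OF z0 z(3)] obtain d where d: "0 < d"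
    "\<And>b. 0 < b \<Longrightarrow> \<bar>b - z\<bar> < d \<Longrightarrow> z < b \<Longrightarrow> 0 < s b" by blast
  have gt: "0 < s a" if a: "z < a" for a
  proof -
    define x where "x = min ((z + a) / 2) (z + d / 2)"
    have x: "z < x" "x < a" "\<bar>x - z\<bar> < d" "0 < x" using a d(1) z0 by (auto simp: x_def min_def)
    show ?thesis by (rule up[OF x(4,2) d(2)[OF x(4,3,1)]])
  qed
  have lt: "s a < 0" if a: "0 < a" "a < z" for a
  proof (rule ccontr)
    assume "\<not> s a < 0"
    then consider "0 < s a" | "s a = 0" by linarith
    then show False
    proof cases
      case 1
      then show False using up[OF a] z(3) by simp
    next
      case 2
      from cross[OF a(1) 2] obtain d where d: "0 < d"
        "\<And>b. 0 < b \<Longrightarrow> \<bar>b - a\<bar> < d \<Longrightarrow> a < b \<Longrightarrow> 0 < s b" by blast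
      define x where "x = min ((a + z) / 2) (a + d / 2)"
      have x: "a < x" "x < z" "\<bar>x - a\<bar> < d" "0 < x" using a d(1) by (auto simp: x_def min_def)
      show False using up[OF x(4,2) d(2)[OF x(4,3,1)]] z(3) by simp
    qed
  qed
  show ?thesis using z0 z(3) gt lt by blast
qed

section \<open>Continuous functions on the unit interval as bounded continuous functions\<close>

definition bcf :: "(real \<Rightarrow> real) \<Rightarrow> (real \<Rightarrow>\<^sub>C real)" where
  "bcf g = (SOME v. v \<in> C0_01 \<and> (\<forall>r\<in>{0..1}. apply_bcontfun v r = g r))"

lemma bcf_props:
  assumes "continuous_on {0..1} g"
  shows "bcf g \<in> C0_01" "\<And>r. r \<in> {0..1} \<Longrightarrow> apply_bcontfun (bcf g) r = g r"
proof -
  have "\<exists>v. v \<in> C0_01 \<and> (\<forall>r\<in>{0..1}. apply_bcontfun v r = g r)"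
    using C0_01_extension[OF assms] by blast
  from someI_ex[OF this] show "bcf g \<in> C0_01" "\<And>r. r \<in> {0..1} \<Longrightarrow> apply_bcontfun (bcf g) r = g r"
    unfolding bcf_def by blast+
qed

lemma bcf_clamp:
  assumes "continuous_on {0..1} g"
  shows "apply_bcontfun (bcf g) r = g (clamp 0 1 r)"
proof -
  have "apply_bcontfun (bcf g) r = apply_bcontfun (bcf g) (clamp 0 1 r)"
    using bcf_props(1)[OF assms] unfolding C0_01_def by blast
  then show ?thesis using bcf_props(2)[OF assms clamp01_mem] by simp
qed

lemma bcf_tendsto:
  assumes lim: "uniform_limit {0..1} gs g F"
    and c: "eventually (\<lambda>i. continuous_on {0..1} (gs i)) F" "continuous_on {0..1} g"
  shows "((\<lambda>i. bcf (gs i)) \<longlongrightarrow> bcf g) F"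
proof (rule tendstoI)
  fix e :: real assume "0 < e"
  then have "0 < e / 2" by simp
  from uniform_limitD[OF lim this] c(1)
  show "\<forall>\<^sub>F i in F. dist (bcf (gs i)) (bcf g) < e"
  proof eventually_elim
    case (elim i)
    have "dist (bcf (gs i)) (bcf g) \<le> e / 2"
    proof (rule dist_bound)
      show "dist (apply_bcontfun (bcf (gs i)) x) (apply_bcontfun (bcf g) x) \<le> e / 2" for x
        using bspec[OF elim(1) clamp01_mem[of x]] by (simp add: bcf_clamp elim(2) c(2))
    qed
    then show ?case using \<open>0 < e\<close> by simp
  qed
qed

lemma bcf_diff_eq_scaleR:
  assumes "continuous_on {0..1} g1" "continuous_on {0..1} g2" "continuous_on {0..1} k"
    and "\<And>r. r \<in> {0..1} \<Longrightarrow> g2 r - g1 r = c * k r"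
  shows "bcf g2 - bcf g1 = c *\<^sub>R bcf k"
  by (rule bcontfun_eqI) (simp add: bcf_clamp assms(1-3) assms(4)[OF clamp01_mem])

text \<open>Caratheodory's form of differentiability: E x y is a difference quotient that extends
  continuously to y = x, so the diagonal is the derivative and its continuity gives C^1.\<close>

lemma C1_differentiable_onI_quotient:
  fixes u :: "real \<Rightarrow> 'b::real_normed_vector"
  assumes J: "open J"
    and quot: "\<And>x. x \<in> J \<Longrightarrow> eventually (\<lambda>y. u y - u x = (y - x) *\<^sub>R E x y) (at x)"
    and lim: "\<And>x. x \<in> J \<Longrightarrow> (E x \<longlongrightarrow> E x x) (at x)"
    and diag: "continuous_on J (\<lambda>x. E x x)"
  shows "u C1_differentiable_on J"
  unfolding C1_differentiable_on_def
proof (intro exI conjI ballI)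
  fix x assume x: "x \<in> J"
  show "(u has_vector_derivative E x x) (at x)"
    unfolding has_vector_derivative_def
  proof (rule has_derivativeI)
    have "((\<lambda>y. norm (E x y - E x x)) \<longlongrightarrow> 0) (at x)"
      using tendsto_diff[OF lim[OF x] tendsto_const[of "E x x"]] by (intro tendsto_norm_zero) simp
    moreover have "eventually (\<lambda>y. norm (E x y - E x x)
        = norm (((u y - u x) - (y - x) *\<^sub>R E x x) /\<^sub>R norm (y - x))) (at x)"
      using quot[OF x] eventually_neq_at_within[of x x UNIV]
    proof eventually_elim
      case (elim y)
      have "(u y - u x) - (y - x) *\<^sub>R E x x = (y - x) *\<^sub>R (E x y - E x x)"
        unfolding elim(1) by (simp add: scaleR_right_diff_distrib)
      moreover have "\<bar>inverse \<bar>y - x\<bar> * (y - x)\<bar> = 1" using elim(2) by (simp add: abs_mult)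
      ultimately show ?case by simp
    qed
    ultimately have "((\<lambda>y. norm (((u y - u x) - (y - x) *\<^sub>R E x x) /\<^sub>R norm (y - x))) \<longlongrightarrow> 0) (at x)"
      by (rule Lim_transform_eventually)
    then show "((\<lambda>y. ((u y - u x) - (y - x) *\<^sub>R E x x) /\<^sub>R norm (y - x)) \<longlongrightarrow> 0) (at x)"
      by (rule tendsto_norm_zero_cancel)
  qed (rule bounded_linear_scaleR_left)
qed (rule diag)

context bvp
begin

section \<open>The solution curve\<close>

definition U :: "real \<Rightarrow> real \<Rightarrow> real \<Rightarrow> real" where "U l a = (SOME u. sol l a u)"
definition S :: "real \<Rightarrow> real \<Rightarrow> real" where "S l a = U l a 1"

lemma sol_U: "0 < l \<Longrightarrow> 0 < a \<Longrightarrow> sol l a (U l a)"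
  unfolding U_def by (metis sol_exists someI_ex)

text \<open>The constant family u consists of solutions with convergent data, so it converges to
  v.\<close>

lemma sol_unique:
  assumes "sol l a u" "sol l a v" "r \<in> {0..1}"
  shows "u r = v r"
proof -
  have "uniform_limit {0..1} (\<lambda>i::nat. u) v sequentially"
    by (rule sol_limit[OF tendsto_const tendsto_const _ assms(2)]) (simp add: assms(1))
  from tendsto_uniform_limitI[OF this assms(3)] show ?thesis
    by (simp add: LIMSEQ_const_iff)
qed

lemma U_uniform_limit:
  assumes "(ls \<longlongrightarrow> l) F" "0 < l" "(as \<longlongrightarrow> a) F" "0 < a"
  shows "uniform_limit {0..1} (\<lambda>i. U (ls i) (as i)) (U l a) F"
proof (rule sol_limit[OF assms(1,3) _ sol_U[OF assms(2,4)]])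
  show "eventually (\<lambda>i. sol (ls i) (as i) (U (ls i) (as i))) F"
    using order_tendstoD(1)[OF assms(1,2)] order_tendstoD(1)[OF assms(3,4)]
    by eventually_elim (rule sol_U)
qed

lemma S_tendsto:
  assumes "(ls \<longlongrightarrow> l) F" "0 < l" "(as \<longlongrightarrow> a) F" "0 < a"
  shows "((\<lambda>i. S (ls i) (as i)) \<longlongrightarrow> S l a) F"
  unfolding S_def by (rule tendsto_uniform_limitI[OF U_uniform_limit[OF assms]]) simp

text \<open>As S l a = 0, the difference formula reads S l b = (b - a) Y(1), where Y(1) is close to
  its diagonal value and that value is positive by \<open>Ysol_pos\<close>.\<close>

lemma S_crossing:
  assumes l: "0 < l" and a: "0 < a" and zero: "S l a = 0"
  shows "0 < Ysol l (U l a) l (U l a) 1"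
    "\<exists>d>0. \<forall>b>0. \<bar>b - a\<bar> < d \<longrightarrow> (b < a \<longrightarrow> S l b < 0) \<and> (a < b \<longrightarrow> 0 < S l b)"
proof -
  obtain \<delta> \<epsilon> where \<delta>: "0 < \<delta>" "0 < \<epsilon>" "\<forall>t\<in>{1 - \<delta><..1}. \<forall>x\<in>{0<..<\<epsilon>}. f' t x * x < (p - 1) * f t x"
    using H3_strict by blast
  have U1: "U l a 1 = 0" using zero by (simp add: S_def)
  show Y: "0 < Ysol l (U l a) l (U l a) 1"
    by (rule Ysol_pos[OF sol_U[OF l a] U1 H3 \<delta>(1,2)]) (use \<delta>(3) in auto)
  have ev: "eventually (\<lambda>b. sol l b (U l b)) (at a)"
    using order_tendstoD(1)[OF tendsto_ident_at a] by eventually_elim (rule sol_U[OF l])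
  have "uniform_limit {0..1} (\<lambda>b. Ysol l (U l a) l (U l b)) (Ysol l (U l a) l (U l a)) (at a)"
    by (rule Ysol_Zsol_limit(1)[OF tendsto_const tendsto_const tendsto_const tendsto_ident_at _ ev
          sol_U[OF l a]])
       (simp add: sol_U[OF l a])
  from tendsto_uniform_limitI[OF this, of 1]
  have "((\<lambda>b. Ysol l (U l a) l (U l b) 1) \<longlongrightarrow> Ysol l (U l a) l (U l a) 1) (at a)" by simp
  from order_tendstoD(1)[OF this Y] obtain d where d: "0 < d"
    "\<And>b. b \<noteq> a \<Longrightarrow> dist b a < d \<Longrightarrow> 0 < Ysol l (U l a) l (U l b) 1"
    unfolding eventually_at by auto
  show "\<exists>d>0. \<forall>b>0. \<bar>b - a\<bar> < d \<longrightarrow> (b < a \<longrightarrow> S l b < 0) \<and> (a < b \<longrightarrow> 0 < S l b)"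
  proof (intro exI[of _ d] conjI allI impI)
    fix b assume b: "0 < b" "\<bar>b - a\<bar> < d"
    have eq: "S l b = (b - a) * Ysol l (U l a) l (U l b) 1"
      using sol_difference[OF sol_U[OF l a] sol_U[OF l b(1)], of 1] U1 by (simp add: S_def)
    show "S l b < 0" if "b < a"
      unfolding eq using d(2)[of b] b that by (intro mult_neg_pos) (auto simp: dist_real_def)
    show "0 < S l b" if "a < b"
      unfolding eq using d(2)[of b] b that by (intro mult_pos_pos) (auto simp: dist_real_def)
  qed (rule d(1))
qed

end

section \<open>The curve of zeros of the shooting function\<close>

text \<open>The assumptions are the signs of \<open>S\<close> that both cases of (H6) share;
  \<open>linf\<close> is an extended real so that a finite and an infinite right end are treated
  together.\<close>

locale branch = bvp +
  fixes l0 :: real and linf :: ereal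
  assumes l0_pos: "0 < l0"
    and S_l0: "\<And>a. 0 < a \<Longrightarrow> 0 < S l0 a"
    and S_small: "\<And>l. l0 < l \<Longrightarrow> \<exists>a0>0. \<forall>a. 0 < a \<and> a < a0 \<longrightarrow> S l a < 0"
    and S_large: "\<And>l. l0 < l \<Longrightarrow> ereal l < linf \<Longrightarrow> \<exists>a1. \<forall>a>a1. 0 < S l a"
    and S_linf: "\<And>a. 0 < a \<Longrightarrow> \<exists>b. ereal b < linf \<and> (\<forall>l>b. 0 < l \<and> ereal l < linf \<longrightarrow> S l a < 0)"
begin

abbreviation "J \<equiv> einterval (ereal l0) linf"

lemma J_pos: "l \<in> J \<Longrightarrow> l0 < l" "l \<in> J \<Longrightarrow> ereal l < linf" "l \<in> J \<Longrightarrow> 0 < l"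
  using l0_pos by (auto simp: einterval_iff)

definition alpha :: "real \<Rightarrow> real" where
  "alpha l = (SOME z. 0 < z \<and> S l z = 0 \<and> (\<forall>a. 0 < a \<and> a < z \<longrightarrow> S l a < 0) \<and> (\<forall>a>z. 0 < S l a))"

lemma alpha:
  assumes l: "l \<in> J"
  shows "0 < alpha l" "S l (alpha l) = 0" "\<And>a. 0 < a \<Longrightarrow> a < alpha l \<Longrightarrow> S l a < 0"
    "\<And>a. alpha l < a \<Longrightarrow> 0 < S l a"
proof -
  note lJ = J_pos[OF l]
  obtain a0 where a0: "0 < a0" "\<And>a. 0 < a \<Longrightarrow> a < a0 \<Longrightarrow> S l a < 0" using S_small[OF lJ(1)] by blast
  obtain a1 where a1: "\<And>a. a1 < a \<Longrightarrow> 0 < S l a" using S_large[OF lJ(1,2)] by blast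
  have c: "continuous_on {0<..} (S l)"
    unfolding continuous_on_def
    by (auto intro!: S_tendsto tendsto_const tendsto_ident_at lJ)
  have "\<exists>z>0. S l z = 0 \<and> (\<forall>a. 0 < a \<and> a < z \<longrightarrow> S l a < 0) \<and> (\<forall>a>z. 0 < S l a)"
    by (rule unique_crossing[OF c a0 a1 S_crossing(2)[OF lJ(3)]])
  from someI_ex[OF this] show "0 < alpha l" "S l (alpha l) = 0" "\<And>a. 0 < a \<Longrightarrow> a < alpha l \<Longrightarrow> S l a < 0"
    "\<And>a. alpha l < a \<Longrightarrow> 0 < S l a"
    unfolding alpha_def by blast+
qed

lemma alpha_gt: "l \<in> J \<Longrightarrow> 0 < a \<Longrightarrow> S l a < 0 \<Longrightarrow> a < alpha l"
  using alpha(2)[of l] alpha(4)[of l a] by (metis less_asym linorder_less_linear)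

lemma alpha_lt: "l \<in> J \<Longrightarrow> 0 < a \<Longrightarrow> 0 < S l a \<Longrightarrow> alpha l < a"
  using alpha(2)[of l] alpha(3)[of l a] by (metis less_asym linorder_less_linear)

text \<open>S(l, .) has a strict sign on each side of its zero, and the sign at a fixed a survives
  small changes of l; so a stays on the same side of the zero.\<close>

lemma alpha_tendsto:
  assumes l: "l \<in> J" and lim: "(ls \<longlongrightarrow> l) F" and ev: "eventually (\<lambda>i. ls i \<in> J) F"
  shows "((\<lambda>i. alpha (ls i)) \<longlongrightarrow> alpha l) F"
proof (rule order_tendstoI)
  note lJ = J_pos[OF l]
  fix a assume a: "a < alpha l"
  show "\<forall>\<^sub>F i in F. a < alpha (ls i)"
  proof (cases "0 < a")
    case True
    have "\<forall>\<^sub>F i in F. S (ls i) a < 0"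
      by (rule order_tendstoD(2)[OF S_tendsto[OF lim lJ(3) tendsto_const True] alpha(3)[OF l True a]])
    then show ?thesis using ev by eventually_elim (rule alpha_gt[OF _ True])
  next
    case False
    show ?thesis using ev
    proof eventually_elim
      case (elim i)
      then show ?case using alpha(1)[OF elim] False by simp
    qed
  qed
next
  note lJ = J_pos[OF l]
  fix a assume a: "alpha l < a"
  then have a0: "0 < a" using alpha(1)[OF l] by simp
  have "\<forall>\<^sub>F i in F. 0 < S (ls i) a"
    by (rule order_tendstoD(1)[OF S_tendsto[OF lim lJ(3) tendsto_const a0] alpha(4)[OF l a]])
  then show "\<forall>\<^sub>F i in F. alpha (ls i) < a" using ev by eventually_elim (rule alpha_lt[OF _ a0])
qed

text \<open>S is positive at l0 for every a > 0, hence also at nearby l, which forces alpha l <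
  a.\<close>

lemma alpha_tendsto_0: "(alpha \<longlongrightarrow> 0) (at_right l0)"
  if "ereal l0 < linf"
proof (rule order_tendstoI)
  have "\<exists>b>l0. \<forall>y. l0 < y \<and> y < b \<longrightarrow> y \<in> J"
  proof (cases linf)
    case (real r)
    then show ?thesis using that by (intro exI[of _ r]) (auto simp: einterval_iff)
  qed (use that in \<open>auto simp: einterval_iff intro: exI[of _ "l0 + 1"]\<close>)
  then have inJ: "eventually (\<lambda>l. l \<in> J) (at_right l0)"
    unfolding eventually_at_right_field by blast
  fix a :: real
  { assume "a < 0"
    show "\<forall>\<^sub>F l in at_right l0. a < alpha l"
      using inJ
    proof eventually_elim
      case (elim l)
      then show ?case using alpha(1)[OF elim] \<open>a < 0\<close> by simp
    qed }
  { assume a: "0 < a"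
    have "\<forall>\<^sub>F l in at_right l0. 0 < S l a"
      by (rule order_tendstoD(1)[OF S_tendsto[OF tendsto_ident_at l0_pos tendsto_const a] S_l0[OF a]])
    then show "\<forall>\<^sub>F l in at_right l0. alpha l < a" using inJ by eventually_elim (rule alpha_lt[OF _ a]) }
qed

definition V :: "real \<Rightarrow> real \<Rightarrow> real" where "V l = U l (alpha l)"

lemma sol_V: "l \<in> J \<Longrightarrow> sol l (alpha l) (V l)"
  unfolding V_def by (intro sol_U J_pos alpha)

lemma V_props:
  assumes l: "l \<in> J"
  shows "continuous_on {0..1} (V l)" "V l 0 = alpha l" "V l 1 = 0"
    "\<And>r. 0 \<le> r \<Longrightarrow> r < 1 \<Longrightarrow> 0 < V l r" "\<And>r. r \<in> {0..1} \<Longrightarrow> V l r \<le> alpha l"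
    "profile (\<lambda>t. l * h t (V l t)) (V l)"
proof -
  note V = sol_V[OF l]
  show c: "continuous_on {0..1} (V l)" by (rule sol_continuous[OF V])
  show V0: "V l 0 = alpha l" using V by (simp add: sol_def)
  show V1: "V l 1 = 0" using alpha(2)[OF l] by (simp add: V_def S_def)
  show pr: "profile (\<lambda>t. l * h t (V l t)) (V l)" using V by (simp add: sol_def)
  show "0 < V l r" if "0 \<le> r" "r < 1" for r
    by (rule sol_pos_before_1[OF V _ that]) (simp add: V1)
  show "V l r \<le> alpha l" if "r \<in> {0..1}" for r
    using profile_antimono[OF pr, of 0 r] that V0 by simp
qed

text \<open>The difference quotient of the curve: since both solutions vanish at 1, the quotient of
  the differences of alpha and \<lambda> is -Z(1)/Y(1), which is inserted into the difference
  formula.\<close>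

definition E :: "real \<Rightarrow> real \<Rightarrow> real \<Rightarrow> real" where
  "E l1 l2 r = Zsol l1 (V l1) l2 (V l2) r
     + - (Zsol l1 (V l1) l2 (V l2) 1 / Ysol l1 (V l1) l2 (V l2) 1) * Ysol l1 (V l1) l2 (V l2) r"

lemma continuous_E:
  assumes "l1 \<in> J" "l2 \<in> J"
  shows "continuous_on {0..1} (E l1 l2)"
proof -
  note YZ = Ysol_Zsol[OF sol_V[OF assms(1)] sol_V[OF assms(2)]]
  show ?thesis
    unfolding E_def
    by (intro continuous_on_add continuous_on_mult continuous_on_const
        linear_solutionD(3)[OF YZ(1)] linear_solutionD(3)[OF YZ(2)])
qed

lemma Ysol_diag_pos: "l \<in> J \<Longrightarrow> 0 < Ysol l (V l) l (V l) 1"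
  unfolding V_def by (intro S_crossing(1) J_pos alpha)

lemma E_limit:
  assumes l: "l \<in> J" and 1: "(ls1 \<longlongrightarrow> l) F" "eventually (\<lambda>i. ls1 i \<in> J) F"
    and 2: "(ls2 \<longlongrightarrow> l) F" "eventually (\<lambda>i. ls2 i \<in> J) F"
  shows "((\<lambda>i. bcf (E (ls1 i) (ls2 i))) \<longlongrightarrow> bcf (E l l)) F"
    "((\<lambda>i. Ysol (ls1 i) (V (ls1 i)) (ls2 i) (V (ls2 i)) 1) \<longlongrightarrow> Ysol l (V l) l (V l) 1) F"
proof -
  note Vl = sol_V[OF l]
  have s1: "eventually (\<lambda>i. sol (ls1 i) (alpha (ls1 i)) (V (ls1 i))) F"
    using 1(2) by eventually_elim (rule sol_V)
  have s2: "eventually (\<lambda>i. sol (ls2 i) (alpha (ls2 i)) (V (ls2 i))) F"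
    using 2(2) by eventually_elim (rule sol_V)
  note lim = Ysol_Zsol_limit[OF 1(1) alpha_tendsto[OF l 1] 2(1) alpha_tendsto[OF l 2] s1 s2 Vl]
  have one: "(1::real) \<in> {0..1}" by simp
  show Y1: "((\<lambda>i. Ysol (ls1 i) (V (ls1 i)) (ls2 i) (V (ls2 i)) 1) \<longlongrightarrow> Ysol l (V l) l (V l) 1) F"
    by (rule tendsto_uniform_limitI[OF lim(1) one])
  have Z1: "((\<lambda>i. Zsol (ls1 i) (V (ls1 i)) (ls2 i) (V (ls2 i)) 1) \<longlongrightarrow> Zsol l (V l) l (V l) 1) F"
    by (rule tendsto_uniform_limitI[OF lim(2) one])
  have "Ysol l (V l) l (V l) 1 \<noteq> 0" using Ysol_diag_pos[OF l] by simp
  from tendsto_minus[OF tendsto_divide[OF Z1 Y1 this]]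
  have q: "((\<lambda>i. - (Zsol (ls1 i) (V (ls1 i)) (ls2 i) (V (ls2 i)) 1 / Ysol (ls1 i) (V (ls1 i)) (ls2 i) (V (ls2 i)) 1))
      \<longlongrightarrow> - (Zsol l (V l) l (V l) 1 / Ysol l (V l) l (V l) 1)) F" .
  note cY = linear_solutionD(3)[OF Ysol_Zsol(1)[OF Vl Vl]]
  have ul: "uniform_limit {0..1} (\<lambda>i. E (ls1 i) (ls2 i)) (E l l) F"
    unfolding E_def
    by (intro uniform_limit_add lim(2) uniform_limit_mult01[OF uniform_limit_of_tendsto[OF q] lim(1)]
        continuous_on_const cY)
  have ce: "eventually (\<lambda>i. continuous_on {0..1} (E (ls1 i) (ls2 i))) F"
    using 1(2) 2(2) by eventually_elim (rule continuous_E)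
  show "((\<lambda>i. bcf (E (ls1 i) (ls2 i))) \<longlongrightarrow> bcf (E l l)) F"
    by (rule bcf_tendsto[OF ul ce continuous_E[OF l l]])
qed

lemma V_difference:
  assumes l: "l1 \<in> J" "l2 \<in> J" and Y: "Ysol l1 (V l1) l2 (V l2) 1 \<noteq> 0"
  shows "bcf (V l2) - bcf (V l1) = (l2 - l1) *\<^sub>R bcf (E l1 l2)"
proof (rule bcf_diff_eq_scaleR[OF V_props(1)[OF l(1)] V_props(1)[OF l(2)] continuous_E[OF l]])
  note diff = sol_difference[OF sol_V[OF l(1)] sol_V[OF l(2)]]
  let ?Y = "Ysol l1 (V l1) l2 (V l2)" and ?Z = "Zsol l1 (V l1) l2 (V l2)"
  have "0 = (alpha l2 - alpha l1) * ?Y 1 + (l2 - l1) * ?Z 1"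
    using diff[of 1] V_props(3)[OF l(1)] V_props(3)[OF l(2)] by simp
  define c where "c = - (?Z 1 / ?Y 1)"
  have "alpha l2 - alpha l1 = (l2 - l1) * c"
    using \<open>0 = _\<close> Y by (simp add: c_def field_simps)
  moreover have "E l1 l2 r = ?Z r + c * ?Y r" for r
    by (simp only: E_def c_def)
  ultimately show "V l2 r - V l1 r = (l2 - l1) * E l1 l2 r" if "r \<in> {0..1}" for r
    using diff[OF that] by (simp only: distrib_left mult.assoc add.commute)
qed

lemma V_C1: "(\<lambda>l. bcf (V l)) C1_differentiable_on J"
proof (rule C1_differentiable_onI_quotient[where E = "\<lambda>x y. bcf (E x y)"])
  show "open J" by simp
  fix l assume l: "l \<in> J"
  have ev: "eventually (\<lambda>y. y \<in> J) (at l)"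
    using l by (simp add: eventually_at_in_open')
  have cl: "eventually (\<lambda>y. l \<in> J) (at l)" using l by simp
  note lim = E_limit[OF l tendsto_const cl tendsto_ident_at ev]
  show "((\<lambda>y. bcf (E l y)) \<longlongrightarrow> bcf (E l l)) (at l)" by (rule lim(1))
  \<comment> \<open>The diagonal value of Y at 1 is positive, so Y(1) is nonzero for y near l and
    the quotient formula is valid there.\<close>
  show "eventually (\<lambda>y. bcf (V y) - bcf (V l) = (y - l) *\<^sub>R bcf (E l y)) (at l)"
    using ev order_tendstoD(1)[OF lim(2) Ysol_diag_pos[OF l]]
  proof eventually_elim
    case (elim y)
    then show ?case by (intro V_difference l) auto
  qed
next
  show "continuous_on J (\<lambda>x. bcf (E x x))"
    unfolding continuous_on_def
  proof
    fix l assume l: "l \<in> J"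
    have ev: "eventually (\<lambda>y. y \<in> J) (at l within J)" by (simp add: eventually_at_filter)
    show "((\<lambda>x. bcf (E x x)) \<longlongrightarrow> bcf (E l l)) (at l within J)"
      by (rule E_limit(1)[OF l tendsto_ident_at ev tendsto_ident_at ev])
  qed
qed

text \<open>Profiles are largest at the centre, so both limits of the norm reduce to limits of
  alpha.\<close>

lemma norm_V:
  assumes l: "l \<in> J"
  shows "norm (bcf (V l)) = alpha l"
proof (rule antisym)
  note Vp = V_props[OF l]
  show "norm (bcf (V l)) \<le> alpha l"
  proof (rule norm_bound)
    fix x :: real
    have m: "clamp 0 1 x \<in> {0..1::real}" by (rule clamp01_mem)
    have "0 \<le> V l (clamp 0 1 x)"
      using Vp(3) Vp(4)[of "clamp 0 1 x"] m by (cases "clamp 0 1 x = (1::real)") auto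
    then show "norm (apply_bcontfun (bcf (V l)) x) \<le> alpha l"
      using Vp(5)[OF m] by (simp add: bcf_clamp Vp(1))
  qed
  have "alpha l = norm (apply_bcontfun (bcf (V l)) 0)"
    using bcf_props(2)[OF Vp(1), of 0] Vp(2) alpha(1)[OF l] by simp
  also have "\<dots> \<le> norm (bcf (V l))" by (rule norm_bounded)
  finally show "alpha l \<le> norm (bcf (V l))" .
qed

lemma profile_cong_fun:
  assumes pr: "profile \<psi> u" and eq: "\<And>r. r \<in> {0..1} \<Longrightarrow> v r = u r"
  shows "profile \<psi> v"
proof -
  have "v r = v 0 - integral {0..r} (slope \<psi>)" if "r \<in> {0..1}" for r
    using profileD(3)[OF pr that] eq[OF that] eq[of 0] by simp
  then show ?thesis
    using profileD(1,2)[OF pr] unfolding profile_def slope_def[abs_def] by blast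
qed

lemma bcf_V_solution:
  assumes l: "l \<in> J"
  shows "is_solution N p f l (apply_bcontfun (bcf (V l)))" "apply_bcontfun (bcf (V l)) \<in> X p"
proof -
  note Vp = V_props[OF l] and b = bcf_props(2)[OF V_props(1)[OF l]]
  have nonneg: "0 \<le> V l r" if "r \<in> {0..1}" for r
    using Vp(3) Vp(4)[of r] that by (cases "r = 1") auto
  have pr: "profile (\<lambda>t. l * h t (V l t)) (apply_bcontfun (bcf (V l)))"
    by (rule profile_cong_fun[OF Vp(6) b])
  have b1: "apply_bcontfun (bcf (V l)) 1 = 0" using b[of 1] Vp(3) by simp
  have eq: "l * h r (V l r) = l * f r (apply_bcontfun (bcf (V l)) r)" if "r \<in> {0..1}" for r
    using b[OF that] nonneg[OF that] by (simp add: h_eq)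
  show "is_solution N p f l (apply_bcontfun (bcf (V l)))" "apply_bcontfun (bcf (V l)) \<in> X p"
    by (rule profile_is_solution[where g = f and \<mu> = l, OF pr b1 eq]; assumption)+
qed

text \<open>A solution decreases to v(1) = 0, so it is nonnegative, and a non-trivial one has v(0) >
  0. Along it f agrees with \<open>h\<close>, hence v(0) is a zero of S l, and alpha l is the only
  one.\<close>

lemma solution_unique:
  assumes l: "l \<in> J" and v: "is_solution N p f l v" and nt: "nontrivial01 v" and r: "r \<in> {0..1}"
  shows "v r = V l r"
proof -
  note lp = J_pos(3)[OF l]
  have C1: "C1_01 v" and v1: "v 1 = 0" using v by (auto simp: is_solution_def)
  have "continuous_on {0..1} (\<lambda>t. (\<lambda>(t, x). f t x) (t, v t))"
    by (rule continuous_on_compose2[OF f_cont]) (auto intro!: continuous_intros C1_01_continuous[OF C1])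
  then have "continuous_on {0..1} (\<lambda>t. f t (v t))" by simp
  from continuous_on_mult[OF continuous_on_const this]
  have c: "continuous_on {0..1} (\<lambda>t. l * f t (v t))" .
  have pr: "profile (\<lambda>t. l * f t (v t)) v"
    using is_solution_imp_profile[OF v c] lp f_nonneg by simp
  have nonneg: "0 \<le> v t" if "t \<in> {0..1}" for t
    using profile_antimono[OF pr, of t 1] that v1 by simp
  obtain s where s: "s \<in> {0..1}" "v s \<noteq> 0" using nt unfolding nontrivial01_def by blast
  have v0: "0 < v 0"
    using profile_antimono[OF pr, of 0 s] nonneg[OF s(1)] s by simp
  have "profile (\<lambda>t. l * h t (v t)) v"
    by (rule profile_cong[OF pr]) (simp add: h_eq nonneg)
  then have sv: "sol l (v 0) v" using lp v0 by (simp add: sol_def)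
  have "S l (v 0) = v 1"
    unfolding S_def by (rule sol_unique[OF sol_U[OF lp v0] sv]) simp
  then have S0: "S l (v 0) = 0" using v1 by simp
  have "\<not> v 0 < alpha l" using alpha(3)[OF l v0] S0 by auto
  moreover have "\<not> alpha l < v 0" using alpha(4)[OF l, of "v 0"] S0 by auto
  ultimately have "v 0 = alpha l" by simp
  then have "sol l (alpha l) v" using sv by simp
  then show ?thesis by (rule sol_unique[OF _ sol_V[OF l] r])
qed

lemma curve_exists:
  assumes less: "ereal l0 < linf"
  shows "\<exists>u :: real \<Rightarrow> (real \<Rightarrow>\<^sub>C real).
      u ` J \<subseteq> C0_01 \<and> u C1_differentiable_on J \<and>
      (\<forall>\<mu>\<in>J.
         apply_bcontfun (u \<mu>) \<in> X p \<and>
         (\<forall>r\<in>{0..<1}. apply_bcontfun (u \<mu>) r > 0) \<and>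
         is_solution N p f \<mu> (apply_bcontfun (u \<mu>)) \<and> nontrivial01 (apply_bcontfun (u \<mu>)) \<and>
         (\<forall>v. is_solution N p f \<mu> v \<and> nontrivial01 v \<longrightarrow>
            (\<forall>r\<in>{0..1}. v r = apply_bcontfun (u \<mu>) r))) \<and>
      ((\<lambda>\<mu>. norm (u \<mu>)) \<longlongrightarrow> 0) (at_right l0) \<and>
      filterlim (\<lambda>x. norm (u (real_of_ereal x))) at_top (at_left linf)"
proof (intro exI[of _ "\<lambda>l. bcf (V l)"] conjI ballI)
  show "(\<lambda>l. bcf (V l)) ` J \<subseteq> C0_01"
    using bcf_props(1)[OF V_props(1)] by blast
  show "(\<lambda>l. bcf (V l)) C1_differentiable_on J" by (rule V_C1)
  fix l assume l: "l \<in> J"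
  note b = bcf_props(2)[OF V_props(1)[OF l]]
  show pos: "0 < apply_bcontfun (bcf (V l)) r" if "r \<in> {0..<1}" for r
    using b[of r] V_props(4)[OF l, of r] that by simp
  show "is_solution N p f l (apply_bcontfun (bcf (V l)))" "apply_bcontfun (bcf (V l)) \<in> X p"
    by (rule bcf_V_solution[OF l])+
  show "nontrivial01 (apply_bcontfun (bcf (V l)))"
    unfolding nontrivial01_def using pos[of 0] by (intro bexI[of _ 0]) auto
  show "\<forall>v. is_solution N p f l v \<and> nontrivial01 v \<longrightarrow> (\<forall>r\<in>{0..1}. v r = apply_bcontfun (bcf (V l)) r)"
    using solution_unique[OF l] b by simp
next
  have "eventually (\<lambda>l. l \<in> J) (at_right l0)"
  proof -
    have "\<exists>b>l0. \<forall>y. l0 < y \<and> y < b \<longrightarrow> y \<in> J"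
    proof (cases linf)
      case (real r)
      then show ?thesis using less by (intro exI[of _ r]) (auto simp: einterval_iff)
    qed (use less in \<open>auto simp: einterval_iff intro: exI[of _ "l0 + 1"]\<close>)
    then show ?thesis unfolding eventually_at_right_field by blast
  qed
  then have "eventually (\<lambda>l. alpha l = norm (bcf (V l))) (at_right l0)"
    by eventually_elim (simp add: norm_V)
  then show "((\<lambda>\<mu>. norm (bcf (V \<mu>))) \<longlongrightarrow> 0) (at_right l0)"
    by (rule Lim_transform_eventually[OF alpha_tendsto_0[OF less]])
next
  show "filterlim (\<lambda>x. norm (bcf (V (real_of_ereal x)))) at_top (at_left linf)"
    unfolding filterlim_at_top_gt[where c = 0]
  proof (intro allI impI)
    fix Z :: real assume Z: "0 < Z"
    \<comment> \<open>S l Z < 0 for l near the right end means alpha l > Z. The left neighbourhood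
      filter on extended reals covers a finite and an infinite end alike.\<close>
    obtain b where b: "ereal b < linf" "\<And>l. b < l \<Longrightarrow> 0 < l \<Longrightarrow> ereal l < linf \<Longrightarrow> S l Z < 0"
      using S_linf[OF Z] by blast
    have "max (ereal b) (ereal l0) < linf" using b(1) less by simp
    then show "\<forall>\<^sub>F x in at_left linf. Z \<le> norm (bcf (V (real_of_ereal x)))"
      unfolding eventually_at_left[OF \<open>max (ereal b) (ereal l0) < linf\<close>]
    proof (intro exI[of _ "max (ereal b) (ereal l0)"] conjI allI impI)
      fix x assume x: "max (ereal b) (ereal l0) < x" "x < linf"
      then obtain l where l: "x = ereal l" by (cases x) auto
      have lJ: "l \<in> J" using x by (simp add: l einterval_iff)
      have "Z < alpha l"
        using x l b(2)[of l] J_pos(3)[OF lJ] by (intro alpha_gt[OF lJ Z]) simp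
      then show "Z \<le> norm (bcf (V (real_of_ereal x)))" using norm_V[OF lJ] by (simp add: l)
    qed
  qed
qed

end

section \<open>The two cases of (H6)\<close>

context bvp
begin

lemma branch_facts:
  assumes l0: "0 < l0" and v: "eigenprofile f0 l0 v"
  shows "\<And>a. 0 < a \<Longrightarrow> 0 < S l0 a"
    "\<And>l. l0 < l \<Longrightarrow> \<exists>a0>0. \<forall>a. 0 < a \<and> a < a0 \<longrightarrow> S l a < 0"
proof -
  show "0 < S l0 a" if "0 < a" for a
    unfolding S_def by (rule sol_at_l0[OF l0 v sol_U[OF l0 that]])
  fix l assume l: "l0 < l"
  obtain a0 where a0: "0 < a0" "\<And>a u. 0 < a \<Longrightarrow> a < a0 \<Longrightarrow> sol l a u \<Longrightarrow> u 1 < 0"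
    using sol_small[OF l0 l v] by blast
  then show "\<exists>a0>0. \<forall>a. 0 < a \<and> a < a0 \<longrightarrow> S l a < 0"
    using sol_U[of l] l0 l unfolding S_def by (intro exI[of _ a0]) auto
qed

lemma branch_asymptotically_linear:
  assumes l0: "0 < l0" and v: "eigenprofile f0 l0 v"
    and pos: "\<And>t. t \<in> {0..1} \<Longrightarrow> 0 < finf t" and li: "0 < li" and w: "eigenprofile finf li w"
  shows "branch N p f f' f0 finf l0 (ereal li)"
proof unfold_locales
  fix l assume l: "l0 < l" "ereal l < ereal li"
  then have l': "0 < l" "l < li" using l0 by auto
  obtain a1 where a1: "0 < a1" "\<And>a u. a1 < a \<Longrightarrow> sol l a u \<Longrightarrow> 0 < u 1"
    using sol_large[OF pos l' w] by blast
  then show "\<exists>a1. \<forall>a>a1. 0 < S l a"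
    using sol_U[OF l'(1)] unfolding S_def by (intro exI[of _ a1]) auto
next
  fix a :: real assume a: "0 < a"
  \<comment> \<open>At the finite right end itself the sign is already strict, so it persists to the
    left by continuity in l.\<close>
  have "S li a < 0"
    unfolding S_def by (rule sol_at_linf[OF pos li w sol_U[OF li a]])
  from order_tendstoD(2)[OF S_tendsto[OF tendsto_ident_at[of li "{..<li}"] li tendsto_const a] this]
  obtain b where "b < li" "\<And>l. b < l \<Longrightarrow> l < li \<Longrightarrow> S l a < 0"
    unfolding eventually_at_left_field by blast
  then show "\<exists>b. ereal b < ereal li \<and> (\<forall>l>b. 0 < l \<and> ereal l < ereal li \<longrightarrow> S l a < 0)"
    by (intro exI[of _ b]) auto
qed (use l0 branch_facts[OF l0 v] in auto)

lemma branch_sublinear: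
  assumes l0: "0 < l0" and v: "eigenprofile f0 l0 v"
    and zero: "\<And>t. t \<in> {0..1} \<Longrightarrow> finf t = 0"
  shows "branch N p f f' f0 finf l0 \<infinity>"
proof unfold_locales
  fix l assume l: "l0 < l"
  then have l': "0 < l" using l0 by simp
  obtain a1 where a1: "0 < a1" "\<And>a u. a1 < a \<Longrightarrow> sol l a u \<Longrightarrow> 0 < u 1"
    using sol_large_sublinear[OF zero l'] by blast
  then show "\<exists>a1. \<forall>a>a1. 0 < S l a"
    using sol_U[OF l'] unfolding S_def by (intro exI[of _ a1]) auto
next
  fix a :: real assume a: "0 < a"
  obtain l1 where l1: "0 < l1" "\<And>l u. l1 < l \<Longrightarrow> sol l a u \<Longrightarrow> u 1 < 0"
    using sol_neg_large_lambda[OF l0 v a] by blast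
  then show "\<exists>b. ereal b < \<infinity> \<and> (\<forall>l>b. 0 < l \<and> ereal l < \<infinity> \<longrightarrow> S l a < 0)"
    using sol_U[OF _ a] unfolding S_def by (intro exI[of _ l1]) auto
qed (use l0 branch_facts[OF l0 v] in auto)

end

section \<open>From sup norm limits to uniform estimates, and the theorem\<close>

lemma sup_norm01_less:
  assumes "continuous_on {0..1} v" "sup_norm01 v < e" "t \<in> {0..1}"
  shows "\<bar>v t\<bar> < e"
proof -
  obtain B where "\<And>t. t \<in> {0..1} \<Longrightarrow> \<bar>v t\<bar> \<le> B"
    using continuous_on_01_bound[OF assms(1)] by blast
  then have "bdd_above ((\<lambda>r. \<bar>v r\<bar>) ` {0..1})" by (intro bdd_aboveI2)
  then have "\<bar>v t\<bar> \<le> sup_norm01 v"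
    unfolding sup_norm01_def by (rule cSUP_upper[OF assms(3)])
  then show ?thesis using assms(2) by simp
qed

lemma sup_norm01_tendsto_0D:
  assumes lim: "((\<lambda>x. sup_norm01 (v x)) \<longlongrightarrow> 0) F"
    and c: "eventually (\<lambda>x. continuous_on {0..1} (v x)) F" and e: "0 < e"
  shows "eventually (\<lambda>x. \<forall>t\<in>{0..1}. \<bar>v x t\<bar> < e) F"
  using order_tendstoD(2)[OF lim e] c by eventually_elim (blast intro: sup_norm01_less)

theorem theorem1:
  fixes N :: nat and p :: real
    and f :: "real \<Rightarrow> real \<Rightarrow> real"
    and f0 f_inf :: "real \<Rightarrow> real"
    and lam0 :: real and lam_inf :: ereal
  assumes N: "N \<ge> 1" and p: "p > 2"
    and f_cont: "continuous_on ({0..} \<times> UNIV) (\<lambda>(r, \<xi>). f r \<xi>)"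
    and H1: "\<forall>r\<in>{0..1}. f r C1_differentiable_on UNIV"
      "continuous_on ({0..1} \<times> UNIV) (\<lambda>(r, \<xi>). deriv (f r) \<xi>)"
    and H2: "\<forall>r\<in>{0..1}. \<forall>\<xi>. \<xi> \<noteq> 0 \<longrightarrow> f r \<xi> > 0"
      "\<forall>r\<in>{0..1}. f r 0 = 0"
    and H3: "\<forall>r\<in>{0..1}. \<forall>\<xi>\<ge>0. (p - 1) * f r \<xi> \<ge> deriv (f r) \<xi> * \<xi>"
      "\<exists>\<delta>>0. \<exists>\<epsilon>>0. \<forall>r\<in>{1 - \<delta><..1}. \<forall>\<xi>\<in>{0<..<\<epsilon>}. (p - 1) * f r \<xi> > deriv (f r) \<xi> * \<xi>"
    and f0_lim: "\<forall>r\<in>{0..1}. ((\<lambda>\<xi>. f r \<xi> / phi p \<xi>) \<longlongrightarrow> f0 r) (at_right 0)"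
      "continuous_on {0..1} f0"
    and f_inf_lim: "\<forall>r\<in>{0..1}. ((\<lambda>\<xi>. f r \<xi> / phi p \<xi>) \<longlongrightarrow> f_inf r) at_top"
      "continuous_on {0..1} f_inf"
    and H4: "((\<lambda>\<xi>. sup_norm01 (\<lambda>r. f r \<xi> / phi p \<xi> - f0 r)) \<longlongrightarrow> 0) (at_right 0)"
      "((\<lambda>\<xi>. sup_norm01 (\<lambda>r. deriv (f r) \<xi> / \<xi> powr (p - 2) - (p - 1) * f0 r)) \<longlongrightarrow> 0) (at_right 0)"
    and H5: "((\<lambda>\<xi>. sup_norm01 (\<lambda>r. f r \<xi> / phi p \<xi> - f_inf r)) \<longlongrightarrow> 0) at_top"
    and lam0_eig: "principal_eigenvalue N p f0 lam0"
    and H6_lam_inf: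
      "((\<forall>r\<in>{0..1}. f_inf r > 0) \<and> (\<exists>\<mu>. principal_eigenvalue N p f_inf \<mu> \<and> lam_inf = ereal \<mu>)) \<or>
       (N = 1 \<and> (\<forall>r\<in>{0..1}. f_inf r = 0) \<and> lam_inf = \<infinity>)"
  shows "\<exists>u :: real \<Rightarrow> (real \<Rightarrow>\<^sub>C real).
      u ` einterval (ereal lam0) lam_inf \<subseteq> C0_01 \<and>
      u C1_differentiable_on einterval (ereal lam0) lam_inf \<and>
      (\<forall>\<mu>\<in>einterval (ereal lam0) lam_inf.
         apply_bcontfun (u \<mu>) \<in> X p \<and>
         (\<forall>r\<in>{0..<1}. apply_bcontfun (u \<mu>) r > 0) \<and>
         is_solution N p f \<mu> (apply_bcontfun (u \<mu>)) \<and> nontrivial01 (apply_bcontfun (u \<mu>)) \<and>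
         (\<forall>v. is_solution N p f \<mu> v \<and> nontrivial01 v \<longrightarrow>
            (\<forall>r\<in>{0..1}. v r = apply_bcontfun (u \<mu>) r))) \<and>
      ((\<lambda>\<mu>. norm (u \<mu>)) \<longlongrightarrow> 0) (at_right lam0) \<and>
      filterlim (\<lambda>x. norm (u (real_of_ereal x))) at_top (at_left lam_inf)"
proof -
  have rad: "radial N p" using N p by unfold_locales
  have phi_eq: "phi p x = x powr (p - 1)" if "0 < x" for x
    using radial.phi_nonneg[OF rad] that by simp
  have f_c: "continuous_on ({0..1} \<times> UNIV) (\<lambda>(t, x). f t x)"
    by (rule continuous_on_subset[OF f_cont]) auto
  have f_c1: "continuous_on {0..1} (\<lambda>t. f t x)" for x
  proof -
    have "continuous_on {0..1} (\<lambda>t. (\<lambda>(t, x). f t x) (t, x))"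
      by (rule continuous_on_compose2[OF f_c]) (auto intro!: continuous_intros)
    then show ?thesis by simp
  qed
  have pos0: "eventually (\<lambda>x::real. 0 < x) (at_right 0)" by (simp add: eventually_at_right_less)
  have pos_top: "eventually (\<lambda>x::real. 0 < x) at_top" by (rule eventually_gt_at_top)
  have cont_quot: "continuous_on {0..1} (\<lambda>t. f t x / phi p x - c t)"
    if "0 < x" "continuous_on {0..1} c" for x c
    using that by (intro continuous_intros f_c1) (auto simp: phi_eq)
  \<comment> \<open>(H4) and (H5) enter as uniform estimates, and phi p x is replaced by x^(p-1),
    since both limits run through x > 0.\<close>
  interpret bvp N p f "\<lambda>t. deriv (f t)" f0 f_inf
  proof (intro bvp.intro nonlinearity.intro rad nonlinearity_axioms.intro bvp_axioms.intro f_c H1(2) f0_lim(2) f_inf_lim(2))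
    fix t x :: real assume t: "t \<in> {0..1}"
    from H1(1) t obtain D where "(f t has_vector_derivative D x) (at x)"
      unfolding C1_differentiable_on_def by blast
    then have "(f t has_real_derivative D x) (at x)"
      by (simp add: has_real_derivative_iff_has_vector_derivative)
    then show "(f t has_real_derivative deriv (f t) x) (at x)"
      using DERIV_imp_deriv by metis
    show "0 < f t x" if "x \<noteq> 0" using H2(1) t that by blast
    show "f t 0 = 0" using H2(2) t by blast
    show "deriv (f t) x * x \<le> (p - 1) * f t x" if "0 \<le> x" using H3(1) t that by blast
    show "((\<lambda>x. f t x / x powr (p - 1)) \<longlongrightarrow> f0 t) (at_right 0)"
      by (rule Lim_transform_eventually[OF bspec[OF f0_lim(1) t]])
         (rule eventually_mono[OF pos0], simp add: phi_eq)
    show "((\<lambda>x. f t x / x powr (p - 1)) \<longlongrightarrow> f_inf t) at_top"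
      by (rule Lim_transform_eventually[OF bspec[OF f_inf_lim(1) t]])
         (rule eventually_mono[OF pos_top], simp add: phi_eq)
  next
    fix e :: real assume e: "0 < e"
    have "eventually (\<lambda>x. \<forall>t\<in>{0..1}. \<bar>f t x / phi p x - f0 t\<bar> < e) (at_right 0)"
      by (rule sup_norm01_tendsto_0D[OF H4(1) _ e])
         (rule eventually_mono[OF pos0], intro cont_quot f0_lim(2))
    then show "eventually (\<lambda>x. \<forall>t\<in>{0..1}. \<bar>f t x / x powr (p - 1) - f0 t\<bar> < e) (at_right 0)"
      using pos0 by eventually_elim (simp add: phi_eq)
    have "eventually (\<lambda>x. \<forall>t\<in>{0..1}. \<bar>f t x / phi p x - f_inf t\<bar> < e) at_top"
      by (rule sup_norm01_tendsto_0D[OF H5 _ e])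
         (rule eventually_mono[OF pos_top], intro cont_quot f_inf_lim(2))
    then show "eventually (\<lambda>x. \<forall>t\<in>{0..1}. \<bar>f t x / x powr (p - 1) - f_inf t\<bar> < e) at_top"
      using pos_top by eventually_elim (simp add: phi_eq)
  qed (rule H3(2))
  obtain v where l0: "0 < lam0" and v: "eigenprofile f0 lam0 v"
    using principal_eigenvalue_profile[OF f0_cont f0_pos lam0_eig] by blast
  from H6_lam_inf show ?thesis
  proof
    assume "(\<forall>r\<in>{0..1}. f_inf r > 0) \<and> (\<exists>\<mu>. principal_eigenvalue N p f_inf \<mu> \<and> lam_inf = ereal \<mu>)"
    then obtain \<mu> where pos: "\<And>t. t \<in> {0..1} \<Longrightarrow> 0 < f_inf t"
      and ev: "principal_eigenvalue N p f_inf \<mu>" and \<mu>: "lam_inf = ereal \<mu>" by blast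
    obtain w where m: "0 < \<mu>" and w: "eigenprofile f_inf \<mu> w"
      using principal_eigenvalue_profile[OF finf_cont pos ev] by blast
    have "ereal lam0 < lam_inf" using l0_less_linf[OF l0 v pos m w] by (simp add: \<mu>)
    then show ?thesis
      using branch.curve_exists[OF branch_asymptotically_linear[OF l0 v pos m w]] by (simp only: \<mu>)
  next
    assume b: "N = 1 \<and> (\<forall>r\<in>{0..1}. f_inf r = 0) \<and> lam_inf = \<infinity>"
    then have zero: "\<And>t. t \<in> {0..1} \<Longrightarrow> f_inf t = 0" and li: "lam_inf = \<infinity>" by auto
    have "ereal lam0 < lam_inf" by (simp add: li)
    then show ?thesis
      using branch.curve_exists[OF branch_sublinear[OF l0 v zero]] by (simp only: li)
  qed
qed

end
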